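(* Let $K$ be a number field of degree $m=[K:\mathbb{Q}]<\infty$, let $S$ be a finite set of places of $K$ containing all the archimedean places, let $s$ be the cardinality of $S$, and let $U_S$ be the group of $S$-units of $K$. Let $\lambda,\mu\in K\setminus\{0\}$. Then the equation $$\lambda x+\mu y=1$$ has at most $$\left(3.1+5\,(3.4)^{m}\right)\cdot 45^{s}$$ solutions $(x,y)\in U_S^2$.
   Context: $U_S$ is the set of $x\in K\setminus\{0\}$ with $|x|_v=1$ for every place $v$ of $K$ not in $S$. The cardinality $s$ counts all places in $S$, archimedean ones included. *)

theory Defs
  imports Complex_Main
begin

global_interpretation rat_vs: vector_space "\<lambda>(q::rat) (x::'k::field_char_0). of_rat q * x"
  by unfold_locales (simp_all add: of_rat_add of_rat_mult algebra_simps)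

definition number_field :: "'k::field_char_0 itself \<Rightarrow> bool" where
  "number_field _ \<longleftrightarrow> (\<exists>B :: 'k set. finite B \<and> rat_vs.span B = UNIV)"

definition field_degree :: "'k::field_char_0 itself \<Rightarrow> nat" where
  "field_degree _ = rat_vs.dim (UNIV :: 'k set)"

definition absolute_value :: "('k::field \<Rightarrow> real) \<Rightarrow> bool" where
  "absolute_value f \<longleftrightarrow>
     (\<forall>x. 0 \<le> f x) \<and> (\<forall>x. f x = 0 \<longleftrightarrow> x = 0) \<and>
     (\<forall>x y. f (x * y) = f x * f y) \<and> (\<forall>x y. f (x + y) \<le> f x + f y)"

definition nontrivial_absolute_values :: "('k::field \<Rightarrow> real) set" where
  "nontrivial_absolute_values = {f. absolute_value f \<and> (\<exists>x. x \<noteq> 0 \<and> f x \<noteq> 1)}"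

definition absolute_value_equiv :: "(('k::field \<Rightarrow> real) \<times> ('k \<Rightarrow> real)) set" where
  "absolute_value_equiv =
     {(f, g). f \<in> nontrivial_absolute_values \<and> g \<in> nontrivial_absolute_values \<and>
              (\<exists>c>0. \<forall>x. g x = f x powr c)}"

lemma equiv_absolute_value_equiv:
  "equiv nontrivial_absolute_values (absolute_value_equiv :: (('k::field \<Rightarrow> real) \<times> _) set)"
proof (rule equivI)
  show "(absolute_value_equiv :: (('k \<Rightarrow> real) \<times> _) set)
          \<subseteq> nontrivial_absolute_values \<times> nontrivial_absolute_values"
    by (auto simp: absolute_value_equiv_def)
  show "refl_on nontrivial_absolute_values (absolute_value_equiv :: (('k \<Rightarrow> real) \<times> _) set)"
    by (auto simp: refl_on_def absolute_value_equiv_def nontrivial_absolute_values_def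
                   absolute_value_def intro!: exI[of _ 1])
  show "sym (absolute_value_equiv :: (('k \<Rightarrow> real) \<times> _) set)"
  proof (rule symI)
    fix f g :: "'k \<Rightarrow> real"
    assume "(f, g) \<in> absolute_value_equiv"
    then obtain c where f: "f \<in> nontrivial_absolute_values" and g: "g \<in> nontrivial_absolute_values"
      and c: "c > 0" "\<forall>x. g x = f x powr c"
      by (auto simp: absolute_value_equiv_def)
    have "\<forall>x. f x = g x powr (1 / c)"
      using f c by (auto simp: powr_powr nontrivial_absolute_values_def absolute_value_def)
    with f g c show "(g, f) \<in> absolute_value_equiv"
      unfolding absolute_value_equiv_def by (auto intro!: exI[of _ "1 / c"])
  qed
  show "trans (absolute_value_equiv :: (('k \<Rightarrow> real) \<times> _) set)"
  proof (rule transI)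
    fix f g h :: "'k \<Rightarrow> real"
    assume "(f, g) \<in> absolute_value_equiv" "(g, h) \<in> absolute_value_equiv"
    then obtain c d where "f \<in> nontrivial_absolute_values" "h \<in> nontrivial_absolute_values"
      "c > 0" "d > 0" "\<forall>x. g x = f x powr c" "\<forall>x. h x = g x powr d"
      by (auto simp: absolute_value_equiv_def)
    then show "(f, h) \<in> absolute_value_equiv"
      unfolding absolute_value_equiv_def by (auto simp: powr_powr intro!: exI[of _ "c * d"])
  qed
qed

definition places :: "('k::field \<Rightarrow> real) set set" where
  "places = nontrivial_absolute_values // absolute_value_equiv"

definition archimedean :: "('k::field \<Rightarrow> real) set \<Rightarrow> bool" where
  "archimedean v \<longleftrightarrow> (\<exists>f\<in>v. \<exists>x y. f (x + y) > max (f x) (f y))"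

text \<open>
  The condition that \<open>x\<close> has absolute value \<open>1\<close> at a place does not depend on the representative
  (lemma \<open>place_eq_1_iff\<close>), so no normalisation of the absolute values needs to be chosen.
\<close>
definition S_units :: "('k::field \<Rightarrow> real) set set \<Rightarrow> 'k set" where
  "S_units S = {x. x \<noteq> 0 \<and> (\<forall>v\<in>places - S. \<forall>f\<in>v. f x = 1)}"

lemma place_eq_1_iff:
  assumes "v \<in> places" "f \<in> v" "g \<in> v"
  shows "f x = 1 \<longleftrightarrow> g x = 1"
proof -
  have *: "f' x = 1 \<Longrightarrow> g' x = 1" if "(f', g') \<in> absolute_value_equiv" for f' g'
    using that by (auto simp: absolute_value_equiv_def)
  have "(f, g) \<in> absolute_value_equiv" "(g, f) \<in> absolute_value_equiv"
    using assms equiv_absolute_value_equiv unfolding places_def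
    by (metis quotient_eq_iff)+
  then show ?thesis using * by blast
qed

lemma place_archimedean_iff:
  assumes "v \<in> places" "f \<in> v"
  shows "archimedean v \<longleftrightarrow> (\<exists>x y. f (x + y) > max (f x) (f y))"
proof -
  have *: "\<exists>x y. h (x + y) > max (h x) (h y)"
    if "g \<in> v" "h \<in> v" "g (x + y) > max (g x) (g y)" for g h x y
  proof -
    have "(g, h) \<in> absolute_value_equiv"
      using assms that equiv_absolute_value_equiv unfolding places_def by (metis quotient_eq_iff)
    then obtain c where g: "absolute_value g" and "c > 0" "\<forall>x. h x = g x powr c"
      by (auto simp: absolute_value_equiv_def nontrivial_absolute_values_def)
    then have "h x < h (x + y)" "h y < h (x + y)"
      using that(3) by (auto simp: absolute_value_def intro!: powr_less_mono2)
    then show ?thesis by auto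
  qed
  then show ?thesis using assms unfolding archimedean_def by blast
qed

end

theory Submission
  imports Defs "HOL-Computational_Algebra.Computational_Algebra" "HOL-Library.FuncSet" "Jordan_Normal_Form.Determinant"
begin

text \<open>
  A solution is regarded as a triple \<open>x = (lam * a, mu * b, -1)\<close> with sum zero. At every place \<open>v\<close>
  let \<open>m\<close> be the smallest of the \<open>\<bar>x\<^sub>i\<bar>\<close> and \<open>M\<close> the geometric mean of the other two. With normalised
  weights \<open>w\<^sub>v\<close> the height is \<open>h = \<Sum> w\<^sub>v ln M\<close>; by the product formula the nonnegative numbers
  \<open>a\<^sub>v = w\<^sub>v ln (M / m)\<close> add up to \<open>3 h\<close>. Two distinct triples have a non-zero determinant
  \<open>x\<^sub>0 y\<^sub>1 - x\<^sub>1 y\<^sub>0\<close>, whose absolute values are small wherever both triples have the same smallest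
  coordinate. Solutions are sorted into classes according to the position of the smallest coordinate,
  the angular sector of \<open>x\<^sub>i / (x\<^sub>i\<^sub>+\<^sub>1 - x\<^sub>i\<^sub>+\<^sub>2)\<close> at archimedean places, and the approximate proportions
  \<open>a\<^sub>v / 3 h\<close>. Within a class the product formula for the determinant gives the gap principle
  \<open>h(y) \<ge> 1.55 h(x) - 1/8\<close>, while determinants of \<open>y\<close> with Pade forms \<open>P(x)\<close> of degree \<open>3 N\<close> exclude
  \<open>h(y)\<close> from a range far beyond \<open>h(x)\<close>; hence a class has at most 21 members with \<open>h \<ge> 3/5\<close>. Solutions of
  smaller height are separated by a finite grid at the archimedean places.

  All absolute values are realised through the embeddings into the complex numbers and one extension
  of each \<open>p\<close>-adic absolute value to the algebraic numbers, so that the product formula reduces to the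
  one for the rational norm.
\<close>

section \<open>Extending \<open>p\<close>-adic absolute values to algebraic numbers\<close>

text \<open>The constants come from one trade-off. Rounding the proportions costs less than one unit
  per place of \<open>S\<close>, so \<open>n\<close> levels retain a share
  \<open>n / (n + s)\<close>. Demanding the share 2.55 / 3 makes \<open>n\<close> about
  \<open>17 * s / 3\<close> and gives the growth factor 1.55 = 2.55 - 1. Since a positive level
  comes with three positions of the smallest coordinate and level 0 with a single type, counting
  then costs 45/16 * (1 + 5 * 3) = 45 per nonarchimedean place. The obstacle is that a gap principle
  alone lets the heights in a class grow forever. The Pade forms stop this: they have degree
  \<open>3 * N\<close> in \<open>x\<close>, but coordinate \<open>i\<close> is divisible by
  \<open>x i ^ (2 * N)\<close>, so their determinant with \<open>y\<close> is small wherever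
  \<open>x\<close> and \<open>y\<close> share the smallest coordinate. With \<open>N\<close> close
  to 1.55 h(y) / (3 h(x) + ln 10) this contradicts the product formula once h(y) is far beyond h(x).
  A single Pade form could be proportional to \<open>y\<close>; of two with different exponents, one
  is not. The count of level vectors starts at two places. If only one place is available, all
  S-units have absolute value 1 there and the solutions lie on the intersection of two
  circles.\<close>

definition is_subring :: "'a::field_char_0 set \<Rightarrow> bool" where
  "is_subring A \<longleftrightarrow> 1 \<in> A \<and> (\<forall>x\<in>A. \<forall>y\<in>A. x - y \<in> A \<and> x * y \<in> A)"

lemma is_subringD:
  assumes "is_subring A"
  shows "1 \<in> A" "0 \<in> A" "x \<in> A \<Longrightarrow> y \<in> A \<Longrightarrow> x - y \<in> A" "x \<in> A \<Longrightarrow> y \<in> A \<Longrightarrow> x * y \<in> A"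
    "x \<in> A \<Longrightarrow> y \<in> A \<Longrightarrow> x + y \<in> A" "x \<in> A \<Longrightarrow> - x \<in> A"
    "x \<in> A \<Longrightarrow> x ^ n \<in> A" "of_nat n \<in> A" "of_int k \<in> A"
proof -
  have A: "1 \<in> A" "\<And>x y. x \<in> A \<Longrightarrow> y \<in> A \<Longrightarrow> x - y \<in> A" "\<And>x y. x \<in> A \<Longrightarrow> y \<in> A \<Longrightarrow> x * y \<in> A"
    using assms unfolding is_subring_def by auto
  have z: "0 \<in> A" using A(2)[OF A(1) A(1)] by simp
  have m: "\<And>x. x \<in> A \<Longrightarrow> - x \<in> A" using A(2)[OF z] by force
  have p: "\<And>x y. x \<in> A \<Longrightarrow> y \<in> A \<Longrightarrow> x + y \<in> A" using A(2) m by (metis diff_minus_eq_add)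
  have n: "of_nat n \<in> A" for n by (induction n) (auto simp: z A p)
  show "1 \<in> A" "0 \<in> A" "x \<in> A \<Longrightarrow> y \<in> A \<Longrightarrow> x - y \<in> A" "x \<in> A \<Longrightarrow> y \<in> A \<Longrightarrow> x * y \<in> A"
    "x \<in> A \<Longrightarrow> y \<in> A \<Longrightarrow> x + y \<in> A" "x \<in> A \<Longrightarrow> - x \<in> A" "of_nat n \<in> A" "of_int k \<in> A"
    using A z m p n by (auto, cases k, auto)
  show "x \<in> A \<Longrightarrow> x ^ n \<in> A" by (induction n) (auto simp: A)
qed

lemma is_subring_sum: "is_subring A \<Longrightarrow> (\<And>i. i \<in> I \<Longrightarrow> f i \<in> A) \<Longrightarrow> sum f I \<in> A"
  by (induction I rule: infinite_finite_induct) (auto simp: is_subringD)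

text \<open>Zorn's lemma, started at \<open>\<int>\<close>. A maximal member turns out to be a
  valuation ring of the whole field in which \<open>p\<close> is not invertible, hence a source of
  an extension of the \<open>p\<close>-adic absolute value.\<close>

lemma exists_maximal_subring_avoiding:
  assumes p: "prime p"
  obtains A :: "'a::field_char_0 set" where "is_subring A" "inverse (of_nat p) \<notin> A"
    "\<And>B. is_subring B \<Longrightarrow> A \<subseteq> B \<Longrightarrow> inverse (of_nat p) \<notin> B \<Longrightarrow> B = A"
proof -
  let ?S = "{A :: 'a set. is_subring A \<and> inverse (of_nat p) \<notin> A}"
  have "inverse (of_nat p) \<notin> (\<int> :: 'a set)"
  proof
    assume "inverse (of_nat p) \<in> (\<int> :: 'a set)"
    then obtain k where k: "inverse (of_nat p :: 'a) = of_int k" by (auto elim: Ints_cases)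
    have "(of_int (int p * k) :: 'a) = of_int 1"
      using k p prime_gt_0_nat[OF p] by (simp flip: k)
    then have "int p * k = 1" by (simp only: of_int_eq_iff)
    then have "p dvd 1" by (metis dvd_triv_left int_dvd_int_iff of_nat_1)
    then show False using p by auto
  qed
  then have "?S \<noteq> {}" by (auto simp: is_subring_def intro!: exI[of _ \<int>])
  moreover have "\<Union>C \<in> ?S" if C: "C \<noteq> {}" "subset.chain ?S C" for C
  proof -
    have "is_subring (\<Union>C)" unfolding is_subring_def
    proof (intro conjI ballI)
      show "1 \<in> \<Union>C" using C by (auto simp: subset.chain_def is_subring_def)
      fix x y assume "x \<in> \<Union>C" "y \<in> \<Union>C"
      then obtain X Y where XY: "X \<in> C" "Y \<in> C" "x \<in> X" "y \<in> Y" by auto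
      then have "X \<subseteq> Y \<or> Y \<subseteq> X" using C by (auto simp: subset_chain_def)
      then obtain Z where "Z \<in> C" "x \<in> Z" "y \<in> Z" using XY by blast
      moreover have "is_subring Z" using \<open>Z \<in> C\<close> C by (auto simp: subset_chain_def)
      ultimately show "x - y \<in> \<Union>C" "x * y \<in> \<Union>C" using is_subringD(3,4) by blast+
    qed
    then show ?thesis using C by (auto simp: subset_chain_def)
  qed
  ultimately obtain M where "M \<in> ?S" "\<forall>X\<in>?S. M \<subseteq> X \<longrightarrow> X = M"
    using subset_Zorn_nonempty[of ?S] by blast
  then show ?thesis using that by blast
qed

text \<open>The ring A[z] is filtered by degree because the descent behind
  \<open>valuation_ring\<close> lowers this degree.\<close>

definition adjoin :: "'a::field_char_0 set \<Rightarrow> 'a \<Rightarrow> nat \<Rightarrow> 'a set" where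
  "adjoin A z n = {\<Sum>i\<le>n. a i * z ^ i |a. \<forall>i. a i \<in> A}"

lemma adjoin_mono:
  assumes "is_subring A" "m \<le> n"
  shows "adjoin A z m \<subseteq> adjoin A z n"
proof
  fix x assume "x \<in> adjoin A z m"
  then obtain a where a: "x = (\<Sum>i\<le>m. a i * z ^ i)" "\<forall>i. a i \<in> A" by (auto simp: adjoin_def)
  have "x = (\<Sum>i\<le>n. (if i \<le> m then a i else 0) * z ^ i)"
    unfolding a using assms(2) by (intro sum.mono_neutral_cong_left) auto
  then show "x \<in> adjoin A z n" using a(2) is_subringD(2)[OF assms(1)]
    unfolding adjoin_def by (auto intro!: exI[of _ "\<lambda>i. if i \<le> m then a i else 0"])
qed

lemma is_subring_adjoin:
  assumes A: "is_subring A"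
  shows "is_subring (\<Union>n. adjoin A z n)" "A \<subseteq> (\<Union>n. adjoin A z n)" "z \<in> (\<Union>n. adjoin A z n)"
proof -
  show sub: "A \<subseteq> (\<Union>n. adjoin A z n)"
  proof
    fix x assume "x \<in> A"
    then have "x \<in> adjoin A z 0" unfolding adjoin_def by (intro CollectI exI[of _ "\<lambda>_. x"]) simp
    then show "x \<in> (\<Union>n. adjoin A z n)" by blast
  qed
  have "z = (\<Sum>i\<le>1. (if i = 1 then 1 else 0) * z ^ i)" by simp
  then show "z \<in> (\<Union>n. adjoin A z n)" 
    using is_subringD(1,2)[OF A] unfolding adjoin_def
    by (intro UN_I[of 1] CollectI exI[of _ "\<lambda>i. if i = 1 then 1 else 0"]) auto
  show "is_subring (\<Union>n. adjoin A z n)" unfolding is_subring_def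
  proof (intro conjI ballI)
    show "1 \<in> (\<Union>n. adjoin A z n)" using sub is_subringD(1)[OF A] by blast
    fix x y assume "x \<in> (\<Union>n. adjoin A z n)" "y \<in> (\<Union>n. adjoin A z n)"
    then obtain k l where "x \<in> adjoin A z k" "y \<in> adjoin A z l" by auto
    then have "x \<in> adjoin A z (max k l)" "y \<in> adjoin A z (max k l)"
      using adjoin_mono[OF A] by (meson max.cobounded1 max.cobounded2 subsetD)+
    then obtain n a b where ab: "x = (\<Sum>i\<le>n. a i * z ^ i)" "y = (\<Sum>i\<le>n. b i * z ^ i)"
      "\<forall>i. a i \<in> A" "\<forall>i. b i \<in> A" by (auto simp: adjoin_def)
    have "x - y = (\<Sum>i\<le>n. (a i - b i) * z ^ i)" by (simp add: ab algebra_simps sum_subtractf)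
    moreover have "\<forall>i. a i - b i \<in> A" using ab(3,4) is_subringD(3)[OF A] by simp
    ultimately have "x - y \<in> adjoin A z n" unfolding adjoin_def by (intro CollectI exI[of _ "\<lambda>i. a i - b i"] conjI)
    then show "x - y \<in> (\<Union>n. adjoin A z n)" by blast
    define a' b' where "a' = (\<lambda>i. if i \<le> n then a i else 0)" and "b' = (\<lambda>i. if i \<le> n then b i else 0)"
    have *: "x = (\<Sum>i\<le>n. a' i * z ^ i)" "y = (\<Sum>i\<le>n. b' i * z ^ i)" by (auto simp: ab a'_def b'_def)
    have "x * y = (\<Sum>r\<le>n + n. (\<Sum>k\<le>r. a' k * b' (r - k)) * z ^ r)"
      unfolding * by (rule polynomial_product) (auto simp: a'_def b'_def)
    moreover have "\<forall>r. (\<Sum>k\<le>r. a' k * b' (r - k)) \<in> A"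
      using ab is_subringD(2,4)[OF A] by (auto simp: a'_def b'_def intro!: is_subring_sum[OF A])
    ultimately have "x * y \<in> adjoin A z (n + n)" unfolding adjoin_def by (intro CollectI exI conjI)
    then show "x * y \<in> (\<Union>n. adjoin A z n)" by blast
  qed
qed

section \<open>A maximal subring avoiding 1/p is a valuation ring\<close>

locale maximal_subring =
  fixes A :: "'a::field_char_0 set" and p :: nat
  assumes prime_p: "prime p" and subring: "is_subring A" and inverse_p: "inverse (of_nat p) \<notin> A"
    and maximal: "\<And>B. is_subring B \<Longrightarrow> A \<subseteq> B \<Longrightarrow> inverse (of_nat p) \<notin> B \<Longrightarrow> B = A"
begin

lemmas A_intros = is_subringD[OF subring]

lemma p_nonzero: "(of_nat p :: 'a) \<noteq> 0" using prime_p by auto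

lemma adjoin_not_mem: "z \<notin> A \<Longrightarrow> \<exists>n. inverse (of_nat p) \<in> adjoin A z n"
  using maximal[OF is_subring_adjoin(1,2)[OF subring], of z] is_subring_adjoin(3)[OF subring, of z] by blast

text \<open>Write c for 1 - p a. If 1/c were not in \<open>A\<close>, then 1/p would lie in A[1/c];
  multiplying by p c^n puts c^n into p A. But c^n is congruent to 1 modulo p A, so 1 would lie in p
  A.\<close>

lemma inverse_one_minus_p:
  assumes a: "a \<in> A"
  shows "1 - of_nat p * a \<noteq> 0" "inverse (1 - of_nat p * a) \<in> A"
proof -
  let ?c = "1 - of_nat p * a"
  have no: "1 \<noteq> of_nat p * x" if "x \<in> A" for x
    using inverse_p that inverse_unique[of "of_nat p" x] by auto
  show c: "?c \<noteq> 0" using no[OF a] by simp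
  show "inverse ?c \<in> A"
  proof (rule ccontr)
    assume "inverse ?c \<notin> A"
    then obtain n b where b: "inverse (of_nat p) = (\<Sum>i\<le>n. b i * inverse ?c ^ i)" "\<forall>i. b i \<in> A"
      using adjoin_not_mem unfolding adjoin_def by blast
    have "?c ^ n = of_nat p * (?c ^ n * inverse (of_nat p))" using p_nonzero by simp
    also have "?c ^ n * inverse (of_nat p) = (\<Sum>i\<le>n. b i * ?c ^ (n - i))"
      unfolding b(1) sum_distrib_left 
      using c by (intro sum.cong refl) (simp add: power_diff power_inverse divide_inverse)
    finally have 1: "?c ^ n = of_nat p * (\<Sum>i\<le>n. b i * ?c ^ (n - i))" .
    have cA: "?c ^ k \<in> A" for k using a by (intro A_intros) auto
    have "\<exists>a'\<in>A. ?c ^ k = 1 - of_nat p * a'" for k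
    proof (induction k)
      case 0 then show ?case using A_intros(2) by force
    next
      case (Suc k)
      then obtain a' where a': "a' \<in> A" "?c ^ k = 1 - of_nat p * a'" by auto
      have "?c ^ Suc k = 1 - of_nat p * (a + a' - of_nat p * (a * a'))"
        unfolding power_Suc a'(2) by (simp add: algebra_simps)
      moreover have "a + a' - of_nat p * (a * a') \<in> A" using a a'(1) by (intro A_intros)
      ultimately show ?case by blast
    qed
    then obtain a' where "a' \<in> A" "?c ^ n = 1 - of_nat p * a'" by blast
    with 1 have "1 = of_nat p * (a' + (\<Sum>i\<le>n. b i * ?c ^ (n - i)))" by (simp add: algebra_simps)
    moreover have "a' + (\<Sum>i\<le>n. b i * ?c ^ (n - i)) \<in> A"
      using \<open>a' \<in> A\<close> b(2) cA by (intro A_intros(5) is_subring_sum[OF subring] A_intros(4)) auto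
    ultimately show False using no by blast
  qed
qed

text \<open>In the relation for 1/z the factor \<open>1 - of_nat p * b 0\<close> is a unit of
  \<open>A\<close>. Dividing by it and multiplying by \<open>z ^ n\<close> expresses
  \<open>z ^ n\<close> through the powers from \<open>z ^ (n - m)\<close> to
  \<open>z ^ (n - 1)\<close>, which removes the top term of the relation for
  \<open>z\<close>.\<close>

lemma adjoin_lower:
  assumes z: "z \<noteq> 0" and P: "inverse (of_nat p) \<in> adjoin A z n" 
    and Q: "inverse (of_nat p) \<in> adjoin A (inverse z) m" and "m \<le> n" "0 < n"
  shows "inverse (of_nat p) \<in> adjoin A z (n - 1)"
proof -
  obtain a where a: "inverse (of_nat p) = (\<Sum>i\<le>n. a i * z ^ i)" "\<forall>i. a i \<in> A"
    using P by (auto simp: adjoin_def)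
  obtain b where b: "inverse (of_nat p) = (\<Sum>i\<le>m. b i * inverse z ^ i)" "\<forall>i. b i \<in> A"
    using Q by (auto simp: adjoin_def)
  define u where "u = inverse (1 - of_nat p * b 0)"
  have u: "u \<in> A" "u * (1 - of_nat p * b 0) = 1"
    using inverse_one_minus_p[of "b 0"] b(2) by (auto simp: u_def)
  have "1 = of_nat p * (\<Sum>i\<le>m. b i * inverse z ^ i)" using p_nonzero by (simp flip: b(1))
  also have "(\<Sum>i\<le>m. b i * inverse z ^ i) = b 0 + (\<Sum>i\<in>{1..m}. b i * inverse z ^ i)"
    by (subst sum.atMost_shift) (simp add: sum.atLeast1_atMost_eq)
  finally have "1 - of_nat p * b 0 = of_nat p * (\<Sum>i\<in>{1..m}. b i * inverse z ^ i)"
    by (simp add: algebra_simps)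
  then have "1 = u * (of_nat p * (\<Sum>i\<in>{1..m}. b i * inverse z ^ i))" using u(2) by simp
  then have "z ^ n = z ^ n * (u * (of_nat p * (\<Sum>i\<in>{1..m}. b i * inverse z ^ i)))" by simp
  also have "\<dots> = (\<Sum>i\<in>{1..m}. u * of_nat p * b i * z ^ (n - i))"
    using z \<open>m \<le> n\<close> by (simp add: sum_distrib_left power_diff field_simps)
  also have "\<dots> = (\<Sum>i\<in>{n-m..n-1}. u * of_nat p * b (n - i) * z ^ i)"
    using \<open>m \<le> n\<close> \<open>0 < n\<close>
    by (intro sum.reindex_bij_witness[of _ "\<lambda>i. n - i" "\<lambda>i. n - i"]) auto
  also have "\<dots> = (\<Sum>i\<le>n-1. (if n - m \<le> i then u * of_nat p * b (n - i) else 0) * z ^ i)"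
    by (intro sum.mono_neutral_cong_left) auto
  finally have zn: "z ^ n = (\<Sum>i\<le>n-1. (if n - m \<le> i then u * of_nat p * b (n - i) else 0) * z ^ i)" .
  have "{..n} = insert n {..n-1}" using \<open>0 < n\<close> by auto
  then have "inverse (of_nat p) = (\<Sum>i\<le>n-1. a i * z ^ i) + a n * z ^ n"
    unfolding a(1) using \<open>0 < n\<close> by simp
  also have "\<dots> = (\<Sum>i\<le>n-1. (a i + a n * (if n - m \<le> i then u * of_nat p * b (n - i) else 0)) * z ^ i)"
    unfolding zn by (simp add: sum_distrib_left sum.distrib[symmetric] algebra_simps)
  moreover have "\<forall>i. a i + a n * (if n - m \<le> i then u * of_nat p * b (n - i) else 0) \<in> A"
    using a(2) b(2) u(1) by (auto intro!: A_intros)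
  ultimately show ?thesis unfolding adjoin_def mem_Collect_eq
    by (intro exI[of _ "\<lambda>i. a i + a n * (if n - m \<le> i then u * of_nat p * b (n - i) else 0)"] conjI) simp_all
qed

text \<open>Otherwise 1/p is a polynomial over \<open>A\<close> in z and also in 1/z.
  \<open>adjoin_lower\<close> shortens the longer of the two until one has degree 0, and then 1/p
  lies in \<open>A\<close>.\<close>

lemma valuation_ring:
  assumes "z \<notin> A" "inverse z \<notin> A"
  shows False
proof -
  have z: "z \<noteq> 0" using A_intros(2) assms(1) by auto
  have not0: "inverse (of_nat p) \<notin> adjoin A y 0" for y using inverse_p by (auto simp: adjoin_def)
  have key: "inverse (of_nat p) \<in> adjoin A y n \<Longrightarrow> inverse (of_nat p) \<in> adjoin A (inverse y) m \<Longrightarrow>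
     y \<noteq> 0 \<Longrightarrow> False" for y n m
  proof (induction "n + m" arbitrary: n m y rule: less_induct)
    case less
    then have "n \<noteq> 0" "m \<noteq> 0" using not0 by (metis (full_types))+
    consider "m \<le> n" | "n \<le> m" by linarith
    then show False
    proof cases
      case 1
      then have "inverse (of_nat p) \<in> adjoin A y (n - 1)"
        using adjoin_lower[of y n m] less.prems \<open>n \<noteq> 0\<close> by blast
      then show False using less.hyps[of "n - 1" m y] less.prems \<open>n \<noteq> 0\<close> by simp
    next
      case 2
      then have "inverse (of_nat p) \<in> adjoin A (inverse y) (m - 1)"
        using adjoin_lower[of "inverse y" m n] less.prems \<open>m \<noteq> 0\<close> by simp
      then show False using less.hyps[of n "m - 1" y] less.prems \<open>m \<noteq> 0\<close> by simp
    qed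
  qed
  show False using key[of z] adjoin_not_mem[OF assms(1)] adjoin_not_mem[OF assms(2)] z by blast
qed

section \<open>The real absolute value attached to the valuation ring\<close>

definition U :: "'a set" where "U = {u\<in>A. u \<noteq> 0 \<and> inverse u \<in> A}"

lemma U_intros: "1 \<in> U" "u \<in> U \<Longrightarrow> v \<in> U \<Longrightarrow> u * v \<in> U" "u \<in> U \<Longrightarrow> inverse u \<in> U"
  "u \<in> U \<Longrightarrow> u ^ n \<in> U" "-1 \<in> U" "u \<in> U \<Longrightarrow> u powi k \<in> U"
proof -
  show 1: "1 \<in> U" "-1 \<in> U" using A_intros by (auto simp: U_def)
  show 2: "u \<in> U \<Longrightarrow> v \<in> U \<Longrightarrow> u * v \<in> U" for u v using A_intros by (auto simp: U_def)
  show 3: "u \<in> U \<Longrightarrow> inverse u \<in> U" for u by (auto simp: U_def)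
  show 4: "u \<in> U \<Longrightarrow> u ^ n \<in> U" for n u by (induction n) (auto simp: 1 2)
  show "u \<in> U \<Longrightarrow> u powi k \<in> U" using 3 4 by (auto simp: power_int_def)
qed

lemma p_powi_unit:
  assumes "(of_nat p :: 'a) powi k \<in> U"
  shows "k = 0"
proof -
  have *: "(of_nat p :: 'a) powi int n \<notin> U" if "n > 0" for n
  proof
    assume "(of_nat p :: 'a) powi int n \<in> U"
    then have "inverse ((of_nat p :: 'a) ^ n) \<in> A" by (simp add: U_def)
    then have "of_nat p ^ (n - 1) * inverse ((of_nat p :: 'a) ^ n) \<in> A" by (intro A_intros)
    moreover have "of_nat p ^ (n - 1) * inverse ((of_nat p :: 'a) ^ n) = inverse (of_nat p)"
      using that p_nonzero by (cases n) (auto simp: field_simps)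
    ultimately show False using inverse_p by simp
  qed
  show ?thesis
  proof (rule ccontr)
    assume "k \<noteq> 0"
    have "(of_nat p :: 'a) powi int (nat \<bar>k\<bar>) \<in> U"
    proof (cases "k > 0")
      case True then show ?thesis using assms by simp
    next
      case False
      then have "(of_nat p :: 'a) powi int (nat \<bar>k\<bar>) = inverse (of_nat p powi k)"
        by (simp flip: power_int_minus)
      then show ?thesis using U_intros(3)[OF assms] by (simp only:)
    qed
    then show False using *[of "nat \<bar>k\<bar>"] \<open>k \<noteq> 0\<close> by linarith
  qed
qed

text \<open>By Bezout some multiple of \<open>n\<close> has the form 1 - p v, a unit by
  \<open>inverse_one_minus_p\<close>.\<close>

lemma int_unit:
  assumes "\<not> int p dvd n"
  shows "of_int n \<in> U"
proof -
  have "coprime (int p) n" using prime_p assms by (simp add: prime_imp_coprime)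
  then obtain u v where uv: "u * n + v * int p = 1"
    by (metis bezout_int coprime_iff_gcd_eq_1 gcd.commute)
  have n0: "(of_int n :: 'a) \<noteq> 0" using assms by auto
  have "of_int u * of_int n = (1 - of_nat p * of_int v :: 'a)"
    using arg_cong[OF uv, of "of_int :: int \<Rightarrow> 'a"] by (simp add: algebra_simps)
  moreover have "inverse (1 - of_nat p * of_int v :: 'a) \<in> A" "(1 - of_nat p * of_int v :: 'a) \<noteq> 0"
    using inverse_one_minus_p[of "of_int v"] A_intros by auto
  ultimately have "inverse (of_int u * of_int n :: 'a) \<in> A" "(of_int u :: 'a) \<noteq> 0" by auto
  then have "of_int u * inverse (of_int u * of_int n :: 'a) \<in> A" by (intro A_intros)
  then have "inverse (of_int n :: 'a) \<in> A" using \<open>(of_int u :: 'a) \<noteq> 0\<close> n0 by (simp add: field_simps)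
  then show ?thesis using n0 A_intros by (auto simp: U_def)
qed

lemma int_decomp:
  assumes "n \<noteq> 0"
  obtains u e where "u \<in> U" "of_int n = u * of_nat p ^ e" "p ^ e dvd nat \<bar>n\<bar>"
proof -
  obtain m where m: "n = int p ^ multiplicity (int p) n * m" "\<not> int p dvd m"
    using multiplicity_decompose'[of n "int p"] assms prime_p
    by (metis not_prime_unit prime_nat_int_transfer)
  have "of_int n = (of_int m :: 'a) * of_nat p ^ multiplicity (int p) n"
    by (subst m(1)) (simp add: mult.commute)
  moreover have "int p ^ multiplicity (int p) n dvd n" by (simp add: multiplicity_dvd)
  then have "p ^ multiplicity (int p) n dvd nat \<bar>n\<bar>"
    by (metis dvd_abs_iff int_dvd_int_iff nat_0_le abs_ge_zero of_nat_power)
  ultimately show ?thesis using that int_unit[OF m(2)] by blast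
qed

text \<open>In the value group, the class of \<open>z\<close> is \<open>k / n\<close> times the
  class of \<open>p\<close>. On transcendental elements the value group may fail to embed into the
  reals; on the elements with such a relation it does embed.\<close>

definition torsion :: "'a \<Rightarrow> nat \<Rightarrow> int \<Rightarrow> bool" where
  "torsion z n k \<longleftrightarrow> n > 0 \<and> (\<exists>u\<in>U. z ^ n = u * of_nat p powi k)"

lemma torsion_unique:
  assumes "torsion z n k" "torsion z n' k'"
  shows "k * int n' = k' * int n"
proof -
  obtain u u' where u: "u \<in> U" "z ^ n = u * of_nat p powi k" "u' \<in> U" "z ^ n' = u' * of_nat p powi k'"
    using assms by (auto simp: torsion_def)
  have "(z ^ n) ^ n' = (z ^ n') ^ n" by (simp add: power_mult[symmetric] mult.commute)
  then have eq: "u ^ n' * of_nat p powi (k * int n') = u' ^ n * of_nat p powi (k' * int n)"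
    unfolding u by (simp add: power_mult_distrib power_int_mult power_int_power)
  have un: "u ^ n' \<noteq> 0" using u by (auto simp: U_def)
  have "(of_nat p :: 'a) powi (k * int n' - k' * int n) = u' ^ n * inverse (u ^ n')"
    using eq un p_nonzero by (simp add: power_int_diff field_simps)
  also have "\<dots> \<in> U" using u by (intro U_intros)
  finally show ?thesis using p_powi_unit by force
qed

text \<open>Normalised so that \<open>p\<close> has absolute value \<open>1 / p\<close>. For a
  nonzero \<open>z\<close> without a torsion relation the choice is arbitrary, hence the restriction
  to \<open>tors\<close> in what follows.\<close>

definition val :: "'a \<Rightarrow> real" where
  "val z = (if z = 0 then 0 else SOME r. \<exists>n k. torsion z n k \<and> r = real p powr (- (of_int k / real n)))"

lemma val_eq:
  assumes "torsion z n k"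
  shows "val z = real p powr (- (of_int k / real n))"
proof -
  have z: "z \<noteq> 0" using assms p_nonzero by (auto simp: torsion_def U_def zero_power)
  have "\<exists>n k. torsion z n k \<and> val z = real p powr (- (of_int k / real n))"
    using z assms unfolding val_def by simp (rule someI_ex, blast)
  then obtain n' k' where *: "torsion z n' k'" "val z = real p powr (- (of_int k' / real n'))" by blast
  have "of_int (k * int n') = (of_int (k' * int n) :: real)"
    using torsion_unique[OF assms *(1)] by simp
  then have "of_int k / real n = of_int k' / real n'"
    using assms *(1) by (simp add: torsion_def field_simps)
  then show ?thesis using * by simp
qed

definition tors :: "'a set" where "tors = {z. \<exists>n k. torsion z n k}"

lemma torsE:
  assumes "z \<in> tors"
  obtains n k u where "torsion z n k" "n > 0" "u \<in> U" "z ^ n = u * of_nat p powi k"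
proof -
  obtain n k where t: "torsion z n k" using assms by (auto simp: tors_def)
  then obtain u where "n > 0" "u \<in> U" "z ^ n = u * of_nat p powi k" by (auto simp: torsion_def)
  with t show ?thesis by (rule that)
qed

lemma val_pos: "z \<in> tors \<Longrightarrow> val z > 0" using prime_p prime_gt_0_nat by (auto simp: tors_def val_eq)

lemma val_mult:
  assumes "z \<in> tors" "w \<in> tors"
  shows "z * w \<in> tors" "val (z * w) = val z * val w"
proof -
  obtain n k n' k' where t: "torsion z n k" "torsion w n' k'" using assms by (auto simp: tors_def)
  then obtain u u' where u: "u \<in> U" "z ^ n = u * of_nat p powi k" "u' \<in> U" "w ^ n' = u' * of_nat p powi k'"
    "n > 0" "n' > 0" by (auto simp: torsion_def)
  have "(z * w) ^ (n * n') = (z ^ n) ^ n' * (w ^ n') ^ n"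
    by (simp add: power_mult_distrib power_mult[symmetric] mult.commute)
  also have "\<dots> = (u ^ n' * u' ^ n) * of_nat p powi (k * int n' + k' * int n)"
    unfolding u using p_nonzero by (simp add: power_mult_distrib power_int_mult power_int_power power_int_add)
  finally have t': "torsion (z * w) (n * n') (k * int n' + k' * int n)"
    unfolding torsion_def using u by (intro conjI bexI[of _ "u ^ n' * u' ^ n"] U_intros) auto
  then show "z * w \<in> tors" by (auto simp: tors_def)
  have e: "of_int (k * int n' + k' * int n) / real (n * n') = of_int k / real n + of_int k' / real n'"
    using u by (simp add: field_simps)
  then show "val (z * w) = val z * val w"
    unfolding val_eq[OF t'] val_eq[OF t(1)] val_eq[OF t(2)] e by (simp flip: powr_add)
qed

lemma U_tors: "u \<in> U \<Longrightarrow> u \<in> tors" "u \<in> U \<Longrightarrow> val u = 1"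
proof -
  assume "u \<in> U"
  then have "torsion u 1 0" by (auto simp: torsion_def)
  then show "u \<in> tors" "val u = 1" using val_eq prime_p by (auto simp: tors_def prime_gt_0_nat)
qed

lemma p_tors: "of_nat p \<in> tors" "val (of_nat p) = 1 / real p"
proof -
  have "torsion (of_nat p) 1 1" using U_intros(1) by (auto simp: torsion_def)
  then show "of_nat p \<in> tors" "val (of_nat p) = 1 / real p"
    using val_eq[of "of_nat p" 1 1] prime_gt_0_nat[OF prime_p] by (auto simp: tors_def powr_minus field_simps)
qed

lemma inverse_tors:
  assumes "z \<in> tors"
  shows "z \<noteq> 0" "inverse z \<in> tors" "val (inverse z) = inverse (val z)"
proof -
  obtain n k u where u: "torsion z n k" "n > 0" "u \<in> U" "z ^ n = u * of_nat p powi k"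
    using torsE[OF assms] by blast
  show z: "z \<noteq> 0" using u p_nonzero by (auto simp: U_def zero_power)
  have "inverse z ^ n = inverse u * of_nat p powi (- k)"
    using u(4) by (simp add: power_inverse power_int_minus)
  then have t: "torsion (inverse z) n (- k)" using u U_intros(3) by (auto simp: torsion_def)
  then show "inverse z \<in> tors" by (auto simp: tors_def)
  show "val (inverse z) = inverse (val z)" by (simp add: val_eq[OF t] val_eq[OF u(1)] powr_minus)
qed

text \<open>A negative \<open>k\<close> for an element of \<open>A\<close> would put 1/p into
  \<open>A\<close>. Conversely, if z is not in \<open>A\<close> then 1/z is, which forces
  \<open>val z = 1\<close>; then z^n is a unit and z = z^n (1/z)^(n-1) lies in \<open>A\<close>
  after all.\<close>

lemma val_le_1_iff:
  assumes "z \<in> tors"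
  shows "val z \<le> 1 \<longleftrightarrow> z \<in> A"
proof -
  have le: "val y \<le> 1" if "y \<in> tors" "y \<in> A" for y
  proof -
    obtain n k u where u: "torsion y n k" "n > 0" "u \<in> U" "y ^ n = u * of_nat p powi k"
      using torsE[OF \<open>y \<in> tors\<close>] by blast
    have "k \<ge> 0"
    proof (rule ccontr)
      assume "\<not> k \<ge> 0"
      then obtain j where j: "k = - int (Suc j)" using negD[of k] by auto
      have "inverse u * y ^ n * of_nat p ^ j \<in> A" using u(3) that by (auto intro!: A_intros simp: U_def)
      moreover have "inverse u * y ^ n * of_nat p ^ j = inverse (of_nat p)"
      proof -
        have "y ^ n * of_nat p ^ Suc j = u"
          unfolding u(4) j power_int_minus power_int_of_nat mult.assoc using p_nonzero by (simp del: power_Suc)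
        then have "inverse u * (y ^ n * of_nat p ^ Suc j) = 1" using u(3) by (simp add: U_def)
        then have "of_nat p * (inverse u * y ^ n * of_nat p ^ j) = 1" by (simp add: mult_ac)
        then show ?thesis by (rule inverse_unique[symmetric])
      qed
      ultimately show False using inverse_p by simp
    qed
    then have "real p powr (- (of_int k / real n)) \<le> real p powr 0"
      using prime_p prime_ge_1_nat by (intro powr_mono) auto
    then show ?thesis using val_eq[OF u(1)] prime_p by (auto simp: prime_gt_0_nat)
  qed
  show ?thesis
  proof
    assume v: "val z \<le> 1"
    show "z \<in> A"
    proof (rule ccontr)
      assume z: "z \<notin> A"
      then have i: "inverse z \<in> A" using valuation_ring by blast
      obtain n k u where u: "torsion z n k" "n > 0" "u \<in> U" "z ^ n = u * of_nat p powi k"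
        using torsE[OF assms] by blast
      have "inverse (val z) \<le> 1" using le[OF inverse_tors(2)[OF assms] i] inverse_tors(3)[OF assms] by simp
      then have "val z = 1" using v val_pos[OF assms] by (simp add: field_simps)
      then have "- (of_int k / real n) = (0::real)" using val_eq[OF u(1)] prime_gt_1_nat[OF prime_p]
        by (subst (asm) eq_commute) (simp add: powr_eq_one_iff_gen)
      then have "k = 0" using u(2) by simp
      then have "z ^ n \<in> U" using u by simp
      then have "z ^ n * inverse z ^ (n - 1) \<in> A" using i by (auto intro!: A_intros simp: U_def)
      moreover have "z ^ n * inverse z ^ (n - 1) = z"
        using inverse_tors(1)[OF assms] u(2) by (cases n) (auto simp: field_simps)
      ultimately show False using z by simp
    qed
  qed (use le assms in blast)
qed

text \<open>Divide by the larger term: the quotient lies in \<open>A\<close>, and \<open>A\<close>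
  is closed under adding 1.\<close>

lemma val_add:
  assumes "z \<in> tors" "w \<in> tors" "z + w \<in> tors"
  shows "val (z + w) \<le> max (val z) (val w)"
proof -
  have *: "val (z + w) \<le> max (val z) (val w)"
    if t: "z \<in> tors" "w \<in> tors" "z + w \<in> tors" and le: "val z \<le> val w" for z w
  proof -
    have w: "w \<noteq> 0" "val w > 0" using inverse_tors t val_pos by auto
    have "val (z * inverse w) = val z * inverse (val w)" "z * inverse w \<in> tors"
      using t inverse_tors val_mult by auto
    moreover have "val z * inverse (val w) \<le> 1" using le w by (simp add: field_simps)
    ultimately have "z * inverse w \<in> A" using val_le_1_iff by metis
    then have "z * inverse w + 1 \<in> A" by (rule A_intros(5)) (rule A_intros(1))
    moreover have e: "z * inverse w + 1 = (z + w) * inverse w" using w by (simp add: field_simps)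
    moreover have "(z + w) * inverse w \<in> tors" using t inverse_tors val_mult by auto
    ultimately have "val ((z + w) * inverse w) \<le> 1" using val_le_1_iff by metis
    moreover have "val ((z + w) * inverse w) = val (z + w) * inverse (val w)"
      by (rule val_mult(2)[OF t(3) inverse_tors(2)[OF t(2)], unfolded inverse_tors(3)[OF t(2)]])
    ultimately have "val (z + w) * inverse (val w) \<le> 1" by simp
    then have "val (z + w) \<le> val w" using w(2) by (simp add: field_simps)
    then show ?thesis by simp
  qed
  show ?thesis
  proof (cases "val z \<le> val w")
    case True then show ?thesis using * assms by blast
  next
    case False then show ?thesis using *[of w z] assms by (simp add: add.commute max.commute)
  qed
qed

text \<open>The nonunits are the maximal ideal: one of x/y and y/x lies in \<open>A\<close>, so x +
  y is an \<open>A\<close>-multiple of x or of y.\<close>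

lemma nonunit_add:
  assumes "x \<in> A" "x \<notin> U" "y \<in> A" "y \<notin> U"
  shows "x + y \<notin> U"
proof
  assume u: "x + y \<in> U"
  have *: False if "x \<in> A" "x \<notin> U" "y \<in> A" "y \<notin> U" "x + y \<in> U" "y \<noteq> 0" "x * inverse y \<in> A" for x y
  proof -
    have "inverse (x + y) * (x * inverse y + 1) \<in> A" using that by (auto intro!: A_intros simp: U_def)
    moreover have "inverse (x + y) * (x * inverse y + 1) = inverse y"
      using that by (auto simp: U_def field_simps)
    ultimately show False using that by (auto simp: U_def)
  qed
  have "x \<noteq> 0" "y \<noteq> 0" using u assms by auto
  have "x * inverse y \<in> A \<or> inverse (x * inverse y) \<in> A" using valuation_ring by blast
  then show False using *[of x y] *[of y x] assms u \<open>x \<noteq> 0\<close> \<open>y \<noteq> 0\<close>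
    by (auto simp: add.commute mult.commute)
qed

lemma nonunit_sum: "(\<And>i. i \<in> I \<Longrightarrow> f i \<in> A \<and> f i \<notin> U) \<Longrightarrow> sum f I \<notin> U"
proof (induction I rule: infinite_finite_induct)
  case (insert i I)
  moreover have "sum f I \<in> A" by (rule is_subring_sum[OF subring]) (use insert in auto)
  ultimately show ?case using nonunit_add by auto
qed (auto simp: U_def)

text \<open>In an integer equation for \<open>z\<close> at least two nonzero terms must share the
  largest value, as the terms sum to zero. Their quotient is a unit, and it expresses a power of
  \<open>z\<close> through two integers.\<close>

lemma algebraic_tors:
  assumes "algebraic z" "z \<noteq> 0"
  shows "z \<in> tors"
proof -
  obtain P where P: "\<And>i. coeff P i \<in> \<int>" "P \<noteq> 0" "poly P z = 0" using algebraicE[OF assms(1)] by blast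
  define I where "I = {i. i \<le> degree P \<and> coeff P i \<noteq> 0}"
  define t where "t = (\<lambda>i. coeff P i * z ^ i)"
  have fin: "finite I" by (auto simp: I_def)
  have t0: "t i \<noteq> 0" if "i \<in> I" for i using that assms by (auto simp: t_def I_def)
  have sum0: "sum t I = 0"
  proof -
    have "sum t I = (\<Sum>i\<le>degree P. t i)" by (rule sum.mono_neutral_left) (auto simp: I_def t_def)
    then show ?thesis using P(3) by (simp add: poly_altdef t_def)
  qed
  \<comment> \<open>A term of largest value exists: every other term is an \<open>A\<close>-multiple
    of it.\<close>
  have "J \<noteq> {} \<Longrightarrow> J \<subseteq> I \<Longrightarrow> \<exists>i\<in>J. \<forall>j\<in>J. t j * inverse (t i) \<in> A" if "finite J" for J
    using that
  proof (induction J rule: finite_induct)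
    case (insert k J)
    show ?case
    proof (cases "J = {}")
      case True then show ?thesis using t0 insert A_intros(1) by auto
    next
      case False
      then obtain i where i: "i \<in> J" "\<forall>j\<in>J. t j * inverse (t i) \<in> A" using insert by auto
      have ti: "t i \<noteq> 0" "t k \<noteq> 0" using t0 i insert by auto
      consider "t k * inverse (t i) \<in> A" | "t i * inverse (t k) \<in> A"
        using valuation_ring[of "t k * inverse (t i)"] by (auto simp: mult.commute)
      then show ?thesis
      proof cases
        case 1 then show ?thesis using i by auto
      next
        case 2
        have "t j * inverse (t k) \<in> A" if "j \<in> J" for j
        proof -
          have "(t j * inverse (t i)) * (t i * inverse (t k)) \<in> A"
            by (rule A_intros(4)) (use i 2 that in auto)
          then show ?thesis using ti by (simp add: field_simps)
        qed
        then show ?thesis using ti A_intros(1) by auto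
      qed
    qed
  qed simp
  moreover have "degree P \<in> I" using P(2) by (auto simp: I_def)
  ultimately obtain i where i: "i \<in> I" "\<forall>j\<in>I. t j * inverse (t i) \<in> A" using fin by blast
  \<comment> \<open>Otherwise the remaining quotients are nonunits, yet they add up to the unit
    -1.\<close>
  have "\<exists>j\<in>I - {i}. t j * inverse (t i) \<in> U"
  proof (rule ccontr)
    assume "\<not> ?thesis"
    then have "(\<Sum>j\<in>I - {i}. t j * inverse (t i)) \<notin> U" using i by (intro nonunit_sum) auto
    moreover have "(\<Sum>j\<in>I - {i}. t j * inverse (t i)) = (sum t I - t i) * inverse (t i)"
      using fin i by (simp add: sum_distrib_right[symmetric] sum_diff1)
    then have "(\<Sum>j\<in>I - {i}. t j * inverse (t i)) = -1" using sum0 t0[OF i(1)] by simp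
    ultimately show False using U_intros(5) by simp
  qed
  then obtain j where j: "j \<in> I" "j \<noteq> i" "t j * inverse (t i) \<in> U" by auto
  have main: "z \<in> tors" if "i \<in> I" "j \<in> I" "i < j" "t j * inverse (t i) \<in> U" for i j
  proof -
    obtain a b where ab: "coeff P i = of_int a" "coeff P j = of_int b" using P(1) by (meson Ints_cases)
    have ab0: "a \<noteq> 0" "b \<noteq> 0" using that ab by (auto simp: I_def)
    obtain u e where u: "u \<in> U" "of_int a = u * of_nat p ^ e" using int_decomp ab0(1) by metis
    obtain v f where v: "v \<in> U" "of_int b = v * of_nat p ^ f" using int_decomp ab0(2) by metis
    have uv: "u \<noteq> 0" "v \<noteq> 0" using u v by (auto simp: U_def)
    define w where "w = t j * inverse (t i)"
    have tj: "t j = w * t i" using t0[OF that(1)] by (simp add: w_def)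
    have "z ^ j = z ^ (j - i) * z ^ i" using that by (simp flip: power_add)
    then have "v * of_nat p ^ f * z ^ (j - i) = w * (u * of_nat p ^ e)"
      using tj assms(2) by (simp add: t_def ab u v mult.assoc)
    then have "z ^ (j - i) = (w * u * inverse v) * of_nat p powi (int e - int f)"
      using uv p_nonzero by (simp add: power_int_diff field_simps)
    moreover have "w * u * inverse v \<in> U" using u v that by (intro U_intros) (auto simp: w_def)
    ultimately show ?thesis using that by (auto simp: tors_def torsion_def intro!: exI[of _ "j - i"])
  qed
  show ?thesis
  proof (cases "i < j")
    case True then show ?thesis using main i j by blast
  next
    case False
    have "inverse (t j * inverse (t i)) \<in> U" using j U_intros by blast
    then show ?thesis using main[of j i] i j False by (simp add: mult.commute)
  qed
qed

text \<open>If z were not in \<open>A\<close>, then 1/z would be. Dividing the equation by the top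
  power of z writes the leading coefficient, a unit, as 1/z times an element of \<open>A\<close>,
  and this puts z back into \<open>A\<close>.\<close>

lemma val_le_1_of_root:
  assumes P: "\<And>i. coeff P i = of_int (a i)" "P \<noteq> 0" "poly P z = 0" "\<not> int p dvd a (degree P)"
    and z: "z \<in> tors"
  shows "val z \<le> 1"
proof -
  have z0: "z \<noteq> 0" using inverse_tors z by auto
  have "z \<in> A"
  proof (rule ccontr)
    assume "z \<notin> A"
    then have i: "inverse z \<in> A" using valuation_ring by blast
    define n where "n = degree P"
    have "0 = inverse z ^ n * (\<Sum>i\<le>n. coeff P i * z ^ i)" using P(3) by (simp add: poly_altdef n_def)
    also have "\<dots> = (\<Sum>i\<le>n. of_int (a i) * inverse z ^ (n - i))"
      using z0 by (auto simp: sum_distrib_left P(1) power_diff field_simps intro!: sum.cong)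
    also have "\<dots> = of_int (a n) + (\<Sum>i<n. of_int (a i) * inverse z ^ (n - i))"
      by (simp add: lessThan_Suc_atMost[symmetric])
    also have "(\<Sum>i<n. of_int (a i) * inverse z ^ (n - i))
      = inverse z * (\<Sum>i<n. of_int (a i) * inverse z ^ (n - i - 1))"
      unfolding sum_distrib_left by (rule sum.cong) (auto simp: power_eq_if)
    finally have e: "of_int (a n) = inverse z * (- (\<Sum>i<n. of_int (a i) * inverse z ^ (n - i - 1)))"
      by (simp add: eq_neg_iff_add_eq_0)
    define y where "y = - (\<Sum>i<n. of_int (a i) * inverse z ^ (n - i - 1))"
    have y: "y \<in> A" using i unfolding y_def by (auto intro!: A_intros is_subring_sum[OF subring])
    have u: "of_int (a n) \<in> U" using int_unit P(4) by (simp add: n_def)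
    then have "inverse (of_int (a n)) * y \<in> A" using y by (auto intro!: A_intros simp: U_def)
    moreover have e': "z * of_int (a n) = y" using z0 unfolding e y_def[symmetric] by simp
    have "inverse (of_int (a n)) * y = z" using u unfolding e'[symmetric] by (simp add: U_def)
    ultimately show False using \<open>z \<notin> A\<close> by simp
  qed
  then show ?thesis using val_le_1_iff[OF z] by simp
qed

end

text \<open>The last clause says that a root of an integer polynomial whose leading coefficient is prime
  to \<open>p\<close> is \<open>p\<close>-integral.\<close>

theorem exists_padic_absolute_value:
  assumes "prime p"
  obtains v :: "'a::field_char_0 \<Rightarrow> real" where
    "v 0 = 0" "\<And>z. algebraic z \<Longrightarrow> z \<noteq> 0 \<Longrightarrow> v z > 0"
    "\<And>z w. algebraic z \<Longrightarrow> algebraic w \<Longrightarrow> v (z * w) = v z * v w"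
    "\<And>z w. algebraic z \<Longrightarrow> algebraic w \<Longrightarrow> algebraic (z + w) \<Longrightarrow> v (z + w) \<le> max (v z) (v w)"
    "\<And>(I :: nat set) z. finite I \<Longrightarrow> (\<And>i. i \<in> I \<Longrightarrow> algebraic (z i)) \<Longrightarrow> v (\<Prod>i\<in>I. z i) = (\<Prod>i\<in>I. v (z i))"
    "v (of_nat p) = 1 / real p" "\<And>n. \<not> int p dvd n \<Longrightarrow> v (of_int n) = 1"
    "\<And>z P a. (\<And>i. coeff P i = of_int (a i)) \<Longrightarrow> poly P z = 0 \<Longrightarrow> \<not> int p dvd a (degree P) \<Longrightarrow> v z \<le> 1"
proof -
  obtain A :: "'a set" where "is_subring A" "inverse (of_nat p) \<notin> A"
    "\<And>B. is_subring B \<Longrightarrow> A \<subseteq> B \<Longrightarrow> inverse (of_nat p) \<notin> B \<Longrightarrow> B = A"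
    using exists_maximal_subring_avoiding[OF assms] by metis
  then interpret maximal_subring A p using assms by unfold_locales
  have val0: "val 0 = 0" by (simp add: val_def)
  show ?thesis
  proof (rule that[of val])
    show "val z > 0" if "algebraic z" "z \<noteq> 0" for z using algebraic_tors that val_pos by blast
    show "val (z * w) = val z * val w" if "algebraic z" "algebraic w" for z w
      using algebraic_tors[of z] algebraic_tors[of w] that val_mult(2)[of z w] val0 by (cases "z = 0 \<or> w = 0") auto
    show "val (z + w) \<le> max (val z) (val w)" if "algebraic z" "algebraic w" "algebraic (z + w)" for z w
    proof (cases "z = 0 \<or> w = 0 \<or> z + w = 0")
      case True
      have "val x \<ge> 0" if "algebraic x" for x
        using algebraic_tors[OF that] val_pos[of x] val0 by (cases "x = 0") auto
      then show ?thesis using True that val0 by (auto simp: le_max_iff_disj)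
    next
      case False
      then show ?thesis using that algebraic_tors val_add by auto
    qed
    show "val (\<Prod>i\<in>I. z i) = (\<Prod>i\<in>I. val (z i))" if "finite I" "\<And>i. i \<in> I \<Longrightarrow> algebraic (z i)"
      for I :: "nat set" and z
    proof (cases "\<exists>i\<in>I. z i = 0")
      case True
      then obtain i where i: "i \<in> I" "z i = 0" by blast
      then have "(\<Prod>i\<in>I. z i) = 0" "(\<Prod>i\<in>I. val (z i)) = 0"
        using that(1) val0 by (auto simp: prod_zero_iff intro!: bexI[of _ i])
      then show ?thesis using val0 by simp
    next
      case False
      then have "\<And>i. i \<in> I \<Longrightarrow> z i \<in> tors" using that(2) algebraic_tors by blast
      with \<open>finite I\<close> have "(\<Prod>i\<in>I. z i) \<in> tors \<and> val (\<Prod>i\<in>I. z i) = (\<Prod>i\<in>I. val (z i))"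
        by (induction I rule: finite_induct) (use val_mult U_tors U_intros(1) in auto)
      then show ?thesis by blast
    qed
    show "val (of_int n) = 1" if "\<not> int p dvd n" for n using int_unit U_tors(2) that by blast
    show "val z \<le> 1" if P: "\<And>i. coeff P i = of_int (a i)" "poly P z = 0" "\<not> int p dvd a (degree P)" for z P a
    proof (cases "z = 0")
      case False
      have "P \<noteq> 0"
      proof
        assume "P = 0"
        then have "a (degree P) = 0" using P(1)[of "degree P"] by simp
        then show False using P(3) by simp
      qed
      moreover have "algebraic z" using P \<open>P \<noteq> 0\<close> by (intro algebraicI[of P]) auto
      ultimately show ?thesis using val_le_1_of_root[of P a z] P algebraic_tors False by blast
    qed (simp add: val0)
  qed (use val0 p_tors in auto)
qed

section \<open>Embeddings of a number field\<close>

text \<open>There are more powers \<open>x ^ 0, ..., x ^ n\<close> than elements in a spanning set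
  of size \<open>n\<close>: either two of them coincide or they are linearly dependent.\<close>

lemma number_field_annihilator:
  fixes x :: "'k::field_char_0"
  assumes "number_field TYPE('k)"
  obtains a :: "nat \<Rightarrow> rat" and n where "\<exists>i\<le>n. a i \<noteq> 0" "(\<Sum>i\<le>n. of_rat (a i) * x ^ i) = 0"
proof -
  obtain B :: "'k set" where B: "finite B" "rat_vs.span B = UNIV"
    using assms by (auto simp: number_field_def)
  define n where "n = card B"
  define S where "S = (\<lambda>i. x ^ i) ` {..n}"
  show ?thesis
  proof (cases "inj_on (\<lambda>i. x ^ i) {..n}")
    case False
    then obtain i j where ij: "i \<le> n" "j \<le> n" "i \<noteq> j" "x ^ i = x ^ j" by (auto simp: inj_on_def)
    let ?a = "\<lambda>l. if l = i then 1 else if l = j then -1 else (0::rat)"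
    have "(\<Sum>l\<le>n. of_rat (?a l) * x ^ l) = (\<Sum>l\<in>{i,j}. of_rat (?a l) * x ^ l)"
      by (rule sum.mono_neutral_right) (use ij in auto)
    also have "\<dots> = 0" using ij by (simp add: of_rat_minus)
    finally show ?thesis using ij by (intro that[of n ?a]) auto
  next
    case True
    then have "card S = Suc n" by (simp add: S_def card_image)
    then have "\<not> rat_vs.independent S"
      using rat_vs.independent_span_bound[OF B(1), of S] B(2) by (auto simp: n_def)
    then obtain T u v where T: "finite T" "T \<subseteq> S" "(\<Sum>v\<in>T. of_rat (u v) * v) = 0" "v \<in> T" "u v \<noteq> 0"
      unfolding rat_vs.dependent_explicit by blast
    let ?a = "\<lambda>i. if x ^ i \<in> T then u (x ^ i) else 0"
    obtain i where i: "i \<le> n" "v = x ^ i" using T by (auto simp: S_def)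
    have "(\<Sum>i\<le>n. of_rat (?a i) * x ^ i) = (\<Sum>v\<in>S. of_rat (if v \<in> T then u v else 0) * v)"
      unfolding S_def by (subst sum.reindex[OF True]) simp
    also have "\<dots> = (\<Sum>v\<in>T. of_rat (if v \<in> T then u v else 0) * v)"
      by (rule sum.mono_neutral_right) (use T in \<open>auto simp: S_def\<close>)
    also have "\<dots> = 0" using T(3) by simp
    finally show ?thesis using T i by (intro that[of n ?a]) auto
  qed
qed

locale rat_basis =
  fixes m :: nat and b :: "nat \<Rightarrow> 'k::field_char_0" and c :: "'k \<Rightarrow> nat \<Rightarrow> rat"
  assumes repr: "(\<Sum>k<m. of_rat (c x k) * b k) = x"
    and c_add: "c (x + y) k = c x k + c y k"
    and c_scale: "c (of_rat q * x) k = q * c x k"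
    and c_basis: "j < m \<Longrightarrow> k < m \<Longrightarrow> c (b j) k = (if j = k then 1 else 0)"
    and nf: "number_field TYPE('k)"

lemma exists_rat_basis:
  assumes "number_field TYPE('k::field_char_0)"
  shows "\<exists>(b :: nat \<Rightarrow> 'k::field_char_0) c. rat_basis (field_degree TYPE('k::field_char_0)) b c"
proof -
  obtain F :: "'k set" where F: "finite F" "rat_vs.span F = UNIV"
    using assms by (auto simp: number_field_def)
  obtain C :: "'k set" where C: "rat_vs.independent C" "UNIV \<subseteq> rat_vs.span C" "card C = rat_vs.dim (UNIV :: 'k set)"
    by (rule rat_vs.basis_exists[of UNIV])
  have fin: "finite C" using rat_vs.independent_span_bound[OF F(1) C(1)] F(2) by auto
  define m where "m = field_degree TYPE('k)"
  have "m = card C" using C(3) by (simp add: m_def field_degree_def)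
  then obtain b where b: "bij_betw b {..<m} C" using ex_bij_betw_nat_finite[OF fin]
    by (auto simp: atLeast0LessThan)
  define c where "c = (\<lambda>x k. rat_vs.representation C x (b k))"
  have "rat_basis m b c"
  proof
    have sp: "x \<in> rat_vs.span C" for x using C(2) by auto
    show "(\<Sum>k<m. of_rat (c x k) * b k) = x" for x
      using rat_vs.sum_representation_eq[OF C(1) sp fin order.refl, of x]
        sum.reindex_bij_betw[OF b, of "\<lambda>y. of_rat (rat_vs.representation C x y) * y"]
      by (simp add: c_def)
    show "c (x + y) k = c x k + c y k" for x y k
      unfolding c_def by (subst rat_vs.representation_add[OF C(1) sp sp]) simp
    show "c (of_rat q * x) k = q * c x k" for q x k
      unfolding c_def by (subst rat_vs.representation_scale[OF C(1) sp]) simp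
    show "c (b j) k = (if j = k then 1 else 0)" if "j < m" "k < m" for j k
    proof -
      have "b j \<in> C" "b k = b j \<longleftrightarrow> k = j" using b that by (auto simp: bij_betw_def inj_on_def)
      then show ?thesis unfolding c_def using rat_vs.representation_basis[OF C(1), of "b j"] by auto
    qed
  qed (rule assms)
  then show ?thesis unfolding m_def by blast
qed

section \<open>Simultaneous triangularisation of the multiplication operators\<close>

context rat_basis
begin

lemma c_sum: "c (sum f I) k = (\<Sum>i\<in>I. c (f i) k)"
proof (induction I rule: infinite_finite_induct)
  have "c 0 k = 0" using c_scale[of 0 0] by simp
  { case (infinite I) then show ?case using \<open>c 0 k = 0\<close> by simp }
  { case empty then show ?case using \<open>c 0 k = 0\<close> by simp }
qed (simp add: c_add)

text \<open>Multiplication by \<open>x\<close> in the basis \<open>b\<close>, extended to complex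
  coordinates. Vectors are functions on all naturals; only their entries below \<open>m\<close>
  matter.\<close>

definition op :: "'k \<Rightarrow> (nat \<Rightarrow> complex) \<Rightarrow> nat \<Rightarrow> complex" where
  "op x w = (\<lambda>k. if k < m then \<Sum>j<m. of_rat (c (x * b j) k) * w j else 0)"

lemma c_mult: "c (x * y) k = (\<Sum>i<m. c y i * c (x * b i) k)"
proof -
  have "x * y = (\<Sum>i<m. of_rat (c y i) * (x * b i))"
    by (subst repr[of y, symmetric]) (simp add: sum_distrib_left mult_ac)
  then show ?thesis by (simp add: c_sum c_scale)
qed

lemma op_add_left: "op (x + y) w k = op x w k + op y w k"
  by (simp add: op_def distrib_right c_add of_rat_add sum.distrib)

lemma op_scale_left: "op (of_rat q * x) w k = of_rat q * op x w k"
  unfolding op_def mult.assoc c_scale by (simp only: of_rat_mult mult.assoc sum_distrib_left split: if_split) simp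

lemma op_sum_left: "op (sum f I) w k = (\<Sum>i\<in>I. op (f i) w k)"
proof (induction I rule: infinite_finite_induct)
  have "op 0 w k = 0" using op_scale_left[of 0 0 w k] by simp
  { case (infinite I) then show ?case using \<open>op 0 w k = 0\<close> by simp }
  { case empty then show ?case using \<open>op 0 w k = 0\<close> by simp }
qed (simp add: op_add_left)

lemma op_mult: "op (x * y) w = op x (op y w)"
proof
  fix k show "op (x * y) w k = op x (op y w) k"
  proof (cases "k < m")
    case True
    have "op (x * y) w k = (\<Sum>j<m. \<Sum>i<m. of_rat (c (y * b j) i) * of_rat (c (x * b i) k) * w j)"
      using True unfolding op_def mult.assoc[of x y] c_mult[of x "y * _"]
      by (simp add: of_rat_sum of_rat_mult sum_distrib_right)
    also have "\<dots> = (\<Sum>i<m. \<Sum>j<m. of_rat (c (y * b j) i) * of_rat (c (x * b i) k) * w j)"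
      by (rule sum.swap)
    also have "\<dots> = op x (op y w) k"
      using True by (simp add: op_def sum_distrib_left mult_ac)
    finally show ?thesis .
  qed (simp add: op_def)
qed

lemma op_one: "k < m \<Longrightarrow> op 1 w k = w k"
  by (simp add: op_def c_basis if_distrib[of of_rat] if_distrib[of "\<lambda>t. t * _"] cong: if_cong)

lemma op_lin: "op x (\<lambda>k. \<alpha> * w k + \<beta> * w' k) = (\<lambda>k. \<alpha> * op x w k + \<beta> * op x w' k)"
  by (auto simp: op_def sum_distrib_left algebra_simps sum.distrib)

lemma op_cong: "(\<And>k. k < m \<Longrightarrow> w k = w' k) \<Longrightarrow> op x w = op x w'"
  by (auto simp: op_def)

lemma op_sum_right: "op x (\<lambda>k. \<Sum>i\<in>I. a i * v i k) k = (\<Sum>i\<in>I. a i * op x (v i) k)"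
proof (induction I rule: infinite_finite_induct)
  case (insert i I)
  have "op x (\<lambda>k. a i * v i k + 1 * (\<Sum>i\<in>I. a i * v i k)) k = a i * op x (v i) k + 1 * op x (\<lambda>k. \<Sum>i\<in>I. a i * v i k) k"
    by (rule fun_cong[OF op_lin])
  then show ?case using insert by simp
qed (auto simp: op_def)

text \<open>The last clause makes membership independent of the entries from \<open>m\<close> on, so
  that vectors need to be compared only below \<open>m\<close>.\<close>

definition subsp :: "(nat \<Rightarrow> complex) set \<Rightarrow> bool" where
  "subsp W \<longleftrightarrow> (\<lambda>k. 0) \<in> W \<and> (\<forall>w\<in>W. \<forall>w'\<in>W. \<forall>\<alpha> \<beta>. (\<lambda>k. \<alpha> * w k + \<beta> * w' k) \<in> W)
     \<and> (\<forall>w\<in>W. \<forall>w'. (\<forall>k<m. w k = w' k) \<longrightarrow> w' \<in> W)"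

lemma subspD:
  assumes "subsp W"
  shows "(\<lambda>k. 0) \<in> W" "w \<in> W \<Longrightarrow> w' \<in> W \<Longrightarrow> (\<lambda>k. \<alpha> * w k + \<beta> * w' k) \<in> W"
    "w \<in> W \<Longrightarrow> (\<And>k. k < m \<Longrightarrow> w k = w' k) \<Longrightarrow> w' \<in> W"
    "w \<in> W \<Longrightarrow> w' \<in> W \<Longrightarrow> (\<lambda>k. w k + w' k) \<in> W"
    "w \<in> W \<Longrightarrow> w' \<in> W \<Longrightarrow> (\<lambda>k. w k - w' k) \<in> W"
    "w \<in> W \<Longrightarrow> (\<lambda>k. \<alpha> * w k) \<in> W"
proof -
  show 1: "(\<lambda>k. 0) \<in> W" "w \<in> W \<Longrightarrow> w' \<in> W \<Longrightarrow> (\<lambda>k. \<alpha> * w k + \<beta> * w' k) \<in> W" for w w' \<alpha> \<beta>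
    using assms unfolding subsp_def by blast+
  show "w \<in> W \<Longrightarrow> (\<And>k. k < m \<Longrightarrow> w k = w' k) \<Longrightarrow> w' \<in> W"
    using assms unfolding subsp_def by blast
  show "w \<in> W \<Longrightarrow> w' \<in> W \<Longrightarrow> (\<lambda>k. w k + w' k) \<in> W" using 1(2)[of w w' 1 1] by simp
  show "w \<in> W \<Longrightarrow> w' \<in> W \<Longrightarrow> (\<lambda>k. w k - w' k) \<in> W" using 1(2)[of w w' 1 "-1"] by simp
  show "w \<in> W \<Longrightarrow> (\<lambda>k. \<alpha> * w k) \<in> W" using 1(2)[OF _ 1(1), of w \<alpha> 0] by simp
qed

lemma subsp_sum:
  assumes W: "subsp W" and "\<And>i. i \<in> I \<Longrightarrow> v i \<in> W"
  shows "(\<lambda>k. \<Sum>i\<in>I. a i * v i k) \<in> W"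
  using assms(2)
proof (induction I rule: infinite_finite_induct)
  case (insert i I)
  then have "(\<lambda>k. a i * v i k + 1 * (\<Sum>i\<in>I. a i * v i k)) \<in> W" by (intro subspD(2)[OF W]) auto
  then show ?case using insert by simp
qed (use subspD(1)[OF W] in auto)

text \<open>Take g of least degree with g(x) w in \<open>W\<close> and split off a root, g = (X - a)
  h. Then h(x) w is outside \<open>W\<close> and is an eigenvector for \<open>x\<close> modulo
  \<open>W\<close>. All operators commute, so eigenvalues that \<open>w\<close> already has for
  other elements survive.\<close>

lemma exists_eigenvector_step:
  assumes W: "subsp W" "\<And>x w. w \<in> W \<Longrightarrow> op x w \<in> W" and w: "w \<notin> W"
  obtains a w' where "w' \<notin> W" "(\<lambda>k. op x w' k - a * w' k) \<in> W"
    "\<And>y \<mu>. (\<lambda>k. op y w k - \<mu> * w k) \<in> W \<Longrightarrow> (\<lambda>k. op y w' k - \<mu> * w' k) \<in> W"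
proof -
  define ev where "ev = (\<lambda>g k. \<Sum>i\<le>degree g. coeff g i * op (x ^ i) w k)"
  have ev_alt: "ev g k = (\<Sum>i\<le>n. coeff g i * op (x ^ i) w k)" if "degree g \<le> n" for g n k
    unfolding ev_def by (rule sum.mono_neutral_left) (use that in \<open>auto simp: coeff_eq_0\<close>)
  have ev_step: "ev ([:-a, 1:] * g) k = op x (ev g) k - a * ev g k" for a g k
  proof -
    define n where "n = degree g"
    have d: "degree ([:-a, 1:] * g) \<le> Suc n" using degree_mult_le[of "[:-a, 1:]" g] by (simp add: n_def)
    have co: "coeff ([:-a, 1:] * g) i = (if i = 0 then 0 else coeff g (i - 1)) - a * coeff g i" for i
      by (cases i) auto
    have "ev ([:-a, 1:] * g) k = (\<Sum>i\<le>Suc n. (if i = 0 then 0 else coeff g (i - 1)) * op (x ^ i) w k)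
        - a * (\<Sum>i\<le>Suc n. coeff g i * op (x ^ i) w k)"
      unfolding ev_alt[OF d] co by (simp only: left_diff_distrib sum_subtractf sum_distrib_left mult.assoc)
    also have "(\<Sum>i\<le>Suc n. coeff g i * op (x ^ i) w k) = ev g k"
      by (rule ev_alt[symmetric]) (simp add: n_def)
    also have "(\<Sum>i\<le>Suc n. (if i = 0 then 0 else coeff g (i - 1)) * op (x ^ i) w k)
       = (\<Sum>i\<le>n. coeff g i * op x (op (x ^ i) w) k)"
      by (subst sum.atMost_Suc_shift) (simp add: op_mult)
    also have "\<dots> = op x (ev g) k"
      unfolding ev_def n_def by (simp add: op_sum_right)
    finally show ?thesis .
  qed
  obtain q :: "nat \<Rightarrow> rat" and n where q: "\<exists>i\<le>n. q i \<noteq> 0" "(\<Sum>i\<le>n. of_rat (q i) * x ^ i) = 0"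
    using number_field_annihilator[OF nf] by metis
  define f :: "complex poly" where "f = (\<Sum>i\<le>n. monom (of_rat (q i)) i)"
  have cf: "coeff f i = (if i \<le> n then of_rat (q i) else 0)" for i
    by (simp add: f_def coeff_sum if_distrib cong: if_cong)
  have f0: "f \<noteq> 0" using q(1) cf by (metis coeff_0 of_rat_eq_0_iff)
  have op0: "op 0 w k = 0" for k using op_scale_left[of 0 0] by simp
  have "ev f k = 0" for k
  proof -
    have "degree f \<le> n" by (rule degree_le) (simp add: cf)
    then have "ev f k = (\<Sum>i\<le>n. of_rat (q i) * op (x ^ i) w k)" by (simp add: ev_alt cf)
    also have "\<dots> = (\<Sum>i\<le>n. op (of_rat (q i) * x ^ i) w k)" by (simp add: op_scale_left)
    also have "\<dots> = op (\<Sum>i\<le>n. of_rat (q i) * x ^ i) w k"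
      by (rule op_sum_left[symmetric])
    finally show ?thesis using q(2) op0 by simp
  qed
  then have "ev f = (\<lambda>k. 0)" by auto
  then have expo: "\<exists>g. g \<noteq> 0 \<and> ev g \<in> W" using f0 subspD(1)[OF W(1)] by (intro exI[of _ f]) auto
  define g where "g = arg_min degree (\<lambda>g. g \<noteq> 0 \<and> ev g \<in> W)"
  have g: "g \<noteq> 0" "ev g \<in> W" and g_min: "\<And>h. h \<noteq> 0 \<Longrightarrow> ev h \<in> W \<Longrightarrow> degree g \<le> degree h"
    using arg_min_nat_lemma[of "\<lambda>g. g \<noteq> 0 \<and> ev g \<in> W" _ degree] expo unfolding g_def by blast+
  have "degree g \<noteq> 0"
  proof
    assume "degree g = 0"
    then have "ev g = (\<lambda>k. coeff g 0 * op 1 w k)" by (auto simp: ev_def)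
    then have "(\<lambda>k. inverse (coeff g 0) * (coeff g 0 * op 1 w k)) \<in> W"
      using subspD(6)[OF W(1) g(2)] by simp
    moreover have "coeff g 0 \<noteq> 0" using \<open>degree g = 0\<close> g(1) by (metis leading_coeff_0_iff)
    ultimately have "w \<in> W" using op_one by (elim subspD(3)[OF W(1)]) (simp add: mult.assoc[symmetric])
    then show False using w by simp
  qed
  then obtain a where "poly g a = 0"
    using fundamental_theorem_of_algebra[of g] constant_degree[of g] by auto
  then obtain h where h: "g = [:-a, 1:] * h" by (auto simp: poly_eq_0_iff_dvd)
  have "h \<noteq> 0" using h g(1) by auto
  have "degree g = Suc (degree h)"
    unfolding h by (subst degree_mult_eq) (use \<open>h \<noteq> 0\<close> in auto)
  then have "ev h \<notin> W" using g_min[of h] \<open>h \<noteq> 0\<close> by auto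
  moreover have "(\<lambda>k. op x (ev h) k - a * ev h k) \<in> W"
    by (rule subspD(3)[OF W(1) g(2)]) (simp only: h ev_step)
  moreover have "(\<lambda>k. op y (ev h) k - \<mu> * ev h k) \<in> W" if y: "(\<lambda>k. op y w k - \<mu> * w k) \<in> W" for y \<mu>
  proof -
    have "(\<lambda>k. \<Sum>i\<le>degree h. coeff h i * op (x ^ i) (\<lambda>k. op y w k - \<mu> * w k) k) \<in> W"
      using y by (intro subsp_sum[OF W(1)] W(2))
    moreover have "op (x ^ i) (\<lambda>k. op y w k - \<mu> * w k) k = op y (op (x ^ i) w) k - \<mu> * op (x ^ i) w k" for i k
      using fun_cong[OF op_lin[of "x ^ i" 1 "op y w" "- \<mu>" w], of k]
      by (simp flip: op_mult add: mult.commute)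
    ultimately have "(\<lambda>k. \<Sum>i\<le>degree h. coeff h i * (op y (op (x ^ i) w) k - \<mu> * op (x ^ i) w k)) \<in> W" by simp
    moreover have "(\<lambda>k. \<Sum>i\<le>degree h. coeff h i * (op y (op (x ^ i) w) k - \<mu> * op (x ^ i) w k))
       = (\<lambda>k. op y (ev h) k - \<mu> * ev h k)"
      by (auto simp: ev_def op_sum_right right_diff_distrib sum_subtractf sum_distrib_left mult_ac)
    ultimately show ?thesis by simp
  qed
  ultimately show ?thesis by (rule that)
qed

text \<open>Treat the basis elements one after the other; an eigenvector for all \<open>b l\<close>
  modulo \<open>W\<close> is one for every \<open>x\<close> by linearity.\<close>

lemma exists_eigenvector:
  assumes W: "subsp W" "\<And>x w. w \<in> W \<Longrightarrow> op x w \<in> W" and ne: "W \<noteq> UNIV"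
  obtains w \<sigma> where "w \<notin> W" "\<And>x. (\<lambda>k. op x w k - \<sigma> x * w k) \<in> W"
proof -
  have "\<exists>w. w \<notin> W \<and> (\<forall>l<n. \<exists>a. (\<lambda>k. op (b l) w k - a * w k) \<in> W)" for n
  proof (induction n)
    case 0 then show ?case using ne by auto
  next
    case (Suc n)
    then obtain w where w: "w \<notin> W" "\<forall>l<n. \<exists>a. (\<lambda>k. op (b l) w k - a * w k) \<in> W" by blast
    obtain a w' where w': "w' \<notin> W" "(\<lambda>k. op (b n) w' k - a * w' k) \<in> W"
      "\<And>y \<mu>. (\<lambda>k. op y w k - \<mu> * w k) \<in> W \<Longrightarrow> (\<lambda>k. op y w' k - \<mu> * w' k) \<in> W"
      by (rule exists_eigenvector_step[OF W w(1), of "b n"]) (assumption | rule that)+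
    have "\<exists>a. (\<lambda>k. op (b l) w' k - a * w' k) \<in> W" if "l < Suc n" for l
    proof (cases "l = n")
      case False
      then show ?thesis using w(2) w'(3) that by (metis less_antisym)
    qed (use w' in blast)
    then show ?case using w'(1) by blast
  qed
  then obtain w where w: "w \<notin> W" "\<forall>l<m. \<exists>a. (\<lambda>k. op (b l) w k - a * w k) \<in> W" by blast
  then obtain a where a: "\<And>l. l < m \<Longrightarrow> (\<lambda>k. op (b l) w k - a l * w k) \<in> W" by metis
  have "(\<lambda>k. op x w k - (\<Sum>l<m. of_rat (c x l) * a l) * w k) \<in> W" for x
  proof -
    have "(\<lambda>k. \<Sum>l<m. of_rat (c x l) * (op (b l) w k - a l * w k)) \<in> W"
      using subsp_sum[OF W(1), of "{..<m}" "\<lambda>l k. op (b l) w k - a l * w k"] a by auto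
    moreover have "(\<Sum>l<m. of_rat (c x l) * (op (b l) w k - a l * w k))
       = op x w k - (\<Sum>l<m. of_rat (c x l) * a l) * w k" for k
    proof -
      have "op x w k = op (\<Sum>l<m. of_rat (c x l) * b l) w k" by (simp add: repr)
      also have "\<dots> = (\<Sum>l<m. op (of_rat (c x l) * b l) w k)" by (rule op_sum_left)
      finally have "op x w k = (\<Sum>l<m. of_rat (c x l) * op (b l) w k)" by (simp add: op_scale_left)
      then show ?thesis by (simp add: right_diff_distrib sum_subtractf sum_distrib_right mult.assoc)
    qed
    ultimately show ?thesis by simp
  qed
  with w(1) show ?thesis by (rule that)
qed

definition flag :: "(nat \<Rightarrow> nat \<Rightarrow> complex) \<Rightarrow> nat \<Rightarrow> (nat \<Rightarrow> complex) set" where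
  "flag v r = {u. \<exists>a. \<forall>k<m. u k = (\<Sum>i<r. a i * v i k)}"

lemma subsp_flag: "subsp (flag v r)"
  unfolding subsp_def
proof (intro conjI ballI allI impI)
  show "(\<lambda>k. 0) \<in> flag v r" by (auto simp: flag_def intro!: exI[of _ "\<lambda>_. 0"])
  fix w w' \<alpha> \<beta> assume "w \<in> flag v r" "w' \<in> flag v r"
  then obtain a a' where "\<forall>k<m. w k = (\<Sum>i<r. a i * v i k)" "\<forall>k<m. w' k = (\<Sum>i<r. a' i * v i k)"
    by (auto simp: flag_def)
  then show "(\<lambda>k. \<alpha> * w k + \<beta> * w' k) \<in> flag v r" unfolding flag_def
    by (intro CollectI exI[of _ "\<lambda>i. \<alpha> * a i + \<beta> * a' i"])
       (auto simp: sum_distrib_left sum.distrib[symmetric] algebra_simps)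
next
  fix w w' assume "w \<in> flag v r" "\<forall>k<m. w k = w' k"
  then show "w' \<in> flag v r" by (auto simp: flag_def)
qed

lemma flag_mono: 
  assumes "r \<le> s"
  shows "flag v r \<subseteq> flag v s"
proof
  fix u assume "u \<in> flag v r"
  then obtain a where a: "\<forall>k<m. u k = (\<Sum>i<r. a i * v i k)" by (auto simp: flag_def)
  have "(\<Sum>i<r. a i * v i k) = (\<Sum>i<s. (if i < r then a i else 0) * v i k)" for k
    by (rule sum.mono_neutral_cong_left) (use assms in auto)
  then show "u \<in> flag v s" using a by (auto simp: flag_def intro!: exI[of _ "\<lambda>i. if i < r then a i else 0"])
qed

lemma mem_flag: "i < r \<Longrightarrow> v i \<in> flag v r"
  by (auto simp: flag_def if_distrib[of "\<lambda>t. t * _"] intro!: exI[of _ "\<lambda>j. if j = i then 1 else 0"] cong: if_cong)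

text \<open>Pad the \<open>r\<close> vectors with zero columns to a square matrix. If they spanned
  everything it would have a right inverse, although it kills the unit vector with index
  \<open>r\<close>.\<close>

lemma flag_not_UNIV:
  assumes "r < m"
  shows "flag v r \<noteq> UNIV"
proof
  assume U: "flag v r = UNIV"
  have "\<exists>a. \<forall>k<m. (if k = j then 1 else 0) = (\<Sum>i<r. a i * v i k)" for j
  proof -
    have "(\<lambda>k. if k = j then 1 else 0) \<in> flag v r" using U by simp
    then show ?thesis by (simp only: flag_def mem_Collect_eq)
  qed
  then obtain a where a: "\<And>j k. k < m \<Longrightarrow> (if k = j then 1 else 0) = (\<Sum>i<r. a j i * v i k)" by metis
  define A where "A = mat m m (\<lambda>(k, i). if i < r then v i k else 0)"
  define B where "B = mat m m (\<lambda>(i, j). a j i)"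
  have AB: "A \<in> carrier_mat m m" "B \<in> carrier_mat m m" by (auto simp: A_def B_def)
  have "A * B = 1\<^sub>m m"
  proof (rule eq_matI)
    fix k j assume kj: "k < dim_row (1\<^sub>m m :: complex mat)" "j < dim_col (1\<^sub>m m :: complex mat)"
    then have "(A * B) $$ (k, j) = (\<Sum>i = 0..<m. (if i < r then v i k else 0) * a j i)"
      by (simp add: A_def B_def scalar_prod_def)
    also have "\<dots> = (\<Sum>i<r. a j i * v i k)"
      by (rule sum.mono_neutral_cong_right) (use assms in auto)
    also have "\<dots> = 1\<^sub>m m $$ (k, j)" using a[of k j] kj by simp
    finally show "(A * B) $$ (k, j) = 1\<^sub>m m $$ (k, j)" .
  qed (auto simp: A_def B_def)
  then have "det A * det B = 1" using det_mult[OF AB] by simp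
  moreover have "A *\<^sub>v unit_vec m r = 0\<^sub>v m"
    by (rule eq_vecI) (use assms in \<open>auto simp: A_def scalar_prod_def unit_vec_def intro!: sum.neutral\<close>)
  then have "det A = 0" using det_0_iff_vec_prod_zero[OF AB(1)] assms
    by (metis unit_vec_carrier unit_vec_nonzero)
  ultimately show False by simp
qed

text \<open>The vectors \<open>v j\<close> put all operators into triangular form at once. The
  diagonal entries \<open>\<sigma> j x\<close> will be the embeddings.\<close>

definition good :: "nat \<Rightarrow> (nat \<Rightarrow> nat \<Rightarrow> complex) \<Rightarrow> (nat \<Rightarrow> 'k \<Rightarrow> complex) \<Rightarrow> bool" where
  "good r v \<sigma> \<longleftrightarrow> (\<forall>j<r. v j \<notin> flag v j \<and> (\<forall>x. (\<lambda>k. op x (v j) k - \<sigma> j x * v j k) \<in> flag v j))"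

lemma flag_invariant:
  assumes "good r v \<sigma>" "w \<in> flag v r"
  shows "op x w \<in> flag v r"
proof -
  have *: "op x (v i) \<in> flag v r" if "i < r" for i
  proof -
    have "(\<lambda>k. op x (v i) k - \<sigma> i x * v i k) \<in> flag v r"
      using assms(1) that flag_mono[of i r v] by (auto simp: good_def)
    from subspD(2)[OF subsp_flag this mem_flag[OF that], of 1 "\<sigma> i x"] show ?thesis by simp
  qed
  obtain a where a: "\<forall>k<m. w k = (\<Sum>i<r. a i * v i k)" using assms(2) by (auto simp: flag_def)
  have "op x w = op x (\<lambda>k. \<Sum>i<r. a i * v i k)" by (rule op_cong) (use a in auto)
  also have "\<dots> = (\<lambda>k. \<Sum>i<r. a i * op x (v i) k)" by (auto simp: op_sum_right)
  also have "\<dots> \<in> flag v r" by (rule subsp_sum[OF subsp_flag]) (use * in auto)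
  finally show ?thesis .
qed

lemma flag_cong: "(\<And>i. i < r \<Longrightarrow> v i = v' i) \<Longrightarrow> flag v r = flag v' r"
  by (auto simp: flag_def)

lemma exists_good: "r \<le> m \<Longrightarrow> \<exists>v \<sigma>. good r v \<sigma>"
proof (induction r)
  case 0 then show ?case by (auto simp: good_def)
next
  case (Suc r)
  then obtain v \<sigma> where g: "good r v \<sigma>" by auto
  obtain w \<tau> where w: "w \<notin> flag v r" "\<And>x. (\<lambda>k. op x w k - \<tau> x * w k) \<in> flag v r"
    by (rule exists_eigenvector[OF subsp_flag flag_invariant[OF g] flag_not_UNIV[of r v]])
       (use Suc.prems in simp | assumption | rule that)+
  define v' \<sigma>' where "v' = v(r := w)" and "\<sigma>' = \<sigma>(r := \<tau>)"
  have fl: "flag v' j = flag v j" if "j \<le> r" for j by (rule flag_cong) (use that in \<open>auto simp: v'_def\<close>)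
  have "good (Suc r) v' \<sigma>'" unfolding good_def
  proof (intro allI impI)
    fix j assume "j < Suc r"
    then consider "j < r" | "j = r" by linarith
    then show "v' j \<notin> flag v' j \<and> (\<forall>x. (\<lambda>k. op x (v' j) k - \<sigma>' j x * v' j k) \<in> flag v' j)"
    proof cases
      case 1 then show ?thesis using g fl[of j] by (simp add: good_def v'_def \<sigma>'_def)
    next
      case 2 then show ?thesis using w fl[of j] by (simp add: v'_def \<sigma>'_def)
    qed
  qed
  then show ?case by blast
qed

text \<open>\<open>\<sigma> j x\<close> is the scalar by which \<open>x\<close> acts on the class of
  \<open>v j\<close> modulo \<open>flag v j\<close>. That class is nonzero, so sums and products of
  operators carry over to the scalars.\<close>

lemma good_hom:
  assumes "good r v \<sigma>" "j < r"
  shows "\<sigma> j (x + y) = \<sigma> j x + \<sigma> j y" "\<sigma> j (x * y) = \<sigma> j x * \<sigma> j y" "\<sigma> j 1 = 1"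
proof -
  have v: "v j \<notin> flag v j" "\<And>x. (\<lambda>k. op x (v j) k - \<sigma> j x * v j k) \<in> flag v j"
    using assms by (auto simp: good_def)
  have gj: "good j v \<sigma>" using assms by (auto simp: good_def)
  have key: "a = 0" if "(\<lambda>k. a * v j k) \<in> flag v j" for a
  proof (rule ccontr)
    assume "a \<noteq> 0"
    then have "(\<lambda>k. inverse a * (a * v j k)) \<in> flag v j" using subspD(6)[OF subsp_flag that] by blast
    then show False using v(1) \<open>a \<noteq> 0\<close> by (simp add: mult.assoc[symmetric])
  qed
  have "(\<lambda>k. (op x (v j) k - \<sigma> j x * v j k) + (op y (v j) k - \<sigma> j y * v j k) - (op (x + y) (v j) k - \<sigma> j (x + y) * v j k)) \<in> flag v j"
    by (intro subspD(4,5)[OF subsp_flag] v(2))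
  then have "(\<lambda>k. (\<sigma> j (x + y) - \<sigma> j x - \<sigma> j y) * v j k) \<in> flag v j"
    by (simp add: op_add_left algebra_simps)
  from key[OF this] show "\<sigma> j (x + y) = \<sigma> j x + \<sigma> j y" by (simp add: algebra_simps)
  have "(\<lambda>k. op x (\<lambda>k. op y (v j) k - \<sigma> j y * v j k) k + \<sigma> j y * (op x (v j) k - \<sigma> j x * v j k) - (op (x * y) (v j) k - \<sigma> j (x * y) * v j k)) \<in> flag v j"
    by (intro subspD(4,5,6)[OF subsp_flag] v(2) flag_invariant[OF gj])
  moreover have "op x (\<lambda>k. op y (v j) k - \<sigma> j y * v j k) k = op (x * y) (v j) k - \<sigma> j y * op x (v j) k" for k
    using fun_cong[OF op_lin[of x 1 "op y (v j)" "- \<sigma> j y" "v j"], of k] by (simp add: op_mult)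
  ultimately have "(\<lambda>k. (\<sigma> j (x * y) - \<sigma> j x * \<sigma> j y) * v j k) \<in> flag v j"
    by (simp add: algebra_simps)
  from key[OF this] show "\<sigma> j (x * y) = \<sigma> j x * \<sigma> j y" by simp
  have "(\<lambda>k. (1 - \<sigma> j 1) * v j k) \<in> flag v j"
    by (rule subspD(3)[OF subsp_flag v(2)[of 1]]) (simp add: op_one algebra_simps)
  from key[OF this] show "\<sigma> j 1 = 1" by simp
qed

text \<open>In the basis \<open>v\<close> multiplication by \<open>x\<close> is upper triangular
  with diagonal \<open>\<sigma> j x\<close>. Hence the product of the \<open>\<sigma> j x\<close> is
  the norm of \<open>x\<close>, the determinant of a rational matrix.\<close>

lemma good_det:
  assumes g: "good m v \<sigma>"
  shows "det (mat m m (\<lambda>(k, j). of_rat (c (x * b j) k))) = (\<Prod>j<m. \<sigma> j x)"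
proof -
  have "\<exists>a. \<forall>k<m. op x (v j) k - \<sigma> j x * v j k = (\<Sum>i<j. a i * v i k)" if "j < m" for j
    using g that by (auto simp: good_def flag_def)
  then obtain a where a: "\<And>j k. j < m \<Longrightarrow> k < m \<Longrightarrow> op x (v j) k - \<sigma> j x * v j k = (\<Sum>i<j. a j i * v i k)"
    by metis
  define L where "L = mat m m (\<lambda>(k, j). of_rat (c (x * b j) k) :: complex)"
  define P where "P = mat m m (\<lambda>(k, j). v j k)"
  define D where "D = mat m m (\<lambda>(i, j). if i < j then a j i else if i = j then \<sigma> j x else 0)"
  have car: "L \<in> carrier_mat m m" "P \<in> carrier_mat m m" "D \<in> carrier_mat m m"
    by (auto simp: L_def P_def D_def)
  have "L * P = P * D"
  proof (rule eq_matI)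
    fix k j assume "k < dim_row (P * D)" "j < dim_col (P * D)"
    then have kj: "k < m" "j < m" by (auto simp: P_def D_def)
    have "(L * P) $$ (k, j) = op x (v j) k"
      using kj by (simp add: L_def P_def scalar_prod_def op_def atLeast0LessThan)
    also have "\<dots> = (\<Sum>i<j. a j i * v i k) + \<sigma> j x * v j k" using a[OF kj(2,1)] by (simp only: diff_eq_eq)
    also have "(\<Sum>i<j. a j i * v i k) = (\<Sum>i\<in>{..<m} - {j}. v i k * (if i < j then a j i else if i = j then \<sigma> j x else 0))"
      by (rule sum.mono_neutral_cong_left) (use kj in auto)
    also have "\<dots> + \<sigma> j x * v j k = (\<Sum>i<m. v i k * (if i < j then a j i else if i = j then \<sigma> j x else 0))"
      using kj by (subst sum.remove[of "{..<m}" j]) (auto simp: mult.commute)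
    also have "\<dots> = (P * D) $$ (k, j)"
      using kj by (simp add: P_def D_def scalar_prod_def atLeast0LessThan)
    finally show "(L * P) $$ (k, j) = (P * D) $$ (k, j)" .
  qed (auto simp: L_def P_def D_def)
  then have "det L * det P = det P * det D" using det_mult car by metis
  moreover have "det P \<noteq> 0"
  proof
    assume "det P = 0"
    then obtain u where u: "u \<in> carrier_vec m" "u \<noteq> 0\<^sub>v m" "P *\<^sub>v u = 0\<^sub>v m"
      using det_0_iff_vec_prod_zero[OF car(2)] by auto
    have expo: "\<exists>i<m. u $ i \<noteq> 0" using u(1,2) by (metis eq_vecI carrier_vecD index_zero_vec)
    \<comment> \<open>The last nonzero entry of a kernel vector would express \<open>v j\<close>
      through the vectors before it.\<close>
    define j where "j = Max {i. i < m \<and> u $ i \<noteq> 0}"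
    have "j \<in> {i. i < m \<and> u $ i \<noteq> 0}" unfolding j_def by (rule Max_in) (use expo in auto)
    then have j: "j < m" "u $ j \<noteq> 0" by auto
    have j': "u $ i = 0" if "j < i" "i < m" for i
      using Max_ge[of "{i. i < m \<and> u $ i \<noteq> 0}" i] that unfolding j_def[symmetric] by fastforce
    have "v j \<in> flag v j" unfolding flag_def
    proof (intro CollectI exI allI impI)
      fix k assume k: "k < m"
      have "0 = (P *\<^sub>v u) $ k" using u(3) k by simp
      also have "\<dots> = (\<Sum>i<m. v i k * u $ i)"
        using k u(1) by (simp add: P_def scalar_prod_def atLeast0LessThan)
      also have "\<dots> = (\<Sum>i<Suc j. v i k * u $ i)"
        by (rule sum.mono_neutral_right) (use j j' in \<open>auto simp: not_less_eq\<close>)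
      finally have "v j k * u $ j = - (\<Sum>i<j. v i k * u $ i)" by (simp add: eq_neg_iff_add_eq_0 add.commute)
      then have "v j k = - (\<Sum>i<j. v i k * u $ i) / u $ j" using j by (simp add: field_simps)
      then show "v j k = (\<Sum>i<j. (- u $ i / u $ j) * v i k)"
        by (simp add: sum_divide_distrib sum_negf[symmetric] mult.commute)
    qed
    then show False using g j by (auto simp: good_def)
  qed
  ultimately have "det L = det D" by simp
  also have "det D = prod_list (diag_mat D)"
    by (rule det_upper_triangular[OF _ car(3)]) (auto simp: D_def)
  also have "\<dots> = (\<Prod>j<m. \<sigma> j x)"
    unfolding prod_list_diag_prod by (rule prod.cong) (auto simp: D_def)
  finally show ?thesis by (simp add: L_def)
qed

end

lemma cnj_of_rat: "cnj (of_rat q) = of_rat q"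
  by (cases q) (simp add: of_rat_rat)

text \<open>The polynomial and its coefficientwise conjugate agree at all natural numbers, so they
  are equal.\<close>

lemma poly_rat_values_real:
  fixes p :: "complex poly"
  assumes "\<And>q::rat. poly p (of_rat q) \<in> \<rat>" "poly p z = 0"
  shows "poly p (cnj z) = 0"
proof -
  define p' where "p' = map_poly cnj p"
  have p': "poly p' (cnj w) = cnj (poly p w)" for w unfolding p'_def by (rule poly_cnj[symmetric]) 
  have "poly (p - p') (of_nat n) = 0" for n
  proof -
    have "poly p (of_rat (of_nat n)) \<in> \<rat>" using assms(1) by blast
    then obtain q where "poly p (of_nat n) = of_rat q" by (auto elim: Rats_cases)
    then have "cnj (poly p (of_nat n)) = poly p (of_nat n)" by (simp add: cnj_of_rat)
    then show ?thesis using p'[of "of_nat n"] by simp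
  qed
  then have "range of_nat \<subseteq> {w. poly (p - p') w = 0}" by (intro subsetI CollectI) (elim rangeE, simp only:)
  moreover have "infinite (range (of_nat :: nat \<Rightarrow> complex))" by (simp add: range_inj_infinite)
  ultimately have "infinite {w. poly (p - p') w = 0}" by (rule infinite_super)
  then have "p - p' = 0" using poly_roots_finite[of "p - p'"] by metis
  then show ?thesis using p'[of z] assms(2) by simp
qed

text \<open>The embeddings may be listed with repetitions as far as this statement is concerned; what
  matters is that the product over the list is rational and that the list is closed under
  complex conjugation.\<close>

theorem exists_embeddings:
  assumes nf: "number_field TYPE('k::field_char_0)"
  obtains \<sigma> :: "nat \<Rightarrow> 'k::field_char_0 \<Rightarrow> complex" where
    "\<And>j x y. j < field_degree TYPE('k::field_char_0) \<Longrightarrow> \<sigma> j (x + y) = \<sigma> j x + \<sigma> j y"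
    "\<And>j x y. j < field_degree TYPE('k::field_char_0) \<Longrightarrow> \<sigma> j (x * y) = \<sigma> j x * \<sigma> j y"
    "\<And>j. j < field_degree TYPE('k::field_char_0) \<Longrightarrow> \<sigma> j 1 = 1"
    "\<And>x. (\<Prod>j<field_degree TYPE('k::field_char_0). \<sigma> j x) \<in> \<rat>"
    "\<And>i. i < field_degree TYPE('k::field_char_0) \<Longrightarrow> \<exists>j<field_degree TYPE('k::field_char_0). \<forall>x. \<sigma> j x = cnj (\<sigma> i x)"
    "field_degree TYPE('k::field_char_0) > 0"
proof -
  define m where "m = field_degree TYPE('k)"
  obtain b :: "nat \<Rightarrow> 'k" and c where "rat_basis m b c"
    using exists_rat_basis[OF nf] unfolding m_def by blast
  then interpret rat_basis m b c .
  obtain v \<sigma> where g: "good m v \<sigma>" using exists_good by blast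
  note hom = good_hom[OF g]
  have m0: "m > 0" using repr[of 1] by (cases m) auto
  have rat: "(\<Prod>j<m. \<sigma> j x) \<in> \<rat>" for x
  proof -
    let ?A = "mat m m (\<lambda>(k, j). c (x * b j) k)"
    have "mat m m (\<lambda>(k, j). of_rat (c (x * b j) k) :: complex) = map_mat of_rat ?A"
      by (rule eq_matI) auto
    then have "(\<Prod>j<m. \<sigma> j x) = of_rat (det ?A)"
      using good_det[OF g, of x] of_rat_hom.hom_det[of ?A, where ?'a = complex] by (simp only:)
    then show ?thesis by simp
  qed
  have nat: "\<sigma> j (of_nat n) = of_nat n" if "j < m" for j n
  proof (induction n)
    case 0 then show ?case using hom(1)[OF that, of 0 0] by simp
  next
    case (Suc n) then show ?case using hom(1)[OF that, of "of_nat n" 1] hom(3)[OF that] by (simp add: add.commute)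
  qed
  have minus: "\<sigma> j (- x) = - \<sigma> j x" if "j < m" for j x
    using hom(1)[OF that, of x "-x"] hom(1)[OF that, of 0 0] by (simp add: eq_neg_iff_add_eq_0 add.commute)
  have int: "\<sigma> j (of_int n) = of_int n" if "j < m" for j n
    using nat[OF that] minus[OF that] by (cases n) (auto simp del: of_nat_Suc)
  have ratq: "\<sigma> j (of_rat q) = of_rat q" if "j < m" for j q
  proof -
    obtain a d where ad: "q = of_int a / of_int d" "d \<noteq> 0"
      by (metis Fract_of_int_quotient quotient_of_denom_pos quotient_of_div prod.collapse less_irrefl)
    have "\<sigma> j (of_rat q) * of_int d = of_int a"
      using hom(2)[OF that, of "of_rat q" "of_int d"] ad(2) int[OF that]
      by (simp add: ad(1) of_rat_divide)
    then show ?thesis using ad(2) by (simp add: ad(1) of_rat_divide eq_divide_eq)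
  qed
  \<comment> \<open>The polynomial with roots \<open>\<sigma> j x\<close> takes values at rational
    points that are norms, hence rational. So its roots are closed under conjugation, but the index
    \<open>j\<close> found here may depend on \<open>x\<close>.\<close>
  have conj_pt: "\<exists>j<m. cnj (\<sigma> i x) = \<sigma> j x" if i: "i < m" for i x
  proof -
    define p where "p = (\<Prod>j<m. [:- \<sigma> j x, 1:])"
    have p: "poly p z = (\<Prod>j<m. (z - \<sigma> j x))" for z by (simp add: p_def poly_prod)
    have "poly p (of_rat q) \<in> \<rat>" for q
    proof -
      have "\<sigma> j (of_rat q - x) = of_rat q - \<sigma> j x" if "j < m" for j
        using hom(1)[OF that, of "of_rat q" "- x"] ratq[OF that] minus[OF that] by simp
      then have "poly p (of_rat q) = (\<Prod>j<m. \<sigma> j (of_rat q - x))" by (simp add: p)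
      then show ?thesis using rat by simp
    qed
    moreover have "poly p (\<sigma> i x) = 0" using i by (auto simp: p)
    ultimately have "poly p (cnj (\<sigma> i x)) = 0" by (rule poly_rat_values_real)
    then show ?thesis by (auto simp: p)
  qed
  have conj: "\<exists>j<m. \<forall>x. \<sigma> j x = cnj (\<sigma> i x)" if i: "i < m" for i
  proof -
    \<comment> \<open>These elements make \<open>j\<close> uniform: infinitely many \<open>n\<close>
      share one \<open>j\<close>, and a polynomial in \<open>n\<close> with infinitely many zeros
      vanishes. So \<open>\<sigma> j\<close> agrees with the conjugate of \<open>\<sigma> i\<close>
      on the basis.\<close>
    define y :: "nat \<Rightarrow> 'k" where "y n = (\<Sum>k<m. of_nat (n ^ k) * b k)" for n
    have sum: "\<sigma> j (\<Sum>k<r. f k) = (\<Sum>k<r. \<sigma> j (f k))" if "j < m" for j r and f :: "nat \<Rightarrow> 'k"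
      using nat[OF that, of 0] by (induction r) (simp_all add: hom(1)[OF that])
    have "\<forall>n. \<exists>j. j < m \<and> cnj (\<sigma> i (y n)) = \<sigma> j (y n)" using conj_pt[OF i] by blast
    then obtain J where J: "\<And>n. J n < m" "\<And>n. cnj (\<sigma> i (y n)) = \<sigma> (J n) (y n)" by metis
    have "\<exists>j\<in>{..<m}. infinite {n \<in> (UNIV :: nat set). J n = j}"
      by (rule pigeonhole_infinite_rel) (use J in auto)
    then obtain j where j: "j < m" "infinite {n. J n = j}" by auto
    define p where "p = (\<Sum>k<m. monom (\<sigma> j (b k) - cnj (\<sigma> i (b k))) k)"
    have "poly p (of_nat n) = 0" if "J n = j" for n
    proof -
      have "\<sigma> l (y n) = (\<Sum>k<m. of_nat (n ^ k) * \<sigma> l (b k))" if "l < m" for l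
        unfolding y_def by (simp only: sum[OF that] hom(2)[OF that] nat[OF that])
      then have "(\<Sum>k<m. of_nat (n ^ k) * \<sigma> j (b k)) = (\<Sum>k<m. of_nat (n ^ k) * cnj (\<sigma> i (b k)))"
        using J(2)[of n] that i j by simp
      then show ?thesis
        by (simp add: p_def poly_sum poly_monom left_diff_distrib right_diff_distrib sum_subtractf mult.commute)
    qed
    then have "of_nat ` {n. J n = j} \<subseteq> {z. poly p z = 0}" by (intro image_subsetI CollectI) (elim CollectE)
    moreover have "infinite ((of_nat :: nat \<Rightarrow> complex) ` {n. J n = j})"
      using j(2) by (simp add: finite_image_iff inj_on_def)
    ultimately have "infinite {z. poly p z = 0}" by (rule infinite_super)
    then have "p = 0" using poly_roots_finite[of p] by metis
    have eq: "\<sigma> j (b k) = cnj (\<sigma> i (b k))" if "k < m" for k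
    proof -
      have "coeff p k = \<sigma> j (b k) - cnj (\<sigma> i (b k))"
        using that by (simp add: p_def coeff_sum if_distrib cong: if_cong)
      then show ?thesis using \<open>p = 0\<close> by simp
    qed
    have "\<sigma> j x = cnj (\<sigma> i x)" for x
    proof -
      have "\<sigma> l x = (\<Sum>k<m. of_rat (c x k) * \<sigma> l (b k))" if "l < m" for l
        by (subst repr[of x, symmetric]) (simp only: sum[OF that] hom(2)[OF that] ratq[OF that])
      then show ?thesis using i j eq by (simp add: cnj_of_rat)
    qed
    then show ?thesis using j by blast
  qed
  show ?thesis by (rule that[of \<sigma>]) (use hom rat conj m0 in \<open>auto simp: m_def[symmetric]\<close>)
qed

section \<open>The product formula\<close>

text \<open>By multiplicativity only units and primes matter; a prime r contributes ln r at the
  usual absolute value and - ln r at r alone.\<close>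

lemma sum_ln_padic_int:
  fixes w :: "nat \<Rightarrow> 'a::field_char_0 \<Rightarrow> real"
  assumes Q: "finite Q" "\<And>p. p \<in> Q \<Longrightarrow> prime p"
    and w: "\<And>p. p \<in> Q \<Longrightarrow> w p (of_nat p) = 1 / real p"
      "\<And>p n. p \<in> Q \<Longrightarrow> \<not> int p dvd n \<Longrightarrow> w p (of_int n) = 1"
      "\<And>p a b. p \<in> Q \<Longrightarrow> w p (of_int a * of_int b) = w p (of_int a) * w p (of_int b)"
    and n: "n \<noteq> 0" "\<And>p. prime p \<Longrightarrow> int p dvd n \<Longrightarrow> p \<in> Q"
  shows "ln \<bar>of_int n\<bar> + (\<Sum>p\<in>Q. ln (w p (of_int n))) = 0 \<and> (\<forall>p\<in>Q. w p (of_int n) > 0)"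
  using n
proof (induction n rule: prime_divisors_induct)
  case (unit x)
  then have x: "\<bar>x\<bar> = 1" by simp
  have "w p (of_int x) = 1" if "p \<in> Q" for p
    using w(2)[OF that, of x] unit Q(2)[OF that] 
    by (metis dvd_unit_imp_unit not_prime_unit prime_nat_int_transfer)
  then show ?case using x by simp
next
  case (factor q x)
  define r where "r = nat q"
  have r: "q = int r" "prime r" using factor.hyps by (auto simp: r_def prime_int_iff' prime_nat_int_transfer[symmetric] prime_ge_0_int)
  have x: "x \<noteq> 0" "\<And>p. prime p \<Longrightarrow> int p dvd x \<Longrightarrow> p \<in> Q" using factor.prems by auto
  have IH: "ln \<bar>of_int x\<bar> + (\<Sum>p\<in>Q. ln (w p (of_int x))) = 0" "\<forall>p\<in>Q. w p (of_int x) > 0"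
    using factor.IH[OF x] by auto
  have rQ: "r \<in> Q" using factor.prems(2)[of r] r by simp
  have wq: "w p (of_int q) = (if p = r then 1 / real r else 1)" if "p \<in> Q" for p
  proof (cases "p = r")
    case False
    then have "\<not> int p dvd q" using Q(2)[OF that] r by (simp add: primes_dvd_imp_eq) (metis primes_dvd_imp_eq)
    then show ?thesis using w(2)[OF that] False by simp
  qed (use w(1)[OF that] r in simp)
  have "(\<Sum>p\<in>Q. ln (w p (of_int (q * x)))) = (\<Sum>p\<in>Q. ln (w p (of_int q)) + ln (w p (of_int x)))"
  proof (rule sum.cong[OF refl])
    fix p assume p: "p \<in> Q"
    have "w p (of_int (q * x)) = w p (of_int q) * w p (of_int x)" using w(3)[OF p, of q x] by simp
    moreover have "w p (of_int q) > 0" using wq[OF p] prime_gt_0_nat[OF r(2)] by simp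
    ultimately show "ln (w p (of_int (q * x))) = ln (w p (of_int q)) + ln (w p (of_int x))"
      using IH(2) p by (simp add: ln_mult_pos)
  qed
  also have "\<dots> = (\<Sum>p\<in>Q. ln (w p (of_int q))) + (\<Sum>p\<in>Q. ln (w p (of_int x)))" by (rule sum.distrib)
  also have "(\<Sum>p\<in>Q. ln (w p (of_int q))) = (\<Sum>p\<in>Q. if p = r then ln (1 / real r) else 0)"
    by (rule sum.cong) (auto simp: wq)
  also have "\<dots> = - ln (real r)" using Q(1) rQ prime_gt_0_nat[OF r(2)] by (simp add: ln_div)
  finally have s: "(\<Sum>p\<in>Q. ln (w p (of_int (q * x)))) = - ln (real r) + (\<Sum>p\<in>Q. ln (w p (of_int x)))" .
  have "ln \<bar>of_int (q * x)\<bar> = ln (real r) + ln \<bar>of_int x :: real\<bar>"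
    using r(1) x(1) prime_gt_0_nat[OF r(2)] by (simp add: abs_mult ln_mult_pos)
  moreover have "w p (of_int (q * x)) > 0" if "p \<in> Q" for p
    using w(3)[OF that, of q x] wq[OF that] IH(2) that prime_gt_0_nat[OF r(2)] by simp
  ultimately show ?case using s IH(1) by simp
qed simp

lemma finite_nat_dvd_int:
  assumes "d \<noteq> 0"
  shows "finite {p::nat. int p dvd d}"
proof (rule finite_subset)
  show "{p. int p dvd d} \<subseteq> {..nat \<bar>d\<bar>}" using dvd_imp_le_int[OF assms] by force
qed simp

lemma number_field_algebraic:
  fixes x :: "'k::field_char_0"
  assumes "number_field TYPE('k)"
  shows "algebraic x"
proof -
  obtain a :: "nat \<Rightarrow> rat" and n where a: "\<exists>i\<le>n. a i \<noteq> 0" "(\<Sum>i\<le>n. of_rat (a i) * x ^ i) = 0"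
    using number_field_annihilator[OF assms] by metis
  define p where "p = (\<Sum>i\<le>n. monom (of_rat (a i) :: 'k) i)"
  have c: "coeff p i = (if i \<le> n then of_rat (a i) else 0)" for i
    by (simp add: p_def coeff_sum if_distrib cong: if_cong)
  show ?thesis
  proof (rule algebraicI'[of p])
    show "p \<noteq> 0" using a(1) c by (metis coeff_0 of_rat_eq_0_iff)
    show "poly p x = 0" using a(2) by (simp add: p_def poly_sum poly_monom)
  qed (simp add: c)
qed

lemma abs_val_simps:
  assumes "absolute_value f"
  shows "f x \<ge> 0" "f x = 0 \<longleftrightarrow> x = 0" "f (x * y) = f x * f y" "f (x + y) \<le> f x + f y" "f 1 = 1" "f (- x) = f x"
    "x \<noteq> 0 \<Longrightarrow> f x > 0"
proof -
  show A: "f x \<ge> 0" "f x = 0 \<longleftrightarrow> x = 0" "f (x * y) = f x * f y" "f (x + y) \<le> f x + f y" for x y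
    using assms by (auto simp: absolute_value_def)
  have "f 1 * f 1 = f 1" "f 1 \<noteq> 0" using A(3)[of 1 1] A(2)[of 1] by auto
  then show 1: "f 1 = 1" by simp
  have "f (-1) * f (-1) = 1" using A(3)[of "-1" "-1"] 1 by simp
  then have "f (-1) = 1" using A(1)[of "-1"] by (metis abs_of_nonneg abs_mult_self_eq real_sqrt_abs2 real_sqrt_one)
  then show "f (- x) = f x" using A(3)[of "-1" x] by simp
  show "x \<noteq> 0 \<Longrightarrow> f x > 0" using A(1)[of x] A(2)[of x] by linarith
qed

section \<open>Absolute values from embeddings and their product formula\<close>

locale embeddings =
  fixes m :: nat and \<sigma> :: "nat \<Rightarrow> 'k::field_char_0 \<Rightarrow> complex"
  assumes nf: "number_field TYPE('k)"
    and \<sigma>_add: "j < m \<Longrightarrow> \<sigma> j (x + y) = \<sigma> j x + \<sigma> j y"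
    and \<sigma>_mult: "j < m \<Longrightarrow> \<sigma> j (x * y) = \<sigma> j x * \<sigma> j y"
    and \<sigma>_one: "j < m \<Longrightarrow> \<sigma> j 1 = 1"
    and \<sigma>_rat: "(\<Prod>j<m. \<sigma> j x) \<in> \<rat>"
    and \<sigma>_cnj: "i < m \<Longrightarrow> \<exists>j<m. \<forall>x. \<sigma> j x = cnj (\<sigma> i x)"
    and m_pos: "m > 0"
begin

lemma \<sigma>_zero: "j < m \<Longrightarrow> \<sigma> j 0 = 0" using \<sigma>_add[of j 0 0] by simp

lemma \<sigma>_minus: "j < m \<Longrightarrow> \<sigma> j (- x) = - \<sigma> j x"
  using \<sigma>_add[of j x "-x"] \<sigma>_zero[of j] by (simp add: eq_neg_iff_add_eq_0 add.commute)

lemma \<sigma>_power: "j < m \<Longrightarrow> \<sigma> j (x ^ n) = \<sigma> j x ^ n"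
  by (induction n) (auto simp: \<sigma>_one \<sigma>_mult)

lemma \<sigma>_of_nat: "j < m \<Longrightarrow> \<sigma> j (of_nat n) = of_nat n"
  by (induction n) (auto simp: \<sigma>_one \<sigma>_add \<sigma>_zero)

lemma \<sigma>_of_int: "j < m \<Longrightarrow> \<sigma> j (of_int n) = of_int n"
  by (cases n) (auto simp: \<sigma>_of_nat \<sigma>_minus simp del: of_nat_Suc)

lemma \<sigma>_sum: "j < m \<Longrightarrow> \<sigma> j (sum f I) = (\<Sum>i\<in>I. \<sigma> j (f i))"
  by (induction I rule: infinite_finite_induct) (auto simp: \<sigma>_zero \<sigma>_add)

lemma \<sigma>_eq_0_iff: "j < m \<Longrightarrow> \<sigma> j x = 0 \<longleftrightarrow> x = 0"
proof
  assume j: "j < m" and "\<sigma> j x = 0"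
  show "x = 0"
  proof (rule ccontr)
    assume "x \<noteq> 0"
    then have "\<sigma> j (x * inverse x) = 1" using \<sigma>_one[OF j] by simp
    then show False using \<sigma>_mult[OF j, of x "inverse x"] \<open>\<sigma> j x = 0\<close> by simp
  qed
qed (use \<sigma>_zero in auto)

text \<open>A single integer polynomial serves all embeddings, so a prime not dividing its leading
  coefficient makes all \<open>\<sigma> j x\<close> integral together.\<close>

lemma int_poly_root:
  obtains P :: "complex poly" and a where "\<And>i. coeff P i = of_int (a i)" "P \<noteq> 0" "\<And>j. j < m \<Longrightarrow> poly P (\<sigma> j x) = 0"
proof -
  obtain p where p: "\<And>i. coeff p i \<in> \<int>" "p \<noteq> 0" "poly p x = 0"
    using number_field_algebraic[OF nf, of x] unfolding algebraic_def by blast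
  have "\<forall>i. \<exists>k. coeff p i = of_int k" using p(1) by (auto elim: Ints_cases)
  then obtain a where a: "\<And>i. coeff p i = of_int (a i)" by metis
  define P where "P = (\<Sum>i\<le>degree p. monom (of_int (a i) :: complex) i)"
  have "coeff P i = of_int (a i)" for i
  proof (cases "i \<le> degree p")
    case False
    then have "a i = 0" using a[of i] coeff_eq_0[of p i] by simp
    then show ?thesis by (simp add: P_def coeff_sum if_distrib cong: if_cong)
  qed (simp add: P_def coeff_sum if_distrib cong: if_cong)
  moreover have "P \<noteq> 0"
  proof
    assume "P = 0"
    then have "a (degree p) = 0" using calculation[of "degree p"] by simp
    then show False using a[of "degree p"] p(2) by simp
  qed
  moreover have "poly P (\<sigma> j x) = 0" if j: "j < m" for j
  proof -
    have "poly P (\<sigma> j x) = \<sigma> j (\<Sum>i\<le>degree p. of_int (a i) * x ^ i)"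
      using j by (simp add: P_def poly_sum poly_monom \<sigma>_sum \<sigma>_mult \<sigma>_of_int \<sigma>_power)
    also have "(\<Sum>i\<le>degree p. of_int (a i) * x ^ i) = poly p x" by (simp add: poly_altdef a)
    finally show ?thesis using p(3) \<sigma>_zero j by simp
  qed
  ultimately show ?thesis by (rule that)
qed

lemma \<sigma>_algebraic: "j < m \<Longrightarrow> algebraic (\<sigma> j x)"
proof -
  assume j: "j < m"
  obtain P :: "complex poly" and a where P: "\<And>i. coeff P i = of_int (a i)" "P \<noteq> 0" "\<And>j. j < m \<Longrightarrow> poly P (\<sigma> j x) = 0"
    using int_poly_root[of x] by metis
  show ?thesis by (rule algebraicI[of P]) (use P j in auto)
qed

end

locale padic_absolute_value =
  fixes p :: nat and v :: "complex \<Rightarrow> real"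
  assumes zero: "v 0 = 0"
    and pos: "algebraic z \<Longrightarrow> z \<noteq> 0 \<Longrightarrow> v z > 0"
    and mult: "algebraic z \<Longrightarrow> algebraic z' \<Longrightarrow> v (z * z') = v z * v z'"
    and add: "algebraic z \<Longrightarrow> algebraic z' \<Longrightarrow> algebraic (z + z') \<Longrightarrow> v (z + z') \<le> max (v z) (v z')"
    and prod: "finite I \<Longrightarrow> (\<And>i. i \<in> I \<Longrightarrow> algebraic (f i)) \<Longrightarrow> v (\<Prod>i\<in>I. f i) = (\<Prod>i\<in>(I::nat set). v (f i))"
    and p: "v (of_nat p) = 1 / real p"
    and int: "\<not> int p dvd n \<Longrightarrow> v (of_int n) = 1"
    and integral: "(\<And>i. coeff P i = of_int (a i)) \<Longrightarrow> poly P z = 0 \<Longrightarrow> \<not> int p dvd a (degree P) \<Longrightarrow> v z \<le> 1"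

locale padic_embeddings = embeddings +
  fixes w :: "nat \<Rightarrow> complex \<Rightarrow> real"
  assumes padic: "prime p \<Longrightarrow> padic_absolute_value p (w p)"
begin

lemmas w_zero = padic_absolute_value.zero[OF padic]
  and w_pos = padic_absolute_value.pos[OF padic]
  and w_mult = padic_absolute_value.mult[OF padic]
  and w_add = padic_absolute_value.add[OF padic]
  and w_prod = padic_absolute_value.prod[OF padic]
  and w_p = padic_absolute_value.p[OF padic]
  and w_int = padic_absolute_value.int[OF padic]
  and w_integral = padic_absolute_value.integral[OF padic]

text \<open>The index \<open>p = 0\<close> stands for the complex absolute value.\<close>

definition F :: "nat \<Rightarrow> nat \<Rightarrow> 'a \<Rightarrow> real" where
  "F i p x = (if p = 0 then cmod (\<sigma> i x) else w p (\<sigma> i x))"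

lemma F_mult: "i < m \<Longrightarrow> p = 0 \<or> prime p \<Longrightarrow> F i p (x * y) = F i p x * F i p y"
  using prime_gt_0_nat by (auto simp: F_def \<sigma>_mult norm_mult w_mult \<sigma>_algebraic)

lemma F_ultra:
  assumes "i < m" "prime p"
  shows "F i p (x + y) \<le> max (F i p x) (F i p y)"
proof -
  have "algebraic (\<sigma> i x + \<sigma> i y)" using \<sigma>_algebraic[OF assms(1), of "x + y"] assms(1) by (simp add: \<sigma>_add)
  then show ?thesis using w_add assms prime_gt_0_nat by (auto simp: F_def \<sigma>_add \<sigma>_algebraic)
qed

lemma F_abs: assumes "i < m" "p = 0 \<or> prime p" shows "absolute_value (F i p)"
proof -
  have nn: "F i p x \<ge> 0" for x
    using assms w_zero w_pos \<sigma>_algebraic[OF assms(1), of x] by (cases "\<sigma> i x = 0") (auto simp: F_def less_imp_le)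
  have "F i p x = 0 \<longleftrightarrow> x = 0" for x
    using assms w_zero w_pos[of p "\<sigma> i x"] \<sigma>_algebraic[OF assms(1), of x] \<sigma>_eq_0_iff[OF assms(1), of x]
    by (auto simp: F_def)
  moreover have "F i p (x + y) \<le> F i p x + F i p y" for x y
  proof (cases "p = 0")
    case True then show ?thesis using assms by (simp add: F_def \<sigma>_add norm_triangle_ineq)
  next
    case False
    then have "F i p (x + y) \<le> max (F i p x) (F i p y)" using F_ultra assms by blast
    then show ?thesis using nn[of x] nn[of y] by linarith
  qed
  ultimately show ?thesis using nn F_mult[OF assms] by (simp add: absolute_value_def)
qed

lemma F_p: "i < m \<Longrightarrow> prime p \<Longrightarrow> F i p (of_nat p) = 1 / real p"
  using prime_gt_0_nat by (auto simp: F_def \<sigma>_of_nat w_p)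

lemma F_prime: "i < m \<Longrightarrow> prime p \<Longrightarrow> prime q \<Longrightarrow> p \<noteq> q \<Longrightarrow> F i p (of_nat q) = 1"
proof -
  assume a: "i < m" "prime p" "prime q" "p \<noteq> q"
  then have "\<not> int p dvd int q" by (metis int_dvd_int_iff primes_dvd_imp_eq)
  then show ?thesis using w_int[of p "int q"] a prime_gt_0_nat by (auto simp: F_def \<sigma>_of_nat)
qed

text \<open>At a prime dividing neither leading coefficient of the integer equations for x and 1/x,
  both have absolute value at most 1, hence exactly 1.\<close>

lemma F_finite:
  assumes x: "x \<noteq> 0"
  shows "finite {p. prime p \<and> (\<exists>i<m. F i p x \<noteq> 1)}"
proof -
  obtain P :: "complex poly" and a where P: "\<And>i. coeff P i = of_int (a i)" "P \<noteq> 0" "\<And>j. j < m \<Longrightarrow> poly P (\<sigma> j x) = 0"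
    using int_poly_root[of x] by metis
  obtain P' :: "complex poly" and a' where P': "\<And>i. coeff P' i = of_int (a' i)" "P' \<noteq> 0"
    "\<And>j. j < m \<Longrightarrow> poly P' (\<sigma> j (inverse x)) = 0" using int_poly_root[of "inverse x"] by metis
  define d where "d = a (degree P) * a' (degree P')"
  have "a (degree P) \<noteq> 0" "a' (degree P') \<noteq> 0" using P P' by (metis leading_coeff_0_iff of_int_0)+
  then have d0: "d \<noteq> 0" by (simp add: d_def)
  have "{p. prime p \<and> (\<exists>i<m. F i p x \<noteq> 1)} \<subseteq> {p. int p dvd d}"
  proof (rule subsetI, rule ccontr)
    fix p assume "p \<in> {p. prime p \<and> (\<exists>i<m. F i p x \<noteq> 1)}" "p \<notin> {p. int p dvd d}"
    then obtain i where i: "prime p" "i < m" "F i p x \<noteq> 1" and nd: "\<not> int p dvd d" by auto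
    have "w p (\<sigma> i x) \<le> 1"
      by (rule w_integral[of p P a]) (use P i nd in \<open>auto simp: d_def\<close>)
    moreover have "w p (\<sigma> i (inverse x)) \<le> 1"
      by (rule w_integral[of p P' a']) (use P' i nd in \<open>auto simp: d_def\<close>)
    ultimately have "F i p x \<le> 1" "F i p (inverse x) \<le> 1" using prime_gt_0_nat[OF i(1)] by (auto simp: F_def)
    moreover have "F i p x * F i p (inverse x) = 1"
      using F_mult[OF i(2), of p x "inverse x"] abs_val_simps(5)[OF F_abs[OF i(2), of p]] i x by simp
    moreover have "F i p x > 0" using abs_val_simps(7)[OF F_abs[OF i(2), of p]] x i by simp
    ultimately have "F i p x = 1" by (smt (verit) mult_left_le mult_less_cancel_left2)
    then show False using i by simp
  qed
  then show ?thesis using finite_nat_dvd_int[OF d0] by (rule finite_subset)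
qed

text \<open>For fixed \<open>p\<close> the same extension \<open>w p\<close> is composed with every
  embedding, so the sum over embeddings is the logarithm of \<open>w p\<close> at the norm a / d.
  The formula for the integers a and d does the rest.\<close>

theorem product_formula:
  assumes x: "x \<noteq> 0" and Q: "finite Q" "\<And>p. p \<in> Q \<Longrightarrow> prime p" "\<And>p i. prime p \<Longrightarrow> i < m \<Longrightarrow> F i p x \<noteq> 1 \<Longrightarrow> p \<in> Q"
  shows "(\<Sum>p\<in>insert 0 Q. \<Sum>i<m. ln (F i p x)) = 0"
proof -
  obtain r where r: "(\<Prod>j<m. \<sigma> j x) = of_rat r" using \<sigma>_rat[of x] by (auto elim: Rats_cases)
  obtain a d where ad: "r = of_int a / of_int d" "d \<noteq> 0"
    by (metis Fract_of_int_quotient quotient_of_denom_pos quotient_of_div prod.collapse less_irrefl)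
  define N where "N = (\<Prod>j<m. \<sigma> j x)"
  have N: "N * of_int d = of_int a" using r ad by (simp add: N_def of_rat_divide)
  have N0: "N \<noteq> 0" using x \<sigma>_eq_0_iff by (simp add: N_def)
  then have a0: "a \<noteq> 0" using N ad(2) by auto
  have fin: "finite {p. prime p \<and> int p dvd a * d}"
    by (rule finite_subset[OF _ finite_nat_dvd_int[of "a * d"]]) (use a0 ad(2) in auto)
  \<comment> \<open>The formula for integers needs all primes dividing \<open>a * d\<close>; those
    not in \<open>Q\<close> contribute zero to the sum over embeddings.\<close>
  define Q' where "Q' = Q \<union> {p. prime p \<and> int p dvd a * d}"
  have Q': "finite Q'" "\<And>p. p \<in> Q' \<Longrightarrow> prime p" using Q fin by (auto simp: Q'_def)
  have A: "ln \<bar>of_int n\<bar> + (\<Sum>p\<in>Q'. ln (w p (of_int n))) = 0 \<and> (\<forall>p\<in>Q'. w p (of_int n) > 0)" if "n \<noteq> 0" "n dvd a * d" for n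
  proof -
    have h: "\<And>p. p \<in> Q' \<Longrightarrow> w p (of_nat p) = 1 / real p"
      "\<And>p n. p \<in> Q' \<Longrightarrow> \<not> int p dvd n \<Longrightarrow> w p (of_int n) = 1"
      "\<And>p a b. p \<in> Q' \<Longrightarrow> w p (of_int a * of_int b) = w p (of_int a) * w p (of_int b)"
      using Q'(2) w_p w_int w_mult by auto
    have "p \<in> Q'" if "prime p" "int p dvd n" for p
      using that \<open>n dvd a * d\<close> by (auto simp: Q'_def intro: dvd_trans)
    from sum_ln_padic_int[where w = w and Q = Q', OF Q' h \<open>n \<noteq> 0\<close> this] show ?thesis .
  qed
  have wN: "w p N * w p (of_int d) = w p (of_int a)" if "p \<in> Q'" for p
  proof -
    have "algebraic N" by (simp add: N_def r rat_imp_algebraic)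
    then show ?thesis using w_mult[of p N "of_int d"] Q'(2)[OF that] N by simp
  qed
  have "(\<Sum>p\<in>Q'. ln (w p N)) = (\<Sum>p\<in>Q'. ln (w p (of_int a)) - ln (w p (of_int d)))"
  proof (rule sum.cong[OF refl])
    fix p assume p: "p \<in> Q'"
    have "w p (of_int a) > 0" "w p (of_int d) > 0" using A[of a] A[of d] a0 ad(2) p by auto
    moreover then have "w p N = w p (of_int a) / w p (of_int d)" using wN[OF p] by (simp add: field_simps)
    ultimately show "ln (w p N) = ln (w p (of_int a)) - ln (w p (of_int d))" by (simp add: ln_div)
  qed
  also have "\<dots> = ln \<bar>of_int d\<bar> - ln \<bar>of_int a\<bar>"
    using A[of a] A[of d] a0 ad(2) by (simp add: sum_subtractf)
  also have "\<dots> = - ln (cmod N)"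
  proof -
    have "cmod N * \<bar>of_int d\<bar> = \<bar>of_int a\<bar>" using arg_cong[OF N, of cmod] by (simp add: norm_mult)
    then have "ln (cmod N) + ln \<bar>of_int d :: real\<bar> = ln \<bar>of_int a :: real\<bar>"
      using N0 ad(2) by (subst ln_mult_pos[symmetric]) auto
    then show ?thesis by simp
  qed
  finally have S: "ln (cmod N) + (\<Sum>p\<in>Q'. ln (w p N)) = 0" by simp
  have "F i p x > 0" if "i < m" "p = 0 \<or> prime p" for i p
    using abs_val_simps(7)[OF F_abs[OF that]] x by simp
  note Fpos = this
  have lnN: "ln (cmod N) = (\<Sum>i<m. ln (F i 0 x))"
    unfolding N_def using x \<sigma>_eq_0_iff
    by (subst prod_norm[symmetric], subst ln_prod) (auto simp: F_def)
  have lnwN: "ln (w p N) = (\<Sum>i<m. ln (F i p x))" if "p \<in> Q'" for p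
  proof -
    have p: "prime p" using Q' that by auto
    have "w p N = (\<Prod>i<m. F i p x)"
      unfolding N_def using p prime_gt_0_nat[OF p] w_prod[of p "{..<m}" "\<lambda>j. \<sigma> j x"] \<sigma>_algebraic by (simp add: F_def)
    moreover have "F i p x \<noteq> 0" if "i < m" for i using Fpos[of i p] p that by simp
    ultimately show ?thesis by (simp only:) (subst ln_prod, auto)
  qed
  have "(\<Sum>p\<in>Q'. \<Sum>i<m. ln (F i p x)) = (\<Sum>p\<in>Q. \<Sum>i<m. ln (F i p x))"
  proof (rule sum.mono_neutral_right[OF Q'(1)])
    show "Q \<subseteq> Q'" by (auto simp: Q'_def)
    show "\<forall>p\<in>Q' - Q. (\<Sum>i<m. ln (F i p x)) = 0"
    proof
      fix p assume "p \<in> Q' - Q"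
      then have "F i p x = 1" if "i < m" for i using Q(3)[of p i] Q'(2) that by auto
      then show "(\<Sum>i<m. ln (F i p x)) = 0" by simp
    qed
  qed
  moreover have "0 \<notin> Q" using Q(2)[of 0] by auto
  ultimately show ?thesis using S lnN lnwN Q(1) by simp
qed

end

section \<open>Pade forms\<close>

definition poly_integral :: "'a::field_char_0 poly \<Rightarrow> 'a poly" where
  "poly_integral p = (\<Sum>i\<le>degree p. monom (coeff p i / of_nat (Suc i)) (Suc i))"

lemma coeff_mult_degree_le:
  fixes p q :: "'a::comm_semiring_0 poly"
  assumes "degree p \<le> a" "degree q \<le> b"
  shows "coeff (p * q) (a + b) = coeff p a * coeff q b"
proof -
  have "coeff (p * q) (a + b) = (\<Sum>i\<in>{a}. coeff p i * coeff q (a + b - i))"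
    unfolding coeff_mult
  proof (rule sum.mono_neutral_right)
    show "\<forall>i\<in>{..a + b} - {a}. coeff p i * coeff q (a + b - i) = 0"
    proof
      fix i assume "i \<in> {..a + b} - {a}"
      then consider "i > a" | "a + b - i > b" by force
      then show "coeff p i * coeff q (a + b - i) = 0"
        using assms by cases (simp_all add: coeff_eq_0)
    qed
  qed auto
  then show ?thesis by simp
qed

lemma pderiv_poly_integral: "pderiv (poly_integral p) = p"
proof (rule poly_eqI)
  fix n
  have "coeff (poly_integral p) (Suc n) = coeff p n / of_nat (Suc n)"
    by (auto simp: poly_integral_def coeff_sum if_distrib coeff_eq_0 cong: if_cong)
  then show "coeff (pderiv (poly_integral p)) n = coeff p n" by (simp add: coeff_pderiv del: of_nat_Suc)
qed

text \<open>The formal integral of \<open>f\<close> from \<open>a\<close> to \<open>b\<close>, which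
  makes sense over any field of characteristic zero.\<close>

definition period :: "'a::field_char_0 \<Rightarrow> 'a \<Rightarrow> 'a poly \<Rightarrow> 'a" where
  "period a b f = poly (poly_integral f) b - poly (poly_integral f) a"

lemma period_pderiv: "period a b (pderiv G) = poly G b - poly G a"
proof -
  have "pderiv (poly_integral (pderiv G) - G) = 0" by (simp add: pderiv_diff pderiv_poly_integral)
  then have "degree (poly_integral (pderiv G) - G) = 0" by (simp add: pderiv_eq_0_iff)
  then obtain c where "poly_integral (pderiv G) - G = [:c:]" by (rule degree_eq_zeroE)
  then have "poly_integral (pderiv G) = G + [:c:]" by (simp add: algebra_simps)
  then show ?thesis by (simp add: period_def)
qed

lemma period_add: "period a b (f + g) = period a b f + period a b g"
  using period_pderiv[of a b "poly_integral f + poly_integral g"] by (simp add: pderiv_add pderiv_poly_integral period_def)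

lemma period_smult: "period a b (Polynomial.smult c f) = c * period a b f"
  using period_pderiv[of a b "Polynomial.smult c (poly_integral f)"] by (simp add: pderiv_smult pderiv_poly_integral period_def algebra_simps)

lemma period_sum: "period a b (sum f I) = (\<Sum>i\<in>I. period a b (f i))"
proof (induction I rule: infinite_finite_induct)
  have "period a b 0 = 0" using period_smult[of a b 0 0] by simp
  { case (infinite I) then show ?case using \<open>period a b 0 = 0\<close> by simp }
  { case empty then show ?case using \<open>period a b 0 = 0\<close> by simp }
qed (simp add: period_add)

text \<open>The Beta integral, by integration by parts, which trades an exponent of the second
  factor for one of the first.\<close>

lemma period_beta:
  "period \<alpha> \<beta> ([:-\<alpha>, 1:] ^ a * [:-\<beta>, 1:] ^ b)
     = (-1) ^ b * (fact a * fact b / fact (a + b + 1)) * (\<beta> - \<alpha>) ^ (a + b + 1)"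
proof (induction b arbitrary: a)
  case 0
  have "pderiv (Polynomial.smult (1 / of_nat (Suc a)) ([:-\<alpha>, 1:] ^ Suc a)) = [:-\<alpha>, 1:] ^ a"
    by (simp add: pderiv_smult pderiv_power_Suc pderiv_pCons del: of_nat_Suc power_Suc)
  then have "period \<alpha> \<beta> ([:-\<alpha>, 1:] ^ a) = (\<beta> - \<alpha>) ^ Suc a / of_nat (Suc a)"
    using period_pderiv[of \<alpha> \<beta> "Polynomial.smult (1 / of_nat (Suc a)) ([:-\<alpha>, 1:] ^ Suc a)"]
    by (simp del: of_nat_Suc power_Suc)
  moreover have "fact a * fact 0 / fact (a + 0 + 1) = (1 / of_nat (Suc a) :: 'a)"
    by (simp del: of_nat_Suc)
  ultimately show ?case by (simp del: of_nat_Suc fact_Suc)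
next
  case (Suc b)
  let ?A = "[:-\<alpha>, 1:]" and ?B = "[:-\<beta>, 1:]"
  have "pderiv (?A ^ Suc a * ?B ^ Suc b)
      = Polynomial.smult (of_nat (Suc a)) (?A ^ a * ?B ^ Suc b) + Polynomial.smult (of_nat (Suc b)) (?A ^ Suc a * ?B ^ b)"
    by (simp add: pderiv_mult pderiv_power_Suc pderiv_pCons algebra_simps del: of_nat_Suc power_Suc)
  then have "of_nat (Suc a) * period \<alpha> \<beta> (?A ^ a * ?B ^ Suc b) + of_nat (Suc b) * period \<alpha> \<beta> (?A ^ Suc a * ?B ^ b) = 0"
    using period_pderiv[of \<alpha> \<beta> "?A ^ Suc a * ?B ^ Suc b"] by (simp add: period_add period_smult)
  then have "of_nat (Suc a) * period \<alpha> \<beta> (?A ^ a * ?B ^ Suc b) = - (of_nat (Suc b) * period \<alpha> \<beta> (?A ^ Suc a * ?B ^ b))"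
    by (simp only: eq_neg_iff_add_eq_0)
  also have "\<dots> = of_nat (Suc a) * ((-1) ^ Suc b * (fact a * fact (Suc b) / fact (a + Suc b + 1)) * (\<beta> - \<alpha>) ^ (a + Suc b + 1))"
    unfolding Suc.IH by (simp only: fact_Suc) (simp add: algebra_simps del: of_nat_Suc)
  finally show ?case by (simp only: mult_cancel_left of_nat_eq_0_iff) simp
qed

text \<open>The cofactor of \<open>(\<beta> - \<alpha>) ^ (a + b + 1)\<close> in the integral of (t
  - \<alpha>)^a (t - \<beta>)^b (t - \<gamma>)^c over [\<alpha>, \<beta>], cleared of denominators;
  \<open>y\<close> and \<open>w\<close> stand for \<alpha> - \<gamma> and \<beta> -
  \<gamma>.\<close>

definition pade_factor :: "nat \<Rightarrow> nat \<Rightarrow> nat \<Rightarrow> 'a::comm_ring_1 \<Rightarrow> 'a \<Rightarrow> 'a" where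
  "pade_factor a b c y w = (\<Sum>j\<le>c. of_nat ((a + j choose j) * (b + c - j choose (c - j))) * y ^ (c - j) * w ^ j)"

definition pade_const :: "nat \<Rightarrow> nat \<Rightarrow> nat \<Rightarrow> 'a::field_char_0" where
  "pade_const a b c = fact (a + b + c + 1) / (fact a * fact b * fact c)"

text \<open>Write (\<beta> - \<alpha>)(t - \<gamma>) as a combination of t - \<alpha> and t -
  \<beta> and expand its c-th power. Each term is a Beta integral, and \<open>pade_const\<close>
  turns the factorials into the two binomials of \<open>pade_factor\<close>.\<close>

lemma period_triple:
  fixes \<alpha> \<beta> \<gamma> :: "'a::field_char_0"
  assumes "\<alpha> \<noteq> \<beta>"
  shows "pade_const a b c * period \<alpha> \<beta> ([:-\<alpha>, 1:] ^ a * [:-\<beta>, 1:] ^ b * [:-\<gamma>, 1:] ^ c)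
    = (-1) ^ b * (\<beta> - \<alpha>) ^ (a + b + 1) * pade_factor a b c (\<alpha> - \<gamma>) (\<beta> - \<gamma>)"
proof -
  define A B C where "A = [:-\<alpha>, 1:]" and "B = [:-\<beta>, 1:]" and "C = [:-\<gamma>, 1:]"
  let ?x = "\<beta> - \<alpha>" and ?y = "\<alpha> - \<gamma>" and ?w = "\<beta> - \<gamma>"
  have lin: "Polynomial.smult ?x C = Polynomial.smult ?w A + Polynomial.smult (- ?y) B" by (simp add: A_def B_def C_def algebra_simps)
  have "Polynomial.smult (?x ^ c) (A ^ a * B ^ b * C ^ c) = A ^ a * B ^ b * (Polynomial.smult ?x C) ^ c"
    by (simp add: smult_power)
  also have "\<dots> = A ^ a * B ^ b * (\<Sum>j\<le>c. of_nat (c choose j) * (Polynomial.smult ?w A) ^ j * (Polynomial.smult (- ?y) B) ^ (c - j))"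
    unfolding lin binomial_ring ..
  also have "\<dots> = (\<Sum>j\<le>c. Polynomial.smult (of_nat (c choose j) * ?w ^ j * (- ?y) ^ (c - j)) (A ^ (a + j) * B ^ (b + c - j)))"
    unfolding sum_distrib_left
  proof (rule sum.cong[OF refl])
    fix j assume "j \<in> {..c}"
    then have "b + c - j = b + (c - j)" by simp
    then show "A ^ a * B ^ b * (of_nat (c choose j) * Polynomial.smult ?w A ^ j * Polynomial.smult (- ?y) B ^ (c - j))
       = Polynomial.smult (of_nat (c choose j) * ?w ^ j * (- ?y) ^ (c - j)) (A ^ (a + j) * B ^ (b + c - j))"
      by (simp add: smult_power power_add of_nat_poly mult_ac del: minus_diff_eq smult_minus_left)
  qed
  finally have "?x ^ c * period \<alpha> \<beta> (A ^ a * B ^ b * C ^ c)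
      = (\<Sum>j\<le>c. (of_nat (c choose j) * ?w ^ j * (- ?y) ^ (c - j)) * period \<alpha> \<beta> (A ^ (a + j) * B ^ (b + c - j)))"
    by (simp only: period_smult[symmetric] period_sum)
  then have "?x ^ c * (pade_const a b c * period \<alpha> \<beta> (A ^ a * B ^ b * C ^ c))
      = (\<Sum>j\<le>c. pade_const a b c * ((of_nat (c choose j) * ?w ^ j * (- ?y) ^ (c - j)) * period \<alpha> \<beta> (A ^ (a + j) * B ^ (b + c - j))))"
    by (simp add: sum_distrib_left mult_ac)
  also have "\<dots> = (\<Sum>j\<le>c. ?x ^ c * ((-1) ^ b * ?x ^ (a + b + 1) *
      (of_nat ((a + j choose j) * (b + c - j choose (c - j))) * ?y ^ (c - j) * ?w ^ j)))"
  proof (rule sum.cong[OF refl])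
    fix j assume "j \<in> {..c}"
    then have j: "j \<le> c" by simp
    define i where "i = c - j"
    have c: "c = j + i" using j by (simp add: i_def)
    have e: "b + c - j = b + i" "a + j + (b + i) + 1 = a + b + c + 1" "c - j = i" by (auto simp: c)
    have bin: "(of_nat (c choose j) :: 'a) = fact c / (fact j * fact i)"
      "(of_nat (a + j choose j) :: 'a) = fact (a + j) / (fact j * fact a)"
      "(of_nat (b + i choose i) :: 'a) = fact (b + i) / (fact i * fact b)"
      by (simp_all add: binomial_fact c)
    have fn: "(fact n :: 'a) \<noteq> 0" for n by simp
    have alg: "F / (fa * fb * fc) * (fc / (fj * fi)) * (faj * fbi / F) = faj / (fj * fa) * (fbi / (fi * fb))"
      if "F \<noteq> 0" "fc \<noteq> 0" for F fa fb fc fj fi faj fbi :: 'a using that by simp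
    have sg: "(- ?y) ^ i * (-1) ^ (b + i) = (-1) ^ b * ?y ^ i"
      by (simp add: power_minus[of ?y] power_add flip: power_mult_distrib)
    have "pade_const a b c * ((of_nat (c choose j) * ?w ^ j * (- ?y) ^ (c - j)) * period \<alpha> \<beta> (A ^ (a + j) * B ^ (b + c - j)))
      = (pade_const a b c * of_nat (c choose j) * (fact (a + j) * fact (b + i) / fact (a + b + c + 1)))
         * ?w ^ j * ((- ?y) ^ i * (-1) ^ (b + i)) * ?x ^ (a + b + c + 1)"
      unfolding A_def B_def period_beta e by (simp only: mult_ac)
    also have "pade_const a b c * of_nat (c choose j) * (fact (a + j) * fact (b + i) / fact (a + b + c + 1))
       = (of_nat ((a + j choose j) * (b + i choose i)) :: 'a)"
      unfolding pade_const_def of_nat_mult bin by (rule alg) (rule fn)+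
    finally show "pade_const a b c * ((of_nat (c choose j) * ?w ^ j * (- ?y) ^ (c - j)) * period \<alpha> \<beta> (A ^ (a + j) * B ^ (b + c - j)))
       = ?x ^ c * ((-1) ^ b * ?x ^ (a + b + 1) *
      (of_nat ((a + j choose j) * (b + c - j choose (c - j))) * ?y ^ (c - j) * ?w ^ j))"
      unfolding sg e by (simp add: power_add mult_ac)
  qed
  also have "\<dots> = ?x ^ c * ((-1) ^ b * ?x ^ (a + b + 1) * pade_factor a b c ?y ?w)"
    by (simp add: pade_factor_def sum_distrib_left)
  finally show ?thesis using assms by (simp add: A_def B_def C_def)
qed

text \<open>Up to a common constant, \<open>pade e x i\<close> is the integral of \<open>\<Prod>\<^sub>l (t - \<alpha>\<^sub>l) ^ e l\<close> between two of the
  three points \<open>\<alpha>\<^sub>l\<close>, whose differences are the coordinates of \<open>x\<close>.\<close>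

definition pade :: "(nat \<Rightarrow> nat) \<Rightarrow> (nat \<Rightarrow> 'a::comm_ring_1) \<Rightarrow> nat \<Rightarrow> 'a" where
  "pade e x i = (let j = (i + 1) mod 3; k = (i + 2) mod 3 in
     (-1) ^ e k * x i ^ (e j + e k + 1) * pade_factor (e j) (e k) (e i) (x k) (- x j))"

locale triple =
  fixes x :: "nat \<Rightarrow> 'a::field_char_0"
  assumes sum0: "x 0 + x 1 + x 2 = 0" and nz: "i < 3 \<Longrightarrow> x i \<noteq> 0"
begin

definition "\<alpha>0 = (0::'a)"
definition "\<alpha>1 = x 2"
definition "\<alpha>2 = - x 1"

lemma \<alpha>: "\<alpha>1 - \<alpha>0 = x 2" "\<alpha>2 - \<alpha>1 = x 0" "\<alpha>0 - \<alpha>2 = x 1"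
  "\<alpha>0 - \<alpha>1 = - x 2" "\<alpha>1 - \<alpha>2 = - x 0" "\<alpha>2 - \<alpha>0 = - x 1"
  "\<alpha>0 \<noteq> \<alpha>1" "\<alpha>1 \<noteq> \<alpha>2" "\<alpha>2 \<noteq> \<alpha>0"
proof -
  have "x 0 = - x 1 - x 2" using sum0 by (simp add: algebra_simps eq_neg_iff_add_eq_0)
  then show "\<alpha>1 - \<alpha>0 = x 2" "\<alpha>2 - \<alpha>1 = x 0" "\<alpha>0 - \<alpha>2 = x 1"
    "\<alpha>0 - \<alpha>1 = - x 2" "\<alpha>1 - \<alpha>2 = - x 0" "\<alpha>2 - \<alpha>0 = - x 1"
    "\<alpha>0 \<noteq> \<alpha>1" "\<alpha>1 \<noteq> \<alpha>2" "\<alpha>2 \<noteq> \<alpha>0"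
    using nz[of 0] nz[of 1] nz[of 2] by (auto simp: \<alpha>0_def \<alpha>1_def \<alpha>2_def)
qed

definition "A0 = [:-\<alpha>0, 1:]"
definition "A1 = [:-\<alpha>1, 1:]"
definition "A2 = [:-\<alpha>2, 1:]"

definition "pw e = A0 ^ e 0 * A1 ^ e 1 * A2 ^ e (2::nat)"

lemma pade_eq:
  "pade e x 2 = pade_const (e 0) (e 1) (e 2) * period \<alpha>0 \<alpha>1 (pw e)"
  "pade e x 0 = pade_const (e 0) (e 1) (e 2) * period \<alpha>1 \<alpha>2 (pw e)"
  "pade e x 1 = pade_const (e 0) (e 1) (e 2) * period \<alpha>2 \<alpha>0 (pw e)"
proof -
  have C: "pade_const (e 1) (e 2) (e 0) = (pade_const (e 0) (e 1) (e 2) :: 'a)" "pade_const (e 2) (e 0) (e 1) = (pade_const (e 0) (e 1) (e 2) :: 'a)"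
    by (simp_all add: pade_const_def ac_simps)
  show "pade e x 2 = pade_const (e 0) (e 1) (e 2) * period \<alpha>0 \<alpha>1 (pw e)"
    using period_triple[OF \<alpha>(7), of "e 0" "e 1" "e 2" \<alpha>2]
    by (simp add: pade_def Let_def pw_def A0_def A1_def A2_def \<alpha> numeral_2_eq_2)
  show "pade e x 0 = pade_const (e 0) (e 1) (e 2) * period \<alpha>1 \<alpha>2 (pw e)"
    using period_triple[OF \<alpha>(8), of "e 1" "e 2" "e 0" \<alpha>0]
    by (simp add: pade_def Let_def pw_def A0_def A1_def A2_def \<alpha> mult_ac C[unfolded numeral_2_eq_2 One_nat_def] numeral_2_eq_2)
  show "pade e x 1 = pade_const (e 0) (e 1) (e 2) * period \<alpha>2 \<alpha>0 (pw e)"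
    using period_triple[OF \<alpha>(9), of "e 2" "e 0" "e 1" \<alpha>1]
    by (simp add: pade_def Let_def pw_def A0_def A1_def A2_def \<alpha> mult_ac C[unfolded numeral_2_eq_2 One_nat_def] numeral_2_eq_2)
qed

text \<open>The three integrals run once around the triangle of the three points.\<close>

lemma pade_sum: "pade e x 0 + pade e x 1 + pade e x 2 = 0"
  unfolding pade_eq by (simp add: period_def algebra_simps)

definition "\<Omega> = A0 * A1 * A2"

lemma poly_A: "poly A0 \<alpha>0 = 0" "poly A1 \<alpha>1 = 0" "poly A2 \<alpha>2 = 0"
  "poly A0 \<alpha>1 = x 2" "poly A0 \<alpha>2 = - x 1" "poly A1 \<alpha>0 = - x 2" "poly A1 \<alpha>2 = x 0"
  "poly A2 \<alpha>0 = x 1" "poly A2 \<alpha>1 = - x 0"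
  using \<alpha> by (simp_all add: A0_def A1_def A2_def)

lemma pderiv_Pi: "pderiv \<Omega> = A1 * A2 + A0 * A2 + A0 * A1"
  by (simp add: \<Omega>_def A0_def A1_def A2_def pderiv_mult pderiv_pCons algebra_simps)

lemma Pi_dvd:
  assumes "poly q \<alpha>0 = 0" "poly q \<alpha>1 = 0" "poly q \<alpha>2 = 0"
  shows "\<exists>r. q = \<Omega> * r"
proof -
  obtain q1 where q1: "q = A0 * q1" using assms(1) by (auto simp: poly_eq_0_iff_dvd A0_def)
  then have "poly q1 \<alpha>1 = 0" using assms(2) poly_A(4) nz[of 2] by simp
  then obtain q2 where q2: "q1 = A1 * q2" by (auto simp: poly_eq_0_iff_dvd A1_def)
  then have "poly q2 \<alpha>2 = 0" using assms(3) q1 poly_A(5,7) nz[of 0] nz[of 1] by simp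
  then obtain r where "q2 = A2 * r" by (auto simp: poly_eq_0_iff_dvd A2_def)
  then show ?thesis using q1 q2 by (auto simp: \<Omega>_def mult_ac)
qed

lemma interpolate:
  obtains v where "v = Polynomial.smult a0 (A1 * A2) + Polynomial.smult a1 (A0 * A2) + Polynomial.smult a2 (A0 * A1)"
    "poly v \<alpha>0 = - a0 * x 1 * x 2" "poly v \<alpha>1 = - a1 * x 0 * x 2" "poly v \<alpha>2 = - a2 * x 0 * x 1"
  by (rule that[OF refl]) (simp_all add: poly_A mult_ac)

text \<open>Lagrange interpolation at the three roots. The denominators are, up to sign, the values
  of the derivative of \<open>\<Omega>\<close>, for example \<open>- x 1 * x 2\<close> at
  \<open>\<alpha>0\<close>.\<close>

lemma decompose:
  obtains a0 a1 a2 r where "q = Polynomial.smult a0 (A1 * A2) + Polynomial.smult a1 (A0 * A2) + Polynomial.smult a2 (A0 * A1) + \<Omega> * r"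
proof -
  have n: "x 0 \<noteq> 0" "x 1 \<noteq> 0" "x 2 \<noteq> 0" using nz by auto
  define a0 a1 a2 where "a0 = - poly q \<alpha>0 / (x 1 * x 2)" and "a1 = - poly q \<alpha>1 / (x 0 * x 2)"
    and "a2 = - poly q \<alpha>2 / (x 0 * x 1)"
  obtain v where v1: "v = Polynomial.smult a0 (A1 * A2) + Polynomial.smult a1 (A0 * A2) + Polynomial.smult a2 (A0 * A1)"
    and "poly v \<alpha>0 = - a0 * x 1 * x 2" "poly v \<alpha>1 = - a1 * x 0 * x 2" "poly v \<alpha>2 = - a2 * x 0 * x 1"
    by (rule interpolate)
  then have v: "poly v \<alpha>0 = poly q \<alpha>0" "poly v \<alpha>1 = poly q \<alpha>1" "poly v \<alpha>2 = poly q \<alpha>2"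
    using n by (simp_all add: a0_def a1_def a2_def)
  obtain r where "q - v = \<Omega> * r" using Pi_dvd[of "q - v"] v by auto
  then have "q = v + \<Omega> * r" by (simp add: algebra_simps)
  then show ?thesis unfolding v1 by (rule that)
qed

lemma poly_power_Pi: "k > 0 \<Longrightarrow> poly (\<Omega> ^ k * q) \<alpha>0 = 0" "k > 0 \<Longrightarrow> poly (\<Omega> ^ k * q) \<alpha>1 = 0" 
  "k > 0 \<Longrightarrow> poly (\<Omega> ^ k * q) \<alpha>2 = 0"
  by (simp_all add: \<Omega>_def poly_A)

lemma degree_Pi: "degree \<Omega> = 3" "lead_coeff \<Omega> = 1"
  by (simp_all add: \<Omega>_def A0_def A1_def A2_def)

text \<open>If both forms were proportional to \<open>y\<close>, a non-zero linear combination \<open>L\<close> of the two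
  periods would vanish on all multiples of \<open>\<Omega> ^ (N - 1)\<close>. Coprimality of \<open>\<Omega>\<close> and its derivative
  then lowers the exponent step by step until \<open>L\<close> vanishes identically.\<close>

lemma pade_nonvanishing:
  assumes N: "N > 0" and y: "y 0 + y 1 + y 2 = (0::'a)" "y 0 \<noteq> 0"
  shows "pade (\<lambda>i. if i = 2 then N - 1 else N) x 0 * y 1 - pade (\<lambda>i. if i = 2 then N - 1 else N) x 1 * y 0 \<noteq> 0
    \<or> pade (\<lambda>i. if i = 0 then N - 1 else N) x 0 * y 1 - pade (\<lambda>i. if i = 0 then N - 1 else N) x 1 * y 0 \<noteq> 0"
proof (rule ccontr)
  assume "\<not> ?thesis"
  then have van: "pade (\<lambda>i. if i = 2 then N - 1 else N) x 0 * y 1 - pade (\<lambda>i. if i = 2 then N - 1 else N) x 1 * y 0 = 0"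
    "pade (\<lambda>i. if i = 0 then N - 1 else N) x 0 * y 1 - pade (\<lambda>i. if i = 0 then N - 1 else N) x 1 * y 0 = 0" by auto
  define L where "L f = y 1 * period \<alpha>1 \<alpha>2 f - y 0 * period \<alpha>2 \<alpha>0 f" for f
  have L_add: "L (f + g) = L f + L g" for f g by (simp add: L_def period_add algebra_simps)
  have L_smult: "L (Polynomial.smult c f) = c * L f" for c f by (simp add: L_def period_smult algebra_simps)
  have L_pderiv: "L (pderiv G) = 0" if "poly G \<alpha>0 = 0" "poly G \<alpha>1 = 0" "poly G \<alpha>2 = 0" for G
    using that by (simp add: L_def period_pderiv)
  have Cnz: "(pade_const a b c :: 'a) \<noteq> 0" for a b c by (simp add: pade_const_def del: fact_Suc)
  have L_pw: "L (pw e) = 0" if "pade e x 0 * y 1 - pade e x 1 * y 0 = 0" for e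
  proof -
    have "pade_const (e 0) (e 1) (e 2) * L (pw e) = pade e x 0 * y 1 - pade e x 1 * y 0"
      unfolding pade_eq L_def by (simp add: algebra_simps)
    then show ?thesis using that Cnz by simp
  qed
  have pwr: "A0 ^ N = A0 ^ (N - 1) * A0" "A1 ^ N = A1 ^ (N - 1) * A1" "A2 ^ N = A2 ^ (N - 1) * A2" "\<Omega> ^ N = \<Omega> ^ (N - 1) * \<Omega>"
    using N by (simp_all flip: power_Suc2)
  have L01: "L (\<Omega> ^ (N - 1) * (A0 * A1)) = 0"
    using L_pw[OF van(1)] by (simp add: pw_def pwr \<Omega>_def power_mult_distrib mult_ac)
  have L12: "L (\<Omega> ^ (N - 1) * (A1 * A2)) = 0"
    using L_pw[OF van(2)] by (simp add: pw_def pwr \<Omega>_def power_mult_distrib mult_ac)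
  have pd: "pderiv (\<Omega> ^ N * r) = \<Omega> ^ (N - 1) * (\<Omega> * pderiv r + Polynomial.smult (of_nat N) (pderiv \<Omega> * r))" for r
  proof -
    obtain n where "N = Suc n" using N by (cases N) auto
    then show ?thesis
      by (simp only: pderiv_mult pderiv_power_Suc diff_Suc_1) (simp add: algebra_simps del: of_nat_Suc)
  qed
  have L_exact: "L (\<Omega> ^ (N - 1) * (\<Omega> * pderiv r + Polynomial.smult (of_nat N) (pderiv \<Omega> * r))) = 0" for r
    using L_pderiv[of "\<Omega> ^ N * r"] poly_power_Pi[OF N] by (simp only: pd)
  \<comment> \<open>The two Pade forms give two of the three products of linear factors; the
    derivative of \<open>\<Omega> ^ N\<close> gives the sum of all three, hence the missing
    one.\<close>
  have "L (\<Omega> ^ (N - 1) * pderiv \<Omega>) = 0"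
    using L_exact[of 1] N by (simp add: L_smult)
  then have L02: "L (\<Omega> ^ (N - 1) * (A0 * A2)) = 0"
    unfolding pderiv_Pi using L01 L12 by (simp add: distrib_left L_add)
  have L_top: "L (\<Omega> ^ (N - 1) * q) = 0" for q
  proof (induction "degree q" arbitrary: q rule: less_induct)
    case less
    show ?case
    proof (cases "degree q \<le> 2")
      case True
      obtain a0 a1 a2 r where d: "q = Polynomial.smult a0 (A1 * A2) + Polynomial.smult a1 (A0 * A2) + Polynomial.smult a2 (A0 * A1) + \<Omega> * r"
        by (rule decompose)
      have "r = 0"
      proof (rule ccontr)
        assume "r \<noteq> 0"
        have "degree (\<Omega> * r) = 3 + degree r" using \<open>r \<noteq> 0\<close> degree_Pi by (subst degree_mult_eq) auto
        moreover have "\<Omega> * r = q - (Polynomial.smult a0 (A1 * A2) + Polynomial.smult a1 (A0 * A2) + Polynomial.smult a2 (A0 * A1))"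
          using d by (simp add: algebra_simps)
        moreover have "degree (Polynomial.smult a (B * B')) \<le> 2" if "degree B \<le> 1" "degree B' \<le> 1" for a and B B' :: "'a poly"
          using degree_mult_le[of B B'] that by (intro order.trans[OF degree_smult_le]) linarith
        then have "degree (q - (Polynomial.smult a0 (A1 * A2) + Polynomial.smult a1 (A0 * A2) + Polynomial.smult a2 (A0 * A1))) \<le> 2"
          using True by (intro degree_diff_le degree_add_le) (auto simp: A0_def A1_def A2_def)
        ultimately show False by simp
      qed
      have "\<Omega> ^ (N - 1) * q = Polynomial.smult a0 (\<Omega> ^ (N - 1) * (A1 * A2)) + Polynomial.smult a1 (\<Omega> ^ (N - 1) * (A0 * A2)) + Polynomial.smult a2 (\<Omega> ^ (N - 1) * (A0 * A1))"
        using d \<open>r = 0\<close> by (simp add: distrib_left)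
      then show ?thesis using L01 L02 L12 by (simp add: L_add L_smult)
    next
      case False
      define n where "n = degree q"
      define d where "d = n - 2"
      have n: "n = d + 2" "d > 0" using False by (auto simp: n_def d_def)
      \<comment> \<open>The two summands of \<open>s\<close> have coefficients \<open>d * c\<close>
        and \<open>3 * N * c\<close> in degree \<open>n\<close>, so this \<open>c\<close> makes
        \<open>s\<close> cancel the leading term of \<open>q\<close>. As \<open>L\<close> vanishes
        on the exact term, the degree drops.\<close>
      define c where "c = lead_coeff q / (of_nat d + of_nat N * 3)"
      define r where "r = monom c d"
      define s where "s = \<Omega> * pderiv r + Polynomial.smult (of_nat N) (pderiv \<Omega> * r)"
      have den: "(of_nat d + of_nat N * 3 :: 'a) \<noteq> 0"
      proof -
        have "(of_nat (d + N * 3) :: 'a) \<noteq> 0" using n by (simp only: of_nat_eq_0_iff)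
        then show ?thesis by simp
      qed
      have dp: "degree (pderiv r) \<le> d - 1"
        using degree_pderiv[of r] degree_monom_le[of c d] by (simp add: r_def)
      have dPi': "degree (pderiv \<Omega>) \<le> 2" using degree_pderiv[of \<Omega>] degree_Pi by simp
      have dr: "degree r \<le> d" by (simp add: r_def degree_monom_le)
      have deg1: "degree (\<Omega> * pderiv r) \<le> n"
        using degree_mult_le[of \<Omega> "pderiv r"] degree_Pi dp n by simp
      have deg2: "degree (pderiv \<Omega> * r) \<le> n"
        using degree_mult_le[of "pderiv \<Omega>" r] dPi' dr n by simp
      have "degree s \<le> n" unfolding s_def using deg1 deg2
        by (intro degree_add_le order.trans[OF degree_smult_le]) auto
      have c1: "coeff (\<Omega> * pderiv r) n = of_nat d * c"
      proof -
        have "coeff (\<Omega> * pderiv r) (3 + (d - 1)) = coeff \<Omega> 3 * coeff (pderiv r) (d - 1)"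
          by (rule coeff_mult_degree_le) (use dp degree_Pi in auto)
        moreover have "coeff (pderiv r) (d - 1) = of_nat d * c"
          using n by (simp add: coeff_pderiv r_def)
        moreover have "3 + (d - 1) = n" using n by simp
        ultimately show ?thesis using degree_Pi by simp
      qed
      have c2: "coeff (pderiv \<Omega> * r) n = 3 * c"
      proof -
        have "coeff (pderiv \<Omega> * r) (2 + d) = coeff (pderiv \<Omega>) 2 * coeff r d"
          by (rule coeff_mult_degree_le) (use dPi' dr in auto)
        moreover have "coeff (pderiv \<Omega>) 2 = 3" using degree_Pi by (simp add: coeff_pderiv numeral_3_eq_3 numeral_2_eq_2)
        ultimately show ?thesis using n by (simp add: r_def add.commute)
      qed
      have "coeff s n = (of_nat d + of_nat N * 3) * c"
        by (simp only: s_def coeff_add coeff_smult c1 c2) (simp add: algebra_simps)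
      then have "coeff s n = coeff q n" using den by (simp add: c_def n_def)
      have dlt: "degree (q - s) < n"
      proof -
        have "degree (q - s) \<le> n" using \<open>degree s \<le> n\<close> by (intro degree_diff_le) (auto simp: n_def)
        moreover have "coeff (q - s) n = 0" using \<open>coeff s n = coeff q n\<close> by simp
        ultimately show ?thesis using n by (metis degree_0 leading_coeff_0_iff le_neq_implies_less add_gr_0)
      qed
      then have "L (\<Omega> ^ (N - 1) * (q - s)) = 0" using less[of "q - s"] by (simp add: n_def)
      moreover have "\<Omega> ^ (N - 1) * q = \<Omega> ^ (N - 1) * (q - s) + \<Omega> ^ (N - 1) * s"
        by (simp flip: distrib_left)
      ultimately show ?thesis using L_exact[of r] by (simp add: L_add s_def)
    qed
  qed
  have nn: "x 0 \<noteq> 0" "x 1 \<noteq> 0" "x 2 \<noteq> 0" using nz by auto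
  have L_step: "L (\<Omega> ^ k * q) = 0" if IH: "\<And>q. L (\<Omega> ^ Suc k * q) = 0" for k q
  proof -
    \<comment> \<open>Chosen so that \<open>pderiv \<Omega> * v\<close> agrees with \<open>q\<close>
      at the three roots. The rest is divisible by \<open>\<Omega>\<close>, and integrating by parts
      raises the exponent in the first part as well.\<close>
    define a0 a1 a2 where "a0 = poly q \<alpha>0 / (x 1 * x 2) ^ 2" and "a1 = poly q \<alpha>1 / (x 0 * x 2) ^ 2"
      and "a2 = poly q \<alpha>2 / (x 0 * x 1) ^ 2"
    obtain v where "v = Polynomial.smult a0 (A1 * A2) + Polynomial.smult a1 (A0 * A2) + Polynomial.smult a2 (A0 * A1)"
      and "poly v \<alpha>0 = - a0 * x 1 * x 2" "poly v \<alpha>1 = - a1 * x 0 * x 2" "poly v \<alpha>2 = - a2 * x 0 * x 1"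
      by (rule interpolate)
    then have v: "poly v \<alpha>0 = - poly q \<alpha>0 / (x 1 * x 2)" "poly v \<alpha>1 = - poly q \<alpha>1 / (x 0 * x 2)"
      "poly v \<alpha>2 = - poly q \<alpha>2 / (x 0 * x 1)"
      using nn by (simp_all add: a0_def a1_def a2_def power2_eq_square)
    have "poly (q - pderiv \<Omega> * v) \<alpha>0 = 0" "poly (q - pderiv \<Omega> * v) \<alpha>1 = 0" "poly (q - pderiv \<Omega> * v) \<alpha>2 = 0"
      using nn by (simp_all add: pderiv_Pi poly_A v field_simps)
    then obtain r where r: "q - pderiv \<Omega> * v = \<Omega> * r" using Pi_dvd by blast
    have pdk: "pderiv (\<Omega> ^ Suc k * v) = Polynomial.smult (of_nat (Suc k)) (\<Omega> ^ k * (pderiv \<Omega> * v)) + \<Omega> ^ Suc k * pderiv v"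
      by (simp add: pderiv_mult pderiv_power_Suc algebra_simps del: of_nat_Suc power_Suc)
    have "L (pderiv (\<Omega> ^ Suc k * v)) = 0"
      using poly_power_Pi[of "Suc k" v] by (intro L_pderiv) auto
    then have "of_nat (Suc k) * L (\<Omega> ^ k * (pderiv \<Omega> * v)) = 0"
      unfolding pdk L_add L_smult IH by simp
    then have a: "L (\<Omega> ^ k * (pderiv \<Omega> * v)) = 0" by (simp only: mult_eq_0_iff of_nat_eq_0_iff) simp
    have "q = pderiv \<Omega> * v + \<Omega> * r" using r by (simp add: algebra_simps)
    then have "\<Omega> ^ k * q = \<Omega> ^ k * (pderiv \<Omega> * v) + \<Omega> ^ Suc k * r" by (simp add: algebra_simps)
    then show ?thesis using a IH by (simp add: L_add)
  qed
  have "L (\<Omega> ^ (N - 1 - k) * q) = 0" if "k \<le> N - 1" for k q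
    using that
  proof (induction k arbitrary: q)
    case 0 then show ?case using L_top by simp
  next
    case (Suc k)
    then have "Suc (N - 1 - Suc k) = N - 1 - k" by simp
    then show ?case using L_step[of "N - 1 - Suc k" q] Suc by simp
  qed
  from this[of "N - 1"] have L0: "L q = 0" for q by simp
  \<comment> \<open>The antiderivative \<open>A1 * A2\<close> vanishes at \<open>\<alpha>1\<close>
    and \<open>\<alpha>2\<close> but not at \<open>\<alpha>0\<close>, so \<open>L\<close> takes the
    nonzero value \<open>y 0 * x 1 * x 2\<close>.\<close>
  have "L (pderiv (A1 * A2)) = - y 0 * (x 1 * - x 2)"
    by (simp add: L_def period_pderiv poly_A)
  then show False using L0 nn y(2) by simp
qed

end

text \<open>Compare coefficients of X^c in (1 - X)^-(a+1) (1 - X)^-(b+1). The left side is the sum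
  of the coefficients of \<open>pade_factor\<close>, all nonnegative.\<close>

lemma sum_binomial_product: "(\<Sum>j\<le>c. (a + j choose j) * (b + c - j choose (c - j))) = (a + b + c + 1 choose c)"
proof (induction a arbitrary: c)
  case 0
  have "(\<Sum>j\<le>c. (b + c - j choose (c - j))) = (\<Sum>j\<le>c. (b + j choose j))"
    by (rule sum.reindex_bij_witness[of _ "\<lambda>j. c - j" "\<lambda>j. c - j"]) auto
  then show ?case using sum_choose_lower[of b c] by simp
next
  case (Suc a)
  note IH = Suc
  show ?case
  proof (induction c)
    case 0 then show ?case by simp
  next
    case (Suc c)
    have "(\<Sum>j\<le>Suc c. (Suc a + j choose j) * (b + Suc c - j choose (Suc c - j)))
      = (\<Sum>j\<le>Suc c. (a + j choose j) * (b + Suc c - j choose (Suc c - j)))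
        + (\<Sum>j\<le>Suc c. (if j = 0 then 0 else (a + j choose (j - 1))) * (b + Suc c - j choose (Suc c - j)))"
      unfolding sum.distrib[symmetric]
    proof (rule sum.cong[OF refl])
      fix j show "(Suc a + j choose j) * (b + Suc c - j choose (Suc c - j)) =
         (a + j choose j) * (b + Suc c - j choose (Suc c - j)) +
         (if j = 0 then 0 else (a + j choose (j - 1))) * (b + Suc c - j choose (Suc c - j))"
        by (cases j) (simp_all add: algebra_simps)
    qed
    also have "(\<Sum>j\<le>Suc c. (if j = 0 then 0 else (a + j choose (j - 1))) * (b + Suc c - j choose (Suc c - j)))
      = (\<Sum>j\<le>c. (Suc a + j choose j) * (b + c - j choose (c - j)))"
      by (subst sum.atMost_Suc_shift) simp
    also have "(\<Sum>j\<le>Suc c. (a + j choose j) * (b + Suc c - j choose (Suc c - j))) = (a + b + Suc c + 1 choose Suc c)"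
      by (rule IH)
    finally show ?case using Suc.IH by simp
  qed
qed

section \<open>Local estimates\<close>

definition zero_sum_triple :: "(nat \<Rightarrow> 'a::field_char_0) \<Rightarrow> bool" where
  "zero_sum_triple x \<longleftrightarrow> x 0 + x 1 + x 2 = 0 \<and> x 0 \<noteq> 0 \<and> x 1 \<noteq> 0 \<and> x 2 \<noteq> 0"

definition cross :: "(nat \<Rightarrow> 'a::comm_ring_1) \<Rightarrow> (nat \<Rightarrow> 'a) \<Rightarrow> 'a" where
  "cross x y = x 0 * y 1 - x 1 * y 0"

lemma less3: "i < 3 \<Longrightarrow> i = 0 \<or> i = 1 \<or> i = (2::nat)" by auto

text \<open>Allows the determinant to be expanded by the smallest coordinate, wherever it
  is.\<close>

lemma cross_rot:
  assumes "x 0 + x 1 + x 2 = (0::'a::comm_ring_1)" "y 0 + y 1 + y 2 = 0" "i < 3"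
  shows "cross x y = x i * y ((i + 1) mod 3) - x ((i + 1) mod 3) * y i"
    "cross x y = x ((i + 2) mod 3) * y i - x i * y ((i + 2) mod 3)"
proof -
  have *: "x 2 = - x 0 - x 1" "y 2 = - y 0 - y 1" using assms(1,2) by (simp_all add: algebra_simps eq_neg_iff_add_eq_0)
  show "cross x y = x i * y ((i + 1) mod 3) - x ((i + 1) mod 3) * y i"
    "cross x y = x ((i + 2) mod 3) * y i - x i * y ((i + 2) mod 3)"
    using less3[OF assms(3)] by (auto simp: cross_def * algebra_simps numeral_2_eq_2[symmetric])
qed

definition min_abs :: "('a \<Rightarrow> real) \<Rightarrow> (nat \<Rightarrow> 'a) \<Rightarrow> real" where
  "min_abs f x = min (f (x 0)) (min (f (x 1)) (f (x 2)))"

definition argmin_abs :: "('a \<Rightarrow> real) \<Rightarrow> (nat \<Rightarrow> 'a) \<Rightarrow> nat" where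
  "argmin_abs f x = (if f (x 0) \<le> f (x 1) \<and> f (x 0) \<le> f (x 2) then 0 else if f (x 1) \<le> f (x 2) then 1 else 2)"

definition ln_min :: "('a \<Rightarrow> real) \<Rightarrow> (nat \<Rightarrow> 'a) \<Rightarrow> real" where
  "ln_min f x = ln (min_abs f x)"

text \<open>The logarithm of the geometric mean of the two largest values; these agree when \<open>f\<close> is
  ultrametric and the coordinates sum to zero.\<close>

definition ln_mean :: "('a \<Rightarrow> real) \<Rightarrow> (nat \<Rightarrow> 'a) \<Rightarrow> real" where
  "ln_mean f x = (ln (f (x 0)) + ln (f (x 1)) + ln (f (x 2)) - ln_min f x) / 2"

lemma argmin_abs_less: "argmin_abs f x < 3" by (simp add: argmin_abs_def)

lemma argmin_abs_facts:
  assumes "i = argmin_abs f x" "j = (i + 1) mod 3" "k = (i + 2) mod 3"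
  shows "f (x i) = min_abs f x" "min_abs f x \<le> f (x j)" "min_abs f x \<le> f (x k)" "ln_mean f x = (ln (f (x j)) + ln (f (x k))) / 2"
proof -
  consider "i = 0" "f (x 0) \<le> f (x 1)" "f (x 0) \<le> f (x 2)" | "i = 1" "f (x 1) \<le> f (x 0)" "f (x 1) \<le> f (x 2)"
    | "i = 2" "f (x 2) \<le> f (x 0)" "f (x 2) \<le> f (x 1)"
    using assms(1) unfolding argmin_abs_def by (auto split: if_splits)
  then have "f (x i) = min_abs f x \<and> min_abs f x \<le> f (x j) \<and> min_abs f x \<le> f (x k) \<and> ln_mean f x = (ln (f (x j)) + ln (f (x k))) / 2"
    by cases (auto simp: assms(2,3) min_abs_def ln_mean_def ln_min_def min_def numeral_2_eq_2[symmetric])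
  then show "f (x i) = min_abs f x" "min_abs f x \<le> f (x j)" "min_abs f x \<le> f (x k)" "ln_mean f x = (ln (f (x j)) + ln (f (x k))) / 2"
    by auto
qed

lemma abs_val_sum:
  assumes f: "absolute_value f"
  shows "f (sum g I) \<le> (\<Sum>i\<in>I. f (g i))"
proof (induction I rule: infinite_finite_induct)
  case (insert i I)
  then show ?case using abs_val_simps(4)[OF f, of "g i" "sum g I"] by simp
qed (use abs_val_simps(2)[OF f, of 0] in auto)

lemma abs_val_of_nat:
  assumes f: "absolute_value f"
  shows "f (of_nat n) \<le> real n"
proof (induction n)
  case (Suc n)
  then show ?case using abs_val_simps(4)[OF f, of 1 "of_nat n"] abs_val_simps(5)[OF f] by simp
qed (use abs_val_simps(2)[OF f, of 0] in auto)

lemma abs_val_power: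
  assumes f: "absolute_value f"
  shows "f (x ^ n) = f x ^ n"
  by (induction n) (auto simp: abs_val_simps[OF f])

lemma abs_val_minus_diff:
  assumes f: "absolute_value f"
  shows "f (x - y) \<le> f x + f y"
  using abs_val_simps(4)[OF f, of x "-y"] abs_val_simps(6)[OF f] by simp

definition ultra :: "('a::field \<Rightarrow> real) \<Rightarrow> bool" where
  "ultra f \<longleftrightarrow> absolute_value f \<and> (\<forall>x y. f (x + y) \<le> max (f x) (f y))"

lemma ultraD: "ultra f \<Longrightarrow> absolute_value f" "ultra f \<Longrightarrow> f (x + y) \<le> max (f x) (f y)"
  by (auto simp: ultra_def)

lemma ultra_diff:
  assumes "ultra f"
  shows "f (x - y) \<le> max (f x) (f y)"
  using ultraD(2)[OF assms, of x "-y"] abs_val_simps(6)[OF ultraD(1)[OF assms], of y] by simp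

lemma ultra_sum:
  assumes f: "ultra f" and "B \<ge> 0" "\<And>i. i \<in> I \<Longrightarrow> f (g i) \<le> B"
  shows "f (sum g I) \<le> B"
  using assms(3)
proof (induction I rule: infinite_finite_induct)
  case (insert i I)
  have "f (sum g (insert i I)) \<le> max (f (g i)) (f (sum g I))"
    using insert ultraD(2)[OF f, of "g i" "sum g I"] by simp
  then show ?case using insert by (auto intro: order.trans)
qed (use abs_val_simps(2)[OF ultraD(1)[OF f], of 0] assms(2) in auto)

lemma ultra_of_nat:
  assumes f: "ultra f"
  shows "f (of_nat n) \<le> 1"
proof -
  have "f (\<Sum>i<n. 1) \<le> 1" by (rule ultra_sum[OF f]) (use abs_val_simps(5)[OF ultraD(1)[OF f]] in auto)
  then show ?thesis by simp
qed

section \<open>Size of the Pade forms\<close>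

lemma pade_factor_term_bound:
  assumes f: "absolute_value f" and X: "f y \<le> X" "f w \<le> X" and j: "j \<le> c"
  shows "f (of_nat n * y ^ (c - j) * w ^ j) \<le> f (of_nat n) * X ^ c"
proof -
  have "X \<ge> 0" using X abs_val_simps(1)[OF f, of y] by simp
  have "f y ^ (c - j) * f w ^ j \<le> X ^ (c - j) * X ^ j"
    using X abs_val_simps(1)[OF f] \<open>X \<ge> 0\<close> by (intro mult_mono power_mono) auto
  also have "\<dots> = X ^ c" using j by (simp flip: power_add)
  finally have "f (of_nat n) * (f y ^ (c - j) * f w ^ j) \<le> f (of_nat n) * X ^ c"
    using abs_val_simps(1)[OF f] by (intro mult_left_mono) auto
  then show ?thesis by (simp add: abs_val_simps(3)[OF f] abs_val_power[OF f] mult.assoc)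
qed

lemma pade_factor_bound:
  assumes f: "absolute_value f" and X: "f y \<le> X" "f w \<le> X"
  shows "f (pade_factor a b c y w) \<le> real (a + b + c + 1 choose c) * X ^ c"
proof -
  have "X \<ge> 0" using X abs_val_simps(1)[OF f, of y] by simp
  have "f (pade_factor a b c y w) \<le> (\<Sum>j\<le>c. real ((a + j choose j) * (b + c - j choose (c - j))) * X ^ c)"
    unfolding pade_factor_def
  proof (rule order.trans[OF abs_val_sum[OF f]], rule sum_mono)
    fix j assume j: "j \<in> {..c}"
    let ?n = "(a + j choose j) * (b + c - j choose (c - j))"
    have "f (of_nat ?n * y ^ (c - j) * w ^ j) \<le> f (of_nat ?n) * X ^ c"
      using j by (intro pade_factor_term_bound[OF f X]) simp
    also have "\<dots> \<le> real ?n * X ^ c" using \<open>X \<ge> 0\<close> by (intro mult_right_mono abs_val_of_nat[OF f]) auto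
    finally show "f (of_nat ?n * y ^ (c - j) * w ^ j) \<le> real ?n * X ^ c" .
  qed
  also have "\<dots> = real (a + b + c + 1 choose c) * X ^ c"
    unfolding sum_binomial_product[symmetric] of_nat_sum sum_distrib_right ..
  finally show ?thesis .
qed

lemma pade_factor_bound_ultra:
  assumes f: "ultra f" and X: "f y \<le> X" "f w \<le> X"
  shows "f (pade_factor a b c y w) \<le> X ^ c"
proof -
  have "X \<ge> 0" using X abs_val_simps(1)[OF ultraD(1)[OF f], of y] by simp
  then show ?thesis unfolding pade_factor_def
  proof (intro ultra_sum[OF f])
    fix j assume j: "j \<in> {..c}"
    let ?n = "(a + j choose j) * (b + c - j choose (c - j))"
    have "f (of_nat ?n * y ^ (c - j) * w ^ j) \<le> f (of_nat ?n) * X ^ c"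
      using j by (intro pade_factor_term_bound[OF ultraD(1)[OF f] X]) simp
    also have "\<dots> \<le> 1 * X ^ c" using \<open>X \<ge> 0\<close> by (intro mult_right_mono ultra_of_nat[OF f]) auto
    finally show "f (of_nat ?n * y ^ (c - j) * w ^ j) \<le> X ^ c" by simp
  qed simp
qed

text \<open>Two exponents are N and one is N - 1, in any position. The form then has degree 3
  N.\<close>

definition pade_exponents :: "nat \<Rightarrow> (nat \<Rightarrow> nat) \<Rightarrow> bool" where
  "pade_exponents N e \<longleftrightarrow> e 0 + e 1 + e 2 + 1 = 3 * N \<and> (\<forall>i<3. e i \<le> N \<and> N \<le> e i + 1)"

text \<open>The explicit power of \<open>x i\<close> has exponent \<open>3 * N - e i\<close>, at
  least \<open>2 * N\<close>. The surplus \<open>N - e i\<close> and the cofactor of degree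
  \<open>e i\<close> are estimated together by \<open>X ^ N\<close>.\<close>

lemma pade_bound_aux:
  assumes f: "absolute_value f" and e: "pade_exponents N e" and i: "i < 3" and X: "\<And>l. l < 3 \<Longrightarrow> f (x l) \<le> X"
    and V: "\<And>a b c y w. f y \<le> X \<Longrightarrow> f w \<le> X \<Longrightarrow> a + b + c + 1 = 3 * N \<Longrightarrow> c \<le> N \<Longrightarrow> f (pade_factor a b c y w) \<le> K * X ^ c"
    and K: "K \<ge> 0"
  shows "f (pade e x i) \<le> K * f (x i) ^ (2 * N) * X ^ N"
proof -
  define j k where "j = (i + 1) mod 3" and "k = (i + 2) mod 3"
  have jk: "j < 3" "k < 3" by (auto simp: j_def k_def)
  have s: "e j + e k + e i + 1 = 3 * N"
    using e less3[OF i] unfolding pade_exponents_def j_def k_def by (elim disjE conjE) (auto simp: numeral_2_eq_2[symmetric])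
  have ei: "e i \<le> N" "e j \<le> N" "e k \<le> N" using e i jk by (auto simp: pade_exponents_def)
  have "f (pade e x i) = f (x i) ^ (e j + e k + 1) * f (pade_factor (e j) (e k) (e i) (x k) (- x j))"
    by (simp add: pade_def Let_def j_def k_def abs_val_simps[OF f] abs_val_power[OF f])
  also have "\<dots> \<le> f (x i) ^ (e j + e k + 1) * (K * X ^ e i)"
    by (intro mult_left_mono V) (use s ei X jk abs_val_simps[OF f] in auto)
  also have "e j + e k + 1 = 2 * N + (N - e i)" using s ei by linarith
  also have "f (x i) ^ (2 * N + (N - e i)) * (K * X ^ e i) = K * f (x i) ^ (2 * N) * (f (x i) ^ (N - e i) * X ^ e i)"
    by (simp add: power_add)
  also have "\<dots> \<le> K * f (x i) ^ (2 * N) * (X ^ (N - e i) * X ^ e i)"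
  proof -
    have "X \<ge> 0" using X[OF i] abs_val_simps(1)[OF f, of "x i"] by simp
    then show ?thesis using X[OF i] abs_val_simps(1)[OF f] K
      by (intro mult_left_mono mult_right_mono power_mono) auto
  qed
  also have "X ^ (N - e i) * X ^ e i = X ^ N" using ei by (simp flip: power_add)
  finally show ?thesis .
qed

lemma pade_bound:
  assumes f: "absolute_value f" and e: "pade_exponents N e" and i: "i < 3" and X: "\<And>l. l < 3 \<Longrightarrow> f (x l) \<le> X"
  shows "f (pade e x i) \<le> real (3 * N choose N) * f (x i) ^ (2 * N) * X ^ N"
proof (rule pade_bound_aux[OF f e i X])
  fix a b c :: nat and y w
  assume y: "f y \<le> X" "f w \<le> X" and abc: "a + b + c + 1 = 3 * N" "c \<le> N"
  have "X \<ge> 0" using y abs_val_simps(1)[OF f, of y] by simp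
  have "f (pade_factor a b c y w) \<le> real (3 * N choose c) * X ^ c" using pade_factor_bound[OF f y, of a b c] abc by simp
  also have "\<dots> \<le> real (3 * N choose N) * X ^ c"
    using binomial_mono[of c N "3 * N"] abc \<open>X \<ge> 0\<close> by (intro mult_right_mono) auto
  finally show "f (pade_factor a b c y w) \<le> real (3 * N choose N) * X ^ c" .
qed auto

lemma pade_bound_ultra:
  assumes f: "ultra f" and e: "pade_exponents N e" and i: "i < 3" and X: "\<And>l. l < 3 \<Longrightarrow> f (x l) \<le> X"
  shows "f (pade e x i) \<le> f (x i) ^ (2 * N) * X ^ N"
  using pade_bound_aux[OF ultraD(1)[OF f] e i X, where K = 1] pade_factor_bound_ultra[OF f] by simp

section \<open>Smallest coordinate, geometric mean and determinants\<close>

lemma zero_sum_triple_pos: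
  assumes "absolute_value f" "zero_sum_triple x"
  shows "l < 3 \<Longrightarrow> f (x l) > 0" "min_abs f x > 0"
proof -
  show *: "l < 3 \<Longrightarrow> f (x l) > 0" for l using less3[of l] assms abs_val_simps(7)[OF assms(1)] by (auto simp: zero_sum_triple_def)
  show "min_abs f x > 0" using *[of 0] *[of 1] *[of 2] by (simp add: min_abs_def)
qed

lemma exp_ln_mean_sq:
  assumes f: "absolute_value f" and x: "zero_sum_triple x" and i: "i = argmin_abs f x"
  shows "exp (ln_mean f x) ^ 2 = f (x ((i + 1) mod 3)) * f (x ((i + 2) mod 3))"
proof -
  have p: "f (x ((i + 1) mod 3)) > 0" "f (x ((i + 2) mod 3)) > 0" using zero_sum_triple_pos[OF f x] by auto
  have "exp (ln_mean f x) ^ 2 = exp (2 * ln_mean f x)" by (simp add: exp_double)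
  also have "2 * ln_mean f x = ln (f (x ((i + 1) mod 3))) + ln (f (x ((i + 2) mod 3)))"
    using argmin_abs_facts(4)[OF i refl refl] by simp
  finally show ?thesis using p by (simp add: exp_add)
qed

lemma exp_ln_min:
  assumes f: "absolute_value f" and x: "zero_sum_triple x"
  shows "exp (ln_min f x) = min_abs f x"
  using zero_sum_triple_pos(2)[OF assms] by (simp add: ln_min_def)

lemma ln_min_le_ln_mean:
  assumes f: "absolute_value f" and x: "zero_sum_triple x"
  shows "ln_min f x \<le> ln_mean f x"
proof -
  define i where "i = argmin_abs f x"
  note F = argmin_abs_facts[OF i_def refl refl]
  have "ln (min_abs f x) \<le> ln (f (x ((i + 1) mod 3)))" "ln (min_abs f x) \<le> ln (f (x ((i + 2) mod 3)))"
    using F zero_sum_triple_pos[OF f x] by (auto intro!: ln_mono)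
  then show ?thesis using F(4) by (simp add: ln_min_def)
qed

lemma sum0_rot:
  assumes "x 0 + x 1 + x 2 = (0::'a::comm_ring_1)" "(i::nat) < 3"
  shows "x ((i + 1) mod 3) = - (x i + x ((i + 2) mod 3))" "x ((i + 2) mod 3) = - (x i + x ((i + 1) mod 3))"
  unfolding eq_neg_iff_add_eq_0 using assms(1) less3[OF assms(2)]
  by (auto simp: add_ac numeral_2_eq_2[symmetric])

lemma zero_sum_triple_triangle:
  assumes f: "absolute_value f" and x: "zero_sum_triple x" and "i < 3"
  shows "f (x ((i + 1) mod 3)) \<le> f (x i) + f (x ((i + 2) mod 3))"
    "f (x ((i + 2) mod 3)) \<le> f (x i) + f (x ((i + 1) mod 3))"
proof -
  have "x 0 + x 1 + x 2 = 0" using x by (simp add: zero_sum_triple_def)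
  note * = sum0_rot[OF this assms(3)]
  show "f (x ((i + 1) mod 3)) \<le> f (x i) + f (x ((i + 2) mod 3))"
    by (subst *(1)) (simp only: abs_val_simps(4,6)[OF f])
  show "f (x ((i + 2) mod 3)) \<le> f (x i) + f (x ((i + 1) mod 3))"
    by (subst *(2)) (simp only: abs_val_simps(4,6)[OF f])
qed

lemma three_cases: "i < 3 \<Longrightarrow> l < 3 \<Longrightarrow> l = i \<or> l = (i + 1) mod 3 \<or> l = (i + 2) mod (3::nat)"
  using less3[of i] less3[of l] by auto

text \<open>Of the two coordinates other than the smallest, the larger is at most twice the other by
  the triangle inequality, so its square is at most twice their product.\<close>

lemma le_sqrt2_exp_ln_mean:
  assumes f: "absolute_value f" and x: "zero_sum_triple x" and l: "l < 3"
  shows "f (x l) \<le> sqrt 2 * exp (ln_mean f x)"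
proof -
  define i j k where "i = argmin_abs f x" and "j = (i + 1) mod 3" and "k = (i + 2) mod 3"
  note F = argmin_abs_facts[OF i_def j_def k_def]
  have i3: "i < 3" by (simp add: i_def argmin_abs_less)
  have pos: "f (x i) > 0" "f (x j) > 0" "f (x k) > 0" using zero_sum_triple_pos(1)[OF f x] i3 by (auto simp: j_def k_def)
  have sq: "exp (ln_mean f x) ^ 2 = f (x j) * f (x k)" using exp_ln_mean_sq[OF f x i_def] by (simp add: j_def k_def)
  have tr: "f (x j) \<le> 2 * f (x k)" "f (x k) \<le> 2 * f (x j)"
    using zero_sum_triple_triangle[OF f x i3] F by (simp_all add: j_def k_def)
  have le: "f (x j) ^ 2 \<le> 2 * (f (x j) * f (x k))" "f (x k) ^ 2 \<le> 2 * (f (x j) * f (x k))"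
    using mult_left_mono[OF tr(1), of "f (x j)"] mult_left_mono[OF tr(2), of "f (x k)"] pos
    by (simp_all add: power2_eq_square mult_ac)
  have "f (x i) ^ 2 \<le> f (x j) ^ 2" using F pos by (intro power_mono) auto
  then have "f (x l) ^ 2 \<le> 2 * (f (x j) * f (x k))"
    using three_cases[OF i3 l] le by (auto simp: j_def k_def)
  also have "\<dots> = (sqrt 2 * exp (ln_mean f x)) ^ 2" by (simp add: power_mult_distrib sq)
  finally show ?thesis by (rule power2_le_imp_le) simp
qed

lemma ultra_eq_exp_ln_mean:
  assumes f: "ultra f" and x: "zero_sum_triple x" and l: "l < 3" "l \<noteq> argmin_abs f x"
  shows "f (x l) = exp (ln_mean f x)"
proof -
  define i j k where "i = argmin_abs f x" and "j = (i + 1) mod 3" and "k = (i + 2) mod 3"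
  note fa = ultraD(1)[OF f]
  note F = argmin_abs_facts[OF i_def j_def k_def]
  have i3: "i < 3" by (simp add: i_def argmin_abs_less)
  have pos: "f (x i) > 0" "f (x j) > 0" "f (x k) > 0" using zero_sum_triple_pos(1)[OF fa x] i3 by (auto simp: j_def k_def)
  have "x 0 + x 1 + x 2 = 0" using x by (simp add: zero_sum_triple_def)
  note * = sum0_rot[OF this i3, folded j_def k_def]
  have "f (x j) \<le> max (f (x i)) (f (x k))" by (subst *(1)) (simp only: ultraD(2)[OF f] abs_val_simps(6)[OF fa])
  moreover have "f (x k) \<le> max (f (x i)) (f (x j))" by (subst *(2)) (simp only: ultraD(2)[OF f] abs_val_simps(6)[OF fa])
  ultimately have eq: "f (x j) = f (x k)" using F by linarith
  have "exp (ln_mean f x) ^ 2 = f (x j) ^ 2" using exp_ln_mean_sq[OF fa x i_def] eq by (simp add: j_def k_def power2_eq_square)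
  then have "exp (ln_mean f x) = f (x j)" using pos by (simp add: power2_eq_iff_nonneg)
  then show ?thesis using three_cases[OF i3 l(1)] l(2) eq by (auto simp: i_def j_def k_def)
qed

lemma ultra_le_exp_ln_mean:
  assumes f: "ultra f" and x: "zero_sum_triple x" and l: "l < 3"
  shows "f (x l) \<le> exp (ln_mean f x)"
proof (cases "l = argmin_abs f x")
  case True
  then have "f (x l) = exp (ln_min f x)" using argmin_abs_facts(1)[OF refl refl refl, of f x] exp_ln_min[OF ultraD(1)[OF f] x] by simp
  then show ?thesis using ln_min_le_ln_mean[OF ultraD(1)[OF f] x] by simp
qed (use ultra_eq_exp_ln_mean[OF f x l] in simp)

lemma ln_bound:
  assumes "(d::real) > 0" "K > 0" and d: "d \<le> K * max (exp A) (exp B)"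
  shows "ln d \<le> ln K + max A B"
proof -
  have "max (exp A) (exp B) = exp (max A B)" by (cases "A \<le> B") (auto simp: max_def)
  then have "ln d \<le> ln (K * exp (max A B))" using assms by (intro ln_mono) auto
  also have "\<dots> = ln K + max A B" using assms by (simp add: ln_mult_pos)
  finally show ?thesis .
qed

text \<open>When the smallest coordinates sit at the same index, expand by it and its successor:
  each product contains a smallest factor, and the saving is the lesser of the two
  differences.\<close>

lemma ultra_cross:
  assumes f: "ultra f" and x: "zero_sum_triple x" and y: "zero_sum_triple y" and d: "cross x y \<noteq> 0"
  shows "ln (f (cross x y)) \<le> ln_mean f x + ln_mean f y"
    "argmin_abs f x = argmin_abs f y \<Longrightarrow> ln (f (cross x y)) \<le> ln_mean f x + ln_mean f y - min (ln_mean f x - ln_min f x) (ln_mean f y - ln_min f y)"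
proof -
  note fa = ultraD(1)[OF f]
  have dp: "f (cross x y) > 0" using abs_val_simps(7)[OF fa d] .
  have "f (cross x y) \<le> max (f (x 0 * y 1)) (f (x 1 * y 0))" unfolding cross_def by (rule ultra_diff[OF f])
  also have "\<dots> \<le> exp (ln_mean f x) * exp (ln_mean f y)"
    using ultra_le_exp_ln_mean[OF f x] ultra_le_exp_ln_mean[OF f y] abs_val_simps(1)[OF fa]
    by (auto simp: abs_val_simps(3)[OF fa] intro!: mult_mono)
  also have "\<dots> = exp (ln_mean f x + ln_mean f y)" by (simp add: exp_add)
  finally have "ln (f (cross x y)) \<le> ln (exp (ln_mean f x + ln_mean f y))" using dp by (intro ln_mono)
  then show "ln (f (cross x y)) \<le> ln_mean f x + ln_mean f y" by simp
  assume eq: "argmin_abs f x = argmin_abs f y"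
  define i where "i = argmin_abs f x"
  have i: "i < 3" "(i + 1) mod 3 \<noteq> i" using less3[of i] by (auto simp: i_def argmin_abs_less)
  have s: "x 0 + x 1 + x 2 = 0" "y 0 + y 1 + y 2 = 0" using x y by (auto simp: zero_sum_triple_def)
  have "f (cross x y) \<le> max (f (x i * y ((i + 1) mod 3))) (f (x ((i + 1) mod 3) * y i))"
    unfolding cross_rot(1)[OF s i(1)] by (rule ultra_diff[OF f])
  also have "\<dots> = max (exp (ln_min f x) * exp (ln_mean f y)) (exp (ln_mean f x) * exp (ln_min f y))"
    using ultra_eq_exp_ln_mean[OF f x, of "(i + 1) mod 3"] ultra_eq_exp_ln_mean[OF f y, of "(i + 1) mod 3"] i
      argmin_abs_facts(1)[of i f x] argmin_abs_facts(1)[of i f y] exp_ln_min[OF fa x] exp_ln_min[OF fa y] eq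
    by (simp add: abs_val_simps(3)[OF fa] i_def)
  finally have "ln (f (cross x y)) \<le> ln 1 + max (ln_min f x + ln_mean f y) (ln_mean f x + ln_min f y)"
    by (intro ln_bound dp) (simp_all add: exp_add)
  then show "ln (f (cross x y)) \<le> ln_mean f x + ln_mean f y - min (ln_mean f x - ln_min f x) (ln_mean f y - ln_min f y)"
    by (auto simp: min_def max_def split: if_splits)
qed

text \<open>As in \<open>ultra_cross\<close>, except that the smallest coordinate of
  \<open>x\<close> enters the Pade form with its \<open>2 * N\<close>-th power.\<close>

lemma ultra_pade:
  assumes f: "ultra f" and x: "zero_sum_triple x" and y: "zero_sum_triple y" and e: "pade_exponents N e" and d: "cross (pade e x) y \<noteq> 0"
  shows "ln (f (cross (pade e x) y)) \<le> real (3 * N) * ln_mean f x + ln_mean f y"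
    "argmin_abs f x = argmin_abs f y \<Longrightarrow> ln (f (cross (pade e x) y)) \<le> real (3 * N) * ln_mean f x + ln_mean f y
       - min (real (2 * N) * (ln_mean f x - ln_min f x)) (ln_mean f y - ln_min f y)"
proof -
  note fa = ultraD(1)[OF f]
  let ?P = "pade e x" and ?M = "exp (ln_mean f x)"
  interpret triple x using x by unfold_locales (auto simp: zero_sum_triple_def dest: less3)
  have dp: "f (cross ?P y) > 0" using abs_val_simps(7)[OF fa d] .
  have P: "f (?P l) \<le> f (x l) ^ (2 * N) * ?M ^ N" if "l < 3" for l
    by (rule pade_bound_ultra[OF f e that]) (rule ultra_le_exp_ln_mean[OF f x])
  have P': "f (?P l) \<le> ?M ^ (3 * N)" if "l < 3" for l
  proof -
    have "f (x l) ^ (2 * N) * ?M ^ N \<le> ?M ^ (2 * N) * ?M ^ N"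
      using ultra_le_exp_ln_mean[OF f x that] abs_val_simps(1)[OF fa] by (intro mult_right_mono power_mono) auto
    then show ?thesis using P[OF that] by (simp flip: power_add)
  qed
  have M3: "?M ^ (3 * N) = exp (real (3 * N) * ln_mean f x)" by (simp only: exp_of_nat_mult)
  have "f (cross ?P y) \<le> max (f (?P 0 * y 1)) (f (?P 1 * y 0))" unfolding cross_def by (rule ultra_diff[OF f])
  also have "\<dots> \<le> ?M ^ (3 * N) * exp (ln_mean f y)"
    using P' ultra_le_exp_ln_mean[OF f y] abs_val_simps(1)[OF fa]
    by (auto simp: abs_val_simps(3)[OF fa] intro!: mult_mono)
  also have "\<dots> = exp (real (3 * N) * ln_mean f x + ln_mean f y)" unfolding M3 by (simp add: exp_add)
  finally have "ln (f (cross ?P y)) \<le> ln (exp (real (3 * N) * ln_mean f x + ln_mean f y))" using dp by (intro ln_mono)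
  then show "ln (f (cross ?P y)) \<le> real (3 * N) * ln_mean f x + ln_mean f y" by simp
  assume eq: "argmin_abs f x = argmin_abs f y"
  define i where "i = argmin_abs f x"
  have i: "i < 3" "(i + 1) mod 3 < 3" by (auto simp: i_def argmin_abs_less)
  have s: "y 0 + y 1 + y 2 = 0" using y by (auto simp: zero_sum_triple_def)
  have xi: "f (x i) = exp (ln_min f x)" "f (y i) = exp (ln_min f y)"
    using argmin_abs_facts(1)[of i f x] argmin_abs_facts(1)[of i f y] exp_ln_min[OF fa x] exp_ln_min[OF fa y] eq by (simp_all add: i_def)
  have "f (cross ?P y) \<le> max (f (?P i * y ((i + 1) mod 3))) (f (?P ((i + 1) mod 3) * y i))"
    unfolding cross_rot(1)[OF pade_sum s i(1)] by (rule ultra_diff[OF f])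
  also have "\<dots> \<le> max (exp (ln_min f x) ^ (2 * N) * ?M ^ N * exp (ln_mean f y)) (?M ^ (3 * N) * exp (ln_min f y))"
    unfolding abs_val_simps(3)[OF fa] xi(2)
    by (intro max.mono mult_mono P'[OF i(2)] P[OF i(1), unfolded xi] ultra_le_exp_ln_mean[OF f y i(2)])
       (auto simp: abs_val_simps(1)[OF fa])
  also have "exp (ln_min f x) ^ (2 * N) * ?M ^ N * exp (ln_mean f y) = exp (real (2 * N) * ln_min f x + real N * ln_mean f x + ln_mean f y)"
    by (simp only: exp_add exp_of_nat_mult)
  also have "?M ^ (3 * N) * exp (ln_min f y) = exp (real (3 * N) * ln_mean f x + ln_min f y)"
    by (simp only: exp_add exp_of_nat_mult)
  finally have "ln (f (cross ?P y)) \<le> ln 1 + max (real (2 * N) * ln_min f x + real N * ln_mean f x + ln_mean f y) (real (3 * N) * ln_mean f x + ln_min f y)"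
    by (intro ln_bound dp) simp_all
  then show "ln (f (cross ?P y)) \<le> real (3 * N) * ln_mean f x + ln_mean f y
       - min (real (2 * N) * (ln_mean f x - ln_min f x)) (ln_mean f y - ln_min f y)"
    by (auto simp: min_def max_def algebra_simps split: if_splits)
qed

text \<open>Consecutive binomials grow by at most 27/4, and 27/4 * sqrt 2 is at most 10 as sqrt 2
  \<le> 40/27. At N = 1 the left side still exceeds 10, so the induction starts at 2.\<close>

lemma binomial_growth: "N \<ge> 2 \<Longrightarrow> real (3 * N choose N) * sqrt 2 ^ N * (1 + sqrt 2) \<le> 10 ^ N"
proof (induction N rule: dec_induct)
  case base
  have "sqrt 2 \<le> (1.5::real)" by (rule real_le_lsqrt) (simp_all add: power2_eq_square)
  moreover have "((3 * 2) choose 2 :: nat) = 15" by (simp add: eval_nat_numeral)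
  ultimately show ?case by (simp add: power2_eq_square)
next
  case (step N)
  have f: "((3 * Suc N) choose Suc N) * (Suc N * ((2 * N + 2) * (2 * N + 1))) = ((3 * N) choose N) * ((3 * N + 3) * ((3 * N + 2) * (3 * N + 1)))"
  proof -
    have fN: "fact (3 * N) = fact N * fact (2 * N) * ((3 * N) choose N)"
      using binomial_fact_lemma[of N "3 * N"] by simp
    have fS: "fact (3 * Suc N) = fact (Suc N) * fact (2 * N + 2) * ((3 * Suc N) choose Suc N)"
      using binomial_fact_lemma[of "Suc N" "3 * Suc N"] by simp
    have "fact (3 * Suc N) = (3 * N + 3) * ((3 * N + 2) * ((3 * N + 1) * fact (3 * N) :: nat))"
      by (simp add: numeral_3_eq_3)
    moreover have "fact (2 * N + 2) = (2 * N + 2) * ((2 * N + 1) * fact (2 * N) :: nat)"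
      by (simp add: numeral_2_eq_2)
    ultimately have "fact N * fact (2 * N) * (((3 * Suc N) choose Suc N) * (Suc N * ((2 * N + 2) * (2 * N + 1))))
       = fact N * fact (2 * N) * (((3 * N) choose N) * ((3 * N + 3) * ((3 * N + 2) * (3 * N + 1))))"
      using fS fN by (simp only: fact_Suc of_nat_id) (simp only: mult_ac)
    then show ?thesis by (simp only: mult_cancel1) auto
  qed
  define b where "b = real (3 * N choose N)"
  define b' where "b' = real (3 * Suc N choose Suc N)"
  have eq: "b' * (real (Suc N) * (real (2 * N + 2) * real (2 * N + 1))) = b * (real (3 * N + 3) * (real (3 * N + 2) * real (3 * N + 1)))"
    using arg_cong[OF f, of real] unfolding b_def b'_def of_nat_mult .
  have poly: "real (3 * N + 3) * (real (3 * N + 2) * real (3 * N + 1)) \<le> 27/4 * (real (Suc N) * (real (2 * N + 2) * real (2 * N + 1)))"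
  proof -
    define n where "n = real N"
    have n: "n \<ge> 0" by (simp add: n_def)
    have "3 * ((3 * n + 2) * (3 * n + 1)) \<le> 27/4 * ((2 * n + 2) * (2 * n + 1))"
      using n by (simp add: algebra_simps)
    then have "(n + 1) * (3 * ((3 * n + 2) * (3 * n + 1))) \<le> (n + 1) * (27/4 * ((2 * n + 2) * (2 * n + 1)))"
      using n by (intro mult_left_mono) auto
    moreover have "real (3 * N + 3) = (n + 1) * 3" "real (3 * N + 2) = 3 * n + 2" "real (3 * N + 1) = 3 * n + 1"
      "real (Suc N) = n + 1" "real (2 * N + 2) = 2 * n + 2" "real (2 * N + 1) = 2 * n + 1"
      by (simp_all add: n_def)
    ultimately show ?thesis by (simp only: mult_ac)
  qed
  have "b \<ge> 0" by (simp add: b_def)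
  have "b' * (real (Suc N) * (real (2 * N + 2) * real (2 * N + 1))) \<le> (27/4 * b) * (real (Suc N) * (real (2 * N + 2) * real (2 * N + 1)))"
    unfolding eq using mult_left_mono[OF poly \<open>b \<ge> 0\<close>] by (simp only: mult_ac)
  then have "b' \<le> 27/4 * b" by (rule mult_right_le_imp_le) simp
  have s: "sqrt 2 \<le> (40/27::real)" by (rule real_le_lsqrt) (simp_all add: power2_eq_square)
  have "b' * sqrt 2 \<le> (27/4 * b) * (40/27)" using \<open>b' \<le> _\<close> s \<open>b \<ge> 0\<close> by (intro mult_mono) auto
  then have "(b' * sqrt 2) * (sqrt 2 ^ N * (1 + sqrt 2)) \<le> (10 * b) * (sqrt 2 ^ N * (1 + sqrt 2))"
    by (intro mult_right_mono) auto
  also have "\<dots> \<le> 10 * 10 ^ N" using step.IH by (simp add: b_def mult_ac)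
  finally show ?case by (simp add: b'_def mult_ac)
qed

text \<open>A coordinate may exceed the mean by a factor sqrt 2, which would be costly in a
  \<open>2 * N\<close>-th power. The determinant is therefore expanded by the smallest coordinate
  and the smaller of the other two, which is at most the mean; \<open>binomial_growth\<close>
  absorbs the rest.\<close>

lemma abs_pade:
  assumes f: "absolute_value f" and x: "zero_sum_triple x" and y: "zero_sum_triple y" and e: "pade_exponents N e" and d: "cross (pade e x) y \<noteq> 0"
    and N: "N \<ge> 2" and eq: "argmin_abs f x = argmin_abs f y"
  shows "ln (f (cross (pade e x) y)) \<le> real N * ln 10 + real (3 * N) * ln_mean f x + ln_mean f y
       - min (real (2 * N) * (ln_mean f x - ln_min f x)) (ln_mean f y - ln_min f y)"
proof -
  let ?P = "pade e x" and ?M = "exp (ln_mean f x)" and ?K = "real (3 * N choose N)"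
  interpret triple x using x by unfold_locales (auto simp: zero_sum_triple_def dest: less3)
  have dp: "f (cross ?P y) > 0" using abs_val_simps(7)[OF f d] .
  have P: "f (?P l) \<le> ?K * f (x l) ^ (2 * N) * (sqrt 2 * ?M) ^ N" if "l < 3" for l
    by (rule pade_bound[OF f e that]) (rule le_sqrt2_exp_ln_mean[OF f x])
  define i where "i = argmin_abs f x"
  have i: "i < 3" "(i + 1) mod 3 < 3" "(i + 2) mod 3 < 3" by (auto simp: i_def argmin_abs_less)
  have s: "y 0 + y 1 + y 2 = 0" using y by (auto simp: zero_sum_triple_def)
  have xi: "f (x i) = exp (ln_min f x)" "f (y i) = exp (ln_min f y)"
    using argmin_abs_facts(1)[of i f x] argmin_abs_facts(1)[of i f y] exp_ln_min[OF f x] exp_ln_min[OF f y] eq by (simp_all add: i_def)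
  have sq: "?M ^ 2 = f (x ((i + 1) mod 3)) * f (x ((i + 2) mod 3))" by (rule exp_ln_mean_sq[OF f x i_def])
  have "\<exists>l<3. f (x l) \<le> ?M \<and> f (cross ?P y) \<le> f (?P i) * f (y l) + f (?P l) * f (y i)"
  proof -
    have c: "f (cross ?P y) \<le> f (?P i) * f (y ((i + 1) mod 3)) + f (?P ((i + 1) mod 3)) * f (y i)"
      unfolding cross_rot(1)[OF pade_sum s i(1)] abs_val_simps(3)[OF f, symmetric] by (rule abs_val_minus_diff[OF f])
    have c': "f (cross ?P y) \<le> f (?P ((i + 2) mod 3)) * f (y i) + f (?P i) * f (y ((i + 2) mod 3))"
      unfolding cross_rot(2)[OF pade_sum s i(1)] abs_val_simps(3)[OF f, symmetric] by (rule abs_val_minus_diff[OF f])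
    have pos: "f (x ((i + 1) mod 3)) > 0" "f (x ((i + 2) mod 3)) > 0" using zero_sum_triple_pos(1)[OF f x] i by auto
    show ?thesis
    proof (cases "f (x ((i + 1) mod 3)) \<le> f (x ((i + 2) mod 3))")
      case True
      then have "f (x ((i + 1) mod 3)) ^ 2 \<le> ?M ^ 2" unfolding sq unfolding power2_eq_square using pos by (intro mult_left_mono) auto
      then have "f (x ((i + 1) mod 3)) \<le> ?M" by (rule power2_le_imp_le) simp
      then show ?thesis using c i by blast
    next
      case False
      then have "f (x ((i + 2) mod 3)) ^ 2 \<le> ?M ^ 2" unfolding sq unfolding power2_eq_square using pos by (intro mult_right_mono) auto
      then have "f (x ((i + 2) mod 3)) \<le> ?M" by (rule power2_le_imp_le) simp
      then show ?thesis using c' i by (metis add.commute)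
    qed
  qed
  then obtain l where l: "l < 3" "f (x l) \<le> ?M" "f (cross ?P y) \<le> f (?P i) * f (y l) + f (?P l) * f (y i)" by blast
  let ?A = "real (2 * N) * ln_min f x + real N * ln_mean f x + ln_mean f y" and ?B = "real (3 * N) * ln_mean f x + ln_min f y"
  have eA: "exp ?A = exp (ln_min f x) ^ (2 * N) * ?M ^ N * exp (ln_mean f y)"
    by (simp only: exp_add exp_of_nat_mult)
  have eB: "exp ?B = ?M ^ (2 * N) * ?M ^ N * exp (ln_min f y)"
    by (simp only: exp_add exp_of_nat_mult power_add[symmetric]) simp
  have "f (?P i) * f (y l) \<le> (?K * exp (ln_min f x) ^ (2 * N) * (sqrt 2 * ?M) ^ N) * (sqrt 2 * exp (ln_mean f y))"
    by (intro mult_mono P[OF i(1), unfolded xi] le_sqrt2_exp_ln_mean[OF f y l(1)]) (auto simp: abs_val_simps(1)[OF f])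
  also have "\<dots> = ?K * sqrt 2 ^ N * sqrt 2 * exp ?A" unfolding eA by (simp add: power_mult_distrib mult_ac)
  also have "\<dots> \<le> ?K * sqrt 2 ^ N * sqrt 2 * max (exp ?A) (exp ?B)" by (intro mult_left_mono) auto
  finally have t1: "f (?P i) * f (y l) \<le> ?K * sqrt 2 ^ N * sqrt 2 * max (exp ?A) (exp ?B)" .
  have "f (?P l) * f (y i) \<le> (?K * ?M ^ (2 * N) * (sqrt 2 * ?M) ^ N) * exp (ln_min f y)"
    unfolding xi
  proof (intro mult_right_mono)
    have "?K * f (x l) ^ (2 * N) * (sqrt 2 * ?M) ^ N \<le> ?K * ?M ^ (2 * N) * (sqrt 2 * ?M) ^ N"
      using l(2) abs_val_simps(1)[OF f] by (intro mult_right_mono mult_left_mono power_mono) auto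
    then show "f (?P l) \<le> ?K * ?M ^ (2 * N) * (sqrt 2 * ?M) ^ N" using P[OF l(1)] by linarith
  qed simp
  also have "\<dots> = ?K * sqrt 2 ^ N * exp ?B" unfolding eB by (simp add: power_mult_distrib mult_ac)
  also have "\<dots> \<le> ?K * sqrt 2 ^ N * max (exp ?A) (exp ?B)" by (intro mult_left_mono) auto
  finally have t2: "f (?P l) * f (y i) \<le> ?K * sqrt 2 ^ N * max (exp ?A) (exp ?B)" .
  have "f (cross ?P y) \<le> ?K * sqrt 2 ^ N * (1 + sqrt 2) * max (exp ?A) (exp ?B)"
    using l(3) t1 t2 by (simp add: algebra_simps)
  also have "\<dots> \<le> 10 ^ N * max (exp ?A) (exp ?B)"
    by (intro mult_right_mono binomial_growth[OF N]) (auto simp: le_max_iff_disj)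
  finally have "ln (f (cross ?P y)) \<le> ln (10 ^ N) + max ?A ?B" by (intro ln_bound dp) auto
  moreover have "ln (10 ^ N :: real) = real N * ln 10" by (simp add: ln_realpow)
  ultimately show ?thesis by (auto simp: min_def max_def algebra_simps split: if_splits)
qed

section \<open>Complex triples: ratio, sectors and grid cells\<close>

definition ratio :: "(nat \<Rightarrow> complex) \<Rightarrow> complex" where
  "ratio u = (let i = argmin_abs cmod u in u i / (u ((i + 1) mod 3) - u ((i + 2) mod 3)))"

lemma absolute_value_cmod: "absolute_value cmod"
  by (auto simp: absolute_value_def norm_mult norm_triangle_ineq)

text \<open>The hypotheses say that t is smallest among t, (1 - t)/2 and (1 + t)/2 in absolute
  value. Their product bounds 4 |t|^2 by |1 - t^2|, and 1 - |t|^2 is also at most |1 - t^2|. Their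
  squares give the region to be covered by the grid.\<close>

lemma four_fifths:
  assumes "2 * cmod t \<le> cmod (1 - t)" "2 * cmod t \<le> cmod (1 + t)"
  shows "cmod (1 - t ^ 2) \<ge> 4 / 5" "3 * (cmod t) ^ 2 + 2 * \<bar>Re t\<bar> \<le> 1"
proof -
  have "(2 * cmod t) * (2 * cmod t) \<le> cmod (1 - t) * cmod (1 + t)" using assms by (intro mult_mono) auto
  also have "\<dots> = cmod (1 - t ^ 2)" by (simp flip: norm_mult add: algebra_simps power2_eq_square)
  finally have "4 * cmod t ^ 2 \<le> cmod (1 - t ^ 2)" by (simp add: power2_eq_square)
  moreover have "1 - cmod t ^ 2 \<le> cmod (1 - t ^ 2)"
    using norm_triangle_ineq2[of 1 "t ^ 2"] by (simp add: norm_power)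
  ultimately show "cmod (1 - t ^ 2) \<ge> 4 / 5" by linarith
  have sq: "cmod t ^ 2 = Re t ^ 2 + Im t ^ 2" "cmod (1 - t) ^ 2 = (1 - Re t) ^ 2 + Im t ^ 2"
    "cmod (1 + t) ^ 2 = (1 + Re t) ^ 2 + Im t ^ 2" by (simp_all add: cmod_power2)
  have "(2 * cmod t) ^ 2 \<le> cmod (1 - t) ^ 2" "(2 * cmod t) ^ 2 \<le> cmod (1 + t) ^ 2"
    using assms by (intro power_mono; simp)+
  then have "4 * cmod t ^ 2 \<le> 1 - 2 * Re t + cmod t ^ 2" "4 * cmod t ^ 2 \<le> 1 + 2 * Re t + cmod t ^ 2"
    unfolding power_mult_distrib sq by (simp_all add: power2_eq_square algebra_simps)
  then show "3 * (cmod t) ^ 2 + 2 * \<bar>Re t\<bar> \<le> 1" by linarith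
qed

text \<open>Starting at the smallest coordinate, the triple is \<open>d\<close> times (t, (1 - t)/2,
  -(1 + t)/2) with t the ratio. The constant 5/4 is the inverse of the 4/5 in
  \<open>four_fifths\<close>.\<close>

lemma ratio_facts:
  fixes u :: "nat \<Rightarrow> complex"
  assumes u: "zero_sum_triple u" and i: "i = argmin_abs cmod u" and d: "d = u ((i + 1) mod 3) - u ((i + 2) mod 3)"
  shows "d \<noteq> 0" "u i = ratio u * d" "u ((i + 1) mod 3) = d * (1 - ratio u) / 2"
    "3 * (cmod (ratio u)) ^ 2 + 2 * \<bar>Re (ratio u)\<bar> \<le> 1"
    "cmod d / 2 \<le> sqrt (5/4) * exp (ln_mean cmod u)"
proof -
  let ?j = "(i + 1) mod 3" and ?k = "(i + 2) mod 3"
  have i3: "i < 3" by (simp add: i argmin_abs_less)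
  have s: "u i = - (u ?j + u ?k)"
  proof -
    have "u 0 + u 1 + u 2 = 0" using u by (simp add: zero_sum_triple_def)
    then show ?thesis using sum0_rot(1)[of u i] i3 by (simp add: algebra_simps)
  qed
  note F = argmin_abs_facts[OF i refl refl]
  have pos: "cmod (u i) > 0" "cmod (u ?j) > 0" "cmod (u ?k) > 0"
    using zero_sum_triple_pos(1)[OF absolute_value_cmod u] i3 by auto
  show d0: "d \<noteq> 0"
  proof
    assume "d = 0"
    then have "cmod (u i) = 2 * cmod (u ?k)" using s d by (simp add: norm_mult flip: mult_2)
    then show False using F pos by simp
  qed
  have t: "ratio u = u i / d" by (simp add: ratio_def Let_def i d)
  then show t': "u i = ratio u * d" using d0 by simp
  have du: "d - u i = 2 * u ?j" "d + u i = - 2 * u ?k" unfolding s d by simp_all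
  have j: "u ?j = d * (1 - ratio u) / 2" using du(1) unfolding t'[symmetric] right_diff_distrib
    by (simp add: t' mult.commute)
  have k: "u ?k = - (d * (1 + ratio u) / 2)" using du(2) by (simp add: t' algebra_simps)
  show "u ?j = d * (1 - ratio u) / 2" by (rule j)
  have "cmod (ratio u) * cmod d \<le> cmod (1 - ratio u) / 2 * cmod d"
    using F(1,2) unfolding j by (subst (asm) t') (simp add: norm_mult norm_divide mult_ac)
  then have a: "2 * cmod (ratio u) \<le> cmod (1 - ratio u)" using d0 by simp
  have "cmod (ratio u) * cmod d \<le> cmod (1 + ratio u) / 2 * cmod d"
    using F(1,3) unfolding k by (subst (asm) t') (simp add: norm_mult norm_divide mult_ac)
  then have b: "2 * cmod (ratio u) \<le> cmod (1 + ratio u)" using d0 by simp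
  show "3 * (cmod (ratio u)) ^ 2 + 2 * \<bar>Re (ratio u)\<bar> \<le> 1" by (rule four_fifths(2)[OF a b])
  have "exp (ln_mean cmod u) ^ 2 = cmod (u ?j) * cmod (u ?k)" by (rule exp_ln_mean_sq[OF absolute_value_cmod u i])
  also have "\<dots> = (cmod d / 2) ^ 2 * (cmod (1 - ratio u) * cmod (1 + ratio u))"
    unfolding j k by (simp add: norm_mult norm_divide power2_eq_square)
  also have "cmod (1 - ratio u) * cmod (1 + ratio u) = cmod (1 - ratio u ^ 2)"
    by (simp flip: norm_mult add: algebra_simps power2_eq_square)
  finally have "exp (ln_mean cmod u) ^ 2 \<ge> (cmod d / 2) ^ 2 * (4 / 5)"
    using mult_left_mono[OF four_fifths(1)[OF a b], of "(cmod d / 2) ^ 2"] by simp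
  then have "(cmod d / 2) ^ 2 \<le> (sqrt (5/4) * exp (ln_mean cmod u)) ^ 2"
    unfolding power_mult_distrib by simp
  then show "cmod d / 2 \<le> sqrt (5/4) * exp (ln_mean cmod u)" by (rule power2_le_imp_le) simp
qed

text \<open>Separates the two scales from the position, so that the determinant is controlled by the
  distance of two ratios.\<close>

lemma cross_ratio:
  fixes u v :: "nat \<Rightarrow> complex"
  assumes u: "zero_sum_triple u" and v: "zero_sum_triple v" and eq: "argmin_abs cmod u = argmin_abs cmod v" and i: "i = argmin_abs cmod u"
    and d: "d = u ((i + 1) mod 3) - u ((i + 2) mod 3)" "e = v ((i + 1) mod 3) - v ((i + 2) mod 3)"
  shows "cross u v = 2 * (d / 2) * (e / 2) * (ratio u - ratio v)"
proof -
  note U = ratio_facts[OF u i d(1)] and V = ratio_facts[OF v i[unfolded eq] d(2)]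
  have s: "u 0 + u 1 + u 2 = 0" "v 0 + v 1 + v 2 = 0" using u v by (auto simp: zero_sum_triple_def)
  have "cross u v = u i * v ((i + 1) mod 3) - u ((i + 1) mod 3) * v i"
    by (rule cross_rot(1)[OF s]) (simp add: i argmin_abs_less)
  also have "\<dots> = 2 * (d / 2) * (e / 2) * (ratio u - ratio v)"
    unfolding U(3) V(3) by (subst U(2), subst V(2)) (simp add: field_simps)
  finally show ?thesis .
qed

text \<open>Six sectors of angle at most \<open>\<pi>/3\<close>; real numbers meet only the first two.\<close>

definition sector :: "complex \<Rightarrow> nat" where
  "sector z = (if sqrt 3 * \<bar>Im z\<bar> \<le> \<bar>Re z\<bar> then (if Re z \<ge> 0 then 0 else 1)
     else (if Re z \<ge> 0 then 2 else 3) + (if Im z \<ge> 0 then 0 else 2))"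

lemma sector_less: "sector z < 6" "Im z = 0 \<Longrightarrow> sector z < 2"
  by (auto simp: sector_def)

text \<open>The angle is at most \<pi>/3, so its cosine is at least 1/2. In the sectors around the
  real axis the imaginary parts may have opposite signs, but their product is at most a third of
  that of the real parts.\<close>

lemma sector_angle:
  assumes eq: "sector z = sector w"
  shows "2 * (Re z * Re w + Im z * Im w) \<ge> cmod z * cmod w"
proof -
  define a b a' b' where "a = \<bar>Re z\<bar>" and "b = \<bar>Im z\<bar>" and "a' = \<bar>Re w\<bar>" and "b' = \<bar>Im w\<bar>"
  have nn: "a \<ge> 0" "b \<ge> 0" "a' \<ge> 0" "b' \<ge> 0" by (auto simp: a_def b_def a'_def b'_def)
  have cz: "cmod z ^ 2 = a ^ 2 + b ^ 2" and cw: "cmod w ^ 2 = a' ^ 2 + b' ^ 2"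
    by (simp_all add: cmod_power2 a_def b_def a'_def b'_def)
  consider (inner) "sqrt 3 * b \<le> a" "sqrt 3 * b' \<le> a'" "Re z * Re w = a * a'"
    | (outer) "a \<le> sqrt 3 * b" "a' \<le> sqrt 3 * b'" "Re z * Re w = a * a'" "Im z * Im w = b * b'"
    using eq unfolding sector_def a_def b_def a'_def b'_def
    by (auto split: if_splits simp: abs_mult[symmetric] abs_if mult_nonneg_nonpos mult_nonpos_nonneg not_le)
  then show ?thesis
  proof cases
    case inner
    have sq: "3 * b ^ 2 \<le> a ^ 2" "3 * b' ^ 2 \<le> a' ^ 2"
      using power_mono[OF inner(1), of 2] power_mono[OF inner(2), of 2] nn by (simp_all add: power_mult_distrib)
    have "(3 * (b * b')) \<le> a * a'"
    proof -
      have "3 * (b * b') = (sqrt 3 * sqrt 3) * (b * b')" by simp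
      also have "\<dots> = (sqrt 3 * b) * (sqrt 3 * b')" by (simp only: mult_ac)
      also have "\<dots> \<le> a * a'" using inner(1,2) nn by (intro mult_mono) auto
      finally show ?thesis .
    qed
    moreover have "Im z * Im w \<ge> - (b * b')"
      using abs_ge_minus_self[of "Im z * Im w"] by (simp add: b_def b'_def abs_mult)
    ultimately have 1: "Re z * Re w + Im z * Im w \<ge> 2/3 * (a * a')" using inner(3) by linarith
    have "(cmod z * cmod w) ^ 2 \<le> (4/3 * a ^ 2) * (4/3 * a' ^ 2)"
      unfolding power_mult_distrib cz cw using sq by (intro mult_mono) auto
    also have "\<dots> = (4/3 * (a * a')) ^ 2" by (simp add: power2_eq_square)
    finally have "cmod z * cmod w \<le> 4/3 * (a * a')" by (rule power2_le_imp_le) (use nn in auto)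
    also have "4/3 * (a * a') = 2 * (2/3 * (a * a'))" by simp
    also have "\<dots> \<le> 2 * (Re z * Re w + Im z * Im w)" using 1 by (intro mult_left_mono) auto
    finally show ?thesis .
  next
    case outer
    have sq: "a ^ 2 \<le> 3 * b ^ 2" "a' ^ 2 \<le> 3 * b' ^ 2"
      using power_mono[OF outer(1), of 2] power_mono[OF outer(2), of 2] nn by (simp_all add: power_mult_distrib)
    have "0 \<le> (3 * b ^ 2 - a ^ 2) * (3 * b' ^ 2 - a' ^ 2)" using sq by simp
    moreover have "0 \<le> (a * a') * (b * b')" "0 \<le> a ^ 2 * a' ^ 2" using nn by auto
    ultimately have "(cmod z * cmod w) ^ 2 \<le> (2 * (a * a' + b * b')) ^ 2"
      unfolding power_mult_distrib cz cw by (simp add: power2_eq_square algebra_simps)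
    then have "cmod z * cmod w \<le> 2 * (a * a' + b * b')" by (rule power2_le_imp_le) (use nn in auto)
    then show ?thesis using outer by simp
  qed
qed

text \<open>The law of cosines with an angle of at most \<pi>/3.\<close>

lemma cmod_diff_sector:
  assumes "sector z = sector w"
  shows "cmod (z - w) \<le> max (cmod z) (cmod w)"
proof -
  have "cmod (z - w) ^ 2 = cmod z ^ 2 + cmod w ^ 2 - 2 * (Re z * Re w + Im z * Im w)"
    unfolding cmod_power2 by (simp add: power2_eq_square algebra_simps)
  then have 1: "cmod (z - w) ^ 2 \<le> cmod z ^ 2 + cmod w ^ 2 - cmod z * cmod w" using sector_angle[OF assms] by linarith
  have "cmod (z - w) ^ 2 \<le> max (cmod z) (cmod w) ^ 2"
  proof (cases "cmod z \<le> cmod w")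
    case True
    then have "cmod z ^ 2 \<le> cmod z * cmod w" by (simp add: power2_eq_square mult_left_mono)
    then have "cmod (z - w) ^ 2 \<le> cmod w ^ 2" using 1 by linarith
    then show ?thesis by (simp only: max_absorb2[OF True])
  next
    case False
    then have "cmod w ^ 2 \<le> cmod z * cmod w" by (simp add: power2_eq_square mult_right_mono)
    then have "cmod (z - w) ^ 2 \<le> cmod z ^ 2" using 1 by linarith
    moreover have "max (cmod z) (cmod w) = cmod z" using False by simp
    ultimately show ?thesis by (simp only:)
  qed
  then show ?thesis by (rule power2_le_imp_le) (simp add: le_max_iff_disj)
qed

lemma ln_sqrt_54: "ln (sqrt (5/4)) \<le> 1/8"
proof -
  have "ln (5/4::real) \<le> 1/4" using ln_add_one_self_le_self[of "1/4"] by simp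
  then show ?thesis by (simp add: ln_sqrt)
qed

text \<open>Only one of the two scales is estimated; the other combines with the larger ratio to an
  exact smallest coordinate. So sqrt (5/4) enters once, and its logarithm is at most 1/8.\<close>

lemma complex_cross_sector:
  fixes u v :: "nat \<Rightarrow> complex"
  assumes u: "zero_sum_triple u" and v: "zero_sum_triple v" and eq: "argmin_abs cmod u = argmin_abs cmod v" and sec: "sector (ratio u) = sector (ratio v)"
    and nz: "cross u v \<noteq> 0"
  shows "ln (cmod (cross u v)) \<le> 1/8 + ln_mean cmod u + ln_mean cmod v - min (ln_mean cmod u - ln_min cmod u) (ln_mean cmod v - ln_min cmod v)"
proof -
  define i where "i = argmin_abs cmod u"
  define d e where "d = u ((i + 1) mod 3) - u ((i + 2) mod 3)" and "e = v ((i + 1) mod 3) - v ((i + 2) mod 3)"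
  note U = ratio_facts[OF u i_def d_def] and V = ratio_facts[OF v i_def[unfolded eq] e_def]
  note fa = absolute_value_cmod
  let ?K = "sqrt (5/4)"
  have m: "cmod (ratio u) * cmod d = exp (ln_min cmod u)" "cmod (ratio v) * cmod e = exp (ln_min cmod v)"
    using U(2) V(2) argmin_abs_facts(1)[of i cmod u] argmin_abs_facts(1)[of i cmod v] exp_ln_min[OF fa u] exp_ln_min[OF fa v] eq
    by (simp_all add: i_def norm_mult[symmetric])
  have n: "cmod (cross u v) = 2 * (cmod d / 2) * (cmod e / 2) * cmod (ratio u - ratio v)"
    unfolding cross_ratio[OF u v eq i_def d_def e_def] by (simp add: norm_mult)
  have "cmod (cross u v) \<le> ?K * max (exp (ln_min cmod u + ln_mean cmod v)) (exp (ln_mean cmod u + ln_min cmod v))"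
  proof (cases "cmod (ratio v) \<le> cmod (ratio u)")
    case True
    then have "cmod (ratio u - ratio v) \<le> cmod (ratio u)" using cmod_diff_sector[OF sec] by simp
    then have "cmod (cross u v) \<le> 2 * (cmod d / 2) * (cmod e / 2) * cmod (ratio u)"
      unfolding n by (intro mult_left_mono) auto
    also have "\<dots> = exp (ln_min cmod u) * (cmod e / 2)" by (simp flip: m)
    also have "\<dots> \<le> exp (ln_min cmod u) * (?K * exp (ln_mean cmod v))" using V(5) by (intro mult_left_mono) auto
    also have "\<dots> = ?K * exp (ln_min cmod u + ln_mean cmod v)" by (simp add: exp_add)
    also have "\<dots> \<le> ?K * max (exp (ln_min cmod u + ln_mean cmod v)) (exp (ln_mean cmod u + ln_min cmod v))"
      by (intro mult_left_mono) auto
    finally show ?thesis .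
  next
    case False
    then have "cmod (ratio u - ratio v) \<le> cmod (ratio v)" using cmod_diff_sector[OF sec] by simp
    then have "cmod (cross u v) \<le> 2 * (cmod d / 2) * (cmod e / 2) * cmod (ratio v)"
      unfolding n by (intro mult_left_mono) auto
    also have "\<dots> = exp (ln_min cmod v) * (cmod d / 2)" by (simp flip: m)
    also have "\<dots> \<le> exp (ln_min cmod v) * (?K * exp (ln_mean cmod u))" using U(5) by (intro mult_left_mono) auto
    also have "\<dots> = ?K * exp (ln_mean cmod u + ln_min cmod v)" by (simp add: exp_add)
    also have "\<dots> \<le> ?K * max (exp (ln_min cmod u + ln_mean cmod v)) (exp (ln_mean cmod u + ln_min cmod v))"
      by (intro mult_left_mono) auto
    finally show ?thesis .
  qed
  then have "ln (cmod (cross u v)) \<le> ln ?K + max (ln_min cmod u + ln_mean cmod v) (ln_mean cmod u + ln_min cmod v)"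
    using nz by (intro ln_bound) auto
  then show ?thesis using ln_sqrt_54 by (auto simp: min_def max_def split: if_splits)
qed

text \<open>With mesh 1/12 the determinant is at most 2 * (5/4) * (sqrt 2 / 12) = 5 sqrt 2 / 24
  times the means, which is below exp (-6/5); 6/5 is twice the height threshold 3/5.\<close>

definition cell :: "complex \<Rightarrow> int \<times> int" where
  "cell z = (\<lfloor>12 * Re z\<rfloor>, \<lfloor>12 * Im z\<rfloor>)"

lemma cell_dist:
  assumes "cell z = cell w"
  shows "cmod (z - w) \<le> sqrt 2 / 12"
proof -
  have *: "\<bar>a - b\<bar> \<le> 1 / 12" if "\<lfloor>12 * a\<rfloor> = \<lfloor>12 * b\<rfloor>" for a b :: real
    unfolding abs_le_iff using that floor_correct[of "12 * a"] floor_correct[of "12 * b"] by linarith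
  have "\<bar>Re z - Re w\<bar> \<le> 1 / 12" "\<bar>Im z - Im w\<bar> \<le> 1 / 12" using assms * by (auto simp: cell_def)
  then have "\<bar>Re z - Re w\<bar> ^ 2 \<le> (1 / 12) ^ 2" "\<bar>Im z - Im w\<bar> ^ 2 \<le> (1 / 12) ^ 2"
    by (intro power_mono; simp)+
  then have "cmod (z - w) ^ 2 \<le> (sqrt 2 / 12) ^ 2"
    by (simp add: cmod_power2 power_divide)
  then show ?thesis by (rule power2_le_imp_le) simp
qed

text \<open>The region satisfies |Re z| \<le> 1/3 and (Im z)^2 \<le> 1/3 < (7/12)^2, which leaves 9
  * 14 cells, and 9 for real numbers.\<close>

lemma cell_range:
  assumes "3 * (cmod z) ^ 2 + 2 * \<bar>Re z\<bar> \<le> 1"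
  shows "cell z \<in> {-4..4} \<times> {-7..6}" "Im z = 0 \<Longrightarrow> cell z \<in> {-4..4} \<times> {0}"
proof -
  have sq: "cmod z ^ 2 = Re z ^ 2 + Im z ^ 2" by (simp add: cmod_power2)
  have re: "\<bar>Re z\<bar> \<le> 1/3"
  proof (rule ccontr)
    assume "\<not> \<bar>Re z\<bar> \<le> 1/3"
    then have "(1/3) ^ 2 < \<bar>Re z\<bar> ^ 2" by (intro power_strict_mono) auto
    then have "1/9 < Re z ^ 2" by (simp add: power2_eq_square)
    then show False using assms sq \<open>\<not> \<bar>Re z\<bar> \<le> 1/3\<close> zero_le_power2[of "Im z"] by linarith
  qed
  have "Im z ^ 2 \<le> 1/3" using assms sq zero_le_power2[of "Re z"] abs_ge_zero[of "Re z"] by linarith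
  also have "\<dots> < (7/12) ^ 2" by (simp add: power2_eq_square)
  finally have "\<bar>Im z\<bar> ^ 2 < (7/12) ^ 2" by simp
  then have im: "\<bar>Im z\<bar> < 7/12" by (rule power_less_imp_less_base) simp
  have "-4 \<le> \<lfloor>12 * Re z\<rfloor>" "\<lfloor>12 * Re z\<rfloor> \<le> 4" "-7 \<le> \<lfloor>12 * Im z\<rfloor>" "\<lfloor>12 * Im z\<rfloor> \<le> 6"
    using re im by (auto simp: le_floor_iff floor_le_iff abs_le_iff abs_less_iff)
  then show "cell z \<in> {-4..4} \<times> {-7..6}" "Im z = 0 \<Longrightarrow> cell z \<in> {-4..4} \<times> {0}" by (auto simp: cell_def)
qed

lemma exp_6_5: "exp (6/5::real) \<le> 24 / (5 * sqrt 2)"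
proof -
  have "exp (6/5::real) = exp (1/40) ^ 48" by (simp flip: exp_of_nat_mult)
  also have "\<dots> \<le> (1 + 1/40 + (1/40) ^ 2) ^ 48" by (intro power_mono exp_bound) auto
  also have "\<dots> \<le> 339/100" by (simp add: eval_nat_numeral)
  finally have "exp (6/5::real) \<le> 339/100" .
  moreover have "sqrt 2 \<le> 480/339" by (rule real_le_lsqrt) (simp_all add: power2_eq_square)
  ultimately have "exp (6/5::real) * (5 * sqrt 2) \<le> 339/100 * (5 * (480/339))" by (intro mult_mono) auto
  then show ?thesis by (simp add: field_simps)
qed

lemma complex_cross_cell:
  fixes u v :: "nat \<Rightarrow> complex"
  assumes u: "zero_sum_triple u" and v: "zero_sum_triple v" and eq: "argmin_abs cmod u = argmin_abs cmod v" and c: "cell (ratio u) = cell (ratio v)"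
    and nz: "cross u v \<noteq> 0"
  shows "ln (cmod (cross u v)) \<le> ln_mean cmod u + ln_mean cmod v - 6/5"
proof -
  define i where "i = argmin_abs cmod u"
  define d e where "d = u ((i + 1) mod 3) - u ((i + 2) mod 3)" and "e = v ((i + 1) mod 3) - v ((i + 2) mod 3)"
  note U = ratio_facts[OF u i_def d_def] and V = ratio_facts[OF v i_def[unfolded eq] e_def]
  have "cmod (cross u v) = 2 * (cmod d / 2) * (cmod e / 2) * cmod (ratio u - ratio v)"
    unfolding cross_ratio[OF u v eq i_def d_def e_def] by (simp add: norm_mult)
  also have "\<dots> \<le> 2 * (sqrt (5/4) * exp (ln_mean cmod u)) * (sqrt (5/4) * exp (ln_mean cmod v)) * (sqrt 2 / 12)"
    using U(5) V(5) cell_dist[OF c] by (intro mult_mono) auto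
  also have "\<dots> = (sqrt (5/4) * sqrt (5/4)) * (sqrt 2 / 6) * exp (ln_mean cmod u + ln_mean cmod v)"
    by (simp add: exp_add)
  also have "\<dots> = (5 * sqrt 2 / 24) * exp (ln_mean cmod u + ln_mean cmod v)" by (simp only: real_sqrt_mult_self)
  also have "\<dots> \<le> exp (- (6/5)) * exp (ln_mean cmod u + ln_mean cmod v)"
  proof (rule mult_right_mono)
    have "5 * sqrt 2 / 24 = inverse (24 / (5 * sqrt 2))" by simp
    also have "\<dots> \<le> inverse (exp (6/5))" using exp_6_5 by (intro le_imp_inverse_le) auto
    finally show "5 * sqrt 2 / 24 \<le> exp (- (6/5))" by (simp add: exp_minus)
  qed simp
  also have "\<dots> = exp (ln_mean cmod u + ln_mean cmod v - 6/5)" by (simp add: exp_add[symmetric])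
  finally have "ln (cmod (cross u v)) \<le> ln (exp (ln_mean cmod u + ln_mean cmod v - 6/5))" using nz by (intro ln_mono) auto
  then show ?thesis by simp
qed

section \<open>Counting classes and heights\<close>

lemma ln10: "ln 10 \<le> (12/5::real)"
proof -
  have "(10::real) \<le> (1 + 1/20) ^ 48" by (simp add: eval_nat_numeral)
  also have "\<dots> \<le> exp (1/20) ^ 48" by (intro power_mono exp_ge_add_one_self) auto
  also have "\<dots> = exp (12/5)" by (simp flip: exp_of_nat_mult)
  finally have "ln 10 \<le> ln (exp (12/5::real))" by (intro ln_mono) auto
  then show ?thesis by simp
qed

text \<open>Put q = 3 a + ln 10 and let N be the last integer below 1.55 b / q. If 2 N a \<ge> b,
  the hypothesis gives 1.55 b \<le> N q, against the choice of N. Otherwise 5.1 N a \<le> N q + b;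
  times 1.55, with 1.55 b \<le> (N + 1) q, this is N (7.905 a - 2.55 q) \<le> q. Since 7.905 exceeds
  2.55 * 3, it fails for N \<ge> 20 and a \<ge> 71.\<close>

lemma gap_contradiction:
  fixes a b :: real
  assumes a: "a \<ge> 71" and b: "b \<ge> 5/22 + (31/20) ^ 9 * (a - 5/22)"
    and gap: "\<And>N. N \<ge> 2 \<Longrightarrow> (51/20) * min (2 * real N * a) b \<le> real N * ln 10 + 3 * real N * a + b"
  shows False
proof -
  define k where "k = (ln 10 :: real)"
  have k: "0 \<le> k" "k \<le> 12/5" using ln10 by (auto simp: k_def)
  define q where "q = 3 * a + k"
  have q: "q > 0" using a k by (simp add: q_def)
  define z where "z = (31/20) * b / q"
  define N where "N = nat (\<lceil>z\<rceil> - 1)"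
  have "((258/5)::real) \<le> (31/20) ^ 9" by (simp add: eval_nat_numeral)
  then have "(258/5) * (a - 5/22) \<le> (31/20) ^ 9 * (a - 5/22)" using a by (intro mult_right_mono) auto
  then have "(258/5) * (a - 5/22) \<le> b - 5/22" using b by (simp only: le_diff_eq add.commute[of _ "5/22"])
  then have b': "b \<ge> (258/5) * a - 12" using a by simp
  have "20 * q < (31/20) * b" using b' a k by (simp add: q_def)
  then have "20 < z" using q by (simp add: z_def field_simps)
  then have "\<lceil>z\<rceil> > 20" by linarith
  then have N: "real N = of_int \<lceil>z\<rceil> - 1" "N \<ge> 20" unfolding N_def by linarith+
  have "real N < z" "z \<le> real N + 1" using N(1) by linarith+
  moreover have "(31/20) * b = z * q" using q by (simp add: z_def)
  ultimately have up0: "real N * q < (31/20) * b" "(31/20) * b \<le> (real N + 1) * q" using q by simp_all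
  define w where "w = real N * q"
  define y where "y = real N * a"
  have up: "w < (31/20) * b" "(31/20) * b \<le> w + q" using up0 unfolding w_def distrib_right by simp_all
  have "w = real N * k + 3 * real N * a" by (simp add: w_def q_def algebra_simps)
  then have m: "(51/20) * min (2 * y) b \<le> w + b" using gap[of N] N(2) by (simp add: k_def y_def mult.assoc)
  have "2 * y < b"
  proof (rule ccontr)
    assume "\<not> 2 * y < b"
    then have "(51/20) * b \<le> w + b" using m by simp
    then show False using up(1) by linarith
  qed
  then have "(51/20) * (2 * y) \<le> w + b" using m by simp
  then have "(1581/200) * y - (51/20) * w \<le> q" using up(2) by linarith
  then have "real N * ((1581/200) * a - (51/20) * q) \<le> q" by (simp add: w_def y_def algebra_simps)
  moreover have "20 * ((1581/200) * a - (51/20) * q) \<le> real N * ((1581/200) * a - (51/20) * q)"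
    using N(2) a k by (intro mult_right_mono) (auto simp: q_def)
  ultimately have "20 * ((1581/200) * a - (51/20) * q) \<le> q" by linarith
  moreover have "20 * ((1581/200) * a - (51/20) * q) = (51/10) * a - 51 * k"
    by (simp add: q_def field_simps)
  ultimately show False using a k q_def by linarith
qed

text \<open>5/22 is the fixed point of the map from a to 1.55 a - 1/8, so distances from it grow by
  1.55 per step. Among 22 heights from 3/5 upwards, the one with index 12 is at least 71, and nine
  more steps lead into the range excluded by \<open>gap_contradiction\<close>.\<close>

lemma chain_bound:
  fixes T :: "real set"
  assumes low: "\<And>a. a \<in> T \<Longrightarrow> a \<ge> 3/5"
    and gap: "\<And>a b. a \<in> T \<Longrightarrow> b \<in> T \<Longrightarrow> a < b \<Longrightarrow> (31/20) * a - 1/8 \<le> b"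
    and pade: "\<And>a b N. a \<in> T \<Longrightarrow> b \<in> T \<Longrightarrow> a < b \<Longrightarrow> N \<ge> 2 \<Longrightarrow>
       (51/20) * min (2 * real N * a) b \<le> real N * ln 10 + 3 * real N * a + b"
  shows "finite T \<and> card T \<le> 21"
proof (rule ccontr)
  assume "\<not> ?thesis"
  then have "infinite T \<or> card T \<ge> 22" by auto
  then obtain Z where Z: "Z \<subseteq> T" "finite Z" "card Z = 22"
    using infinite_arbitrarily_large[of T 22] obtain_subset_with_card_n[of 22 T] by metis
  define l where "l = sorted_list_of_set Z"
  have l: "sorted_wrt (<) l" "length l = 22" "set l = Z" using Z by (auto simp: l_def)
  have lt: "l ! i < l ! j" if "i < j" "j < 22" for i j using sorted_wrt_nth_less[OF l(1)] that l(2) by auto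
  have inT: "l ! i \<in> T" if "i < 22" for i using that l Z by (metis nth_mem subsetD)
  have step: "(31/20) * (l ! i - 5/22) \<le> l ! (Suc i) - 5/22" if "Suc i < 22" for i
    using gap[OF inT inT lt[of i "Suc i"]] that by simp
  have pow: "(31/20) ^ n * (l ! i - 5/22) \<le> l ! (i + n) - 5/22" if "i + n < 22" for i n
    using that
  proof (induction n)
    case (Suc n)
    have "(31/20) * ((31/20) ^ n * (l ! i - 5/22)) \<le> (31/20) * (l ! (i + n) - 5/22)"
      using Suc by (intro mult_left_mono) auto
    also have "(31/20) * (l ! (i + n) - 5/22) \<le> l ! (i + Suc n) - 5/22" using step[of "i + n"] Suc.prems by simp
    finally show ?case by (simp only: power_Suc mult.assoc)
  qed simp
  have "(192::real) * (3/5 - 5/22) \<le> (31/20) ^ 12 * (l ! 0 - 5/22)"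
  proof (rule mult_mono)
    show "(192::real) \<le> (31/20) ^ 12" by (simp add: eval_nat_numeral)
  qed (use low[OF inT[of 0]] in auto)
  then have a: "l ! 12 \<ge> 71" using pow[of 0 12] by simp
  moreover have "l ! 21 \<ge> 5/22 + (31/20) ^ 9 * (l ! 12 - 5/22)" using pow[of 12 9] by simp
  ultimately show False
    by (rule gap_contradiction) (rule pade[OF inT inT lt], simp_all)
qed

section \<open>Counting level vectors\<close>

lemma binomial_mode_bound:
  assumes "n \<ge> 12"
  shows "real (n choose k) \<le> (593/2000) * 5 ^ k * (6/5) ^ n"
  using assms
proof (induction n arbitrary: k rule: dec_induct)
  \<comment> \<open>After division by \<open>5 ^ k * (6/5) ^ n\<close> the claim bounds the weights
    of the binomial distribution with success probability 1/6. The constant lies just above the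
    largest weight for n = 12, attained at k = 2.\<close>
  case base
  show ?case
  proof (cases "k \<le> 12")
    case True
    then have "k = 0 \<or> k = 1 \<or> k = 2 \<or> k = 3 \<or> k = 4 \<or> k = 5 \<or> k = 6 \<or> k = 7 \<or> k = 8 \<or> k = 9
       \<or> k = 10 \<or> k = 11 \<or> k = 12" by arith
    then show ?thesis by (elim disjE) (simp_all add: eval_nat_numeral)
  qed (simp add: binomial_eq_0)
next
  case (step n)
  show ?case
  proof (cases k)
    case 0
    have "1 \<le> ((593/2000) * 5 ^ 0 * (6/5) ^ n :: real)" using step.IH[of 0] by simp
    then show ?thesis using 0 by simp
  next
    case (Suc j)
    have "real (Suc n choose k) = real (n choose j) + real (n choose Suc j)" by (simp add: Suc)
    also have "\<dots> \<le> (593/2000) * 5 ^ j * (6/5) ^ n + (593/2000) * 5 ^ Suc j * (6/5) ^ n"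
      using step.IH by (intro add_mono)
    also have "\<dots> = (593/2000) * 5 ^ k * (6/5) ^ Suc n" by (simp add: Suc)
    finally show ?thesis .
  qed
qed

text \<open>The least \<open>n\<close> with \<open>2.55 * (n + s) \<le> 3 * n\<close>: rounding the proportions down to multiples of
  \<open>1 / (n + s)\<close> keeps a share of at least \<open>2.55 / 3\<close>.\<close>

definition total_level :: "nat \<Rightarrow> nat" where "total_level s = (17 * s + 2) div 3"

text \<open>Three more places add exactly 17 levels, and (6/5)^17 \<le> (45/16)^3. The factor
  113/100 covers the rounding in the three initial cases.\<close>

lemma total_level_growth: "s \<ge> 2 \<Longrightarrow> (6/5) ^ total_level s \<le> ((113/100) * (45/16) ^ s :: real)"
proof (induction s rule: less_induct)
  case (less s)
  consider "s = 2" | "s = 3" | "s = 4" | "s \<ge> 5" using less.prems by linarith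
  then show ?case
  proof cases
    case 4
    define r where "r = s - 3"
    then have r: "s = r + 3" "r \<ge> 2" using 4 by simp_all
    have "total_level s = total_level r + 17" by (simp add: total_level_def r)
    then have "(6/5::real) ^ total_level s = (6/5) ^ total_level r * (6/5) ^ 17" by (simp add: power_add)
    also have "\<dots> \<le> ((113/100) * (45/16) ^ r) * (45/16) ^ 3"
      using less.IH[of r] r by (intro mult_mono) (auto simp: power_divide)
    also have "\<dots> = (113/100) * (45/16) ^ s" by (simp add: r power_add)
    finally show ?thesis .
  qed (simp_all add: total_level_def power_divide)
qed

text \<open>\<open>binomial_functional p n\<close> is the linear functional sending \<open>X ^ k\<close> to \<open>n choose k\<close>: compositions of at most
  \<open>n\<close> with support of size \<open>k\<close> are counted by \<open>n choose k\<close>.\<close>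

definition binomial_functional :: "real poly \<Rightarrow> nat \<Rightarrow> real" where
  "binomial_functional p n = (\<Sum>k\<le>degree p. coeff p k * real (n choose k))"

lemma binomial_functional_alt: "degree p \<le> d \<Longrightarrow> binomial_functional p n = (\<Sum>k\<le>d. coeff p k * real (n choose k))"
  unfolding binomial_functional_def by (rule sum.mono_neutral_left) (auto simp: coeff_eq_0)

text \<open>By the hockey-stick identity, multiplication by X turns into summation over all smaller
  arguments.\<close>

lemma binomial_functional_step:
  "binomial_functional ([:a, b:] * p) n = a * binomial_functional p n + b * (\<Sum>j<n. binomial_functional p j)"
proof -
  define d where "d = degree p"
  have dg: "degree ([:a, b:] * p) \<le> Suc d" by (rule order.trans[OF degree_mult_le]) (simp add: d_def)
  have co: "coeff ([:a, b:] * p) k = a * coeff p k + b * (if k = 0 then 0 else coeff p (k - 1))" for k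
    by (cases k) auto
  have hs: "(\<Sum>j<n. real (j choose k)) = real (n choose Suc k)" for k
    by (induction n) auto
  have "binomial_functional ([:a, b:] * p) n = (\<Sum>k\<le>Suc d. (a * coeff p k + b * (if k = 0 then 0 else coeff p (k - 1))) * real (n choose k))"
    unfolding binomial_functional_alt[OF dg] co ..
  also have "\<dots> = a * (\<Sum>k\<le>Suc d. coeff p k * real (n choose k))
     + b * (\<Sum>k\<le>Suc d. (if k = 0 then 0 else coeff p (k - 1)) * real (n choose k))"
    by (simp only: distrib_right sum.distrib sum_distrib_left mult.assoc)
  also have "(\<Sum>k\<le>Suc d. coeff p k * real (n choose k)) = binomial_functional p n"
    by (rule binomial_functional_alt[symmetric]) (simp add: d_def)
  also have "(\<Sum>k\<le>Suc d. (if k = 0 then 0 else coeff p (k - 1)) * real (n choose k))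
     = (\<Sum>k\<le>d. coeff p k * real (n choose Suc k))"
    by (subst sum.atMost_Suc_shift) simp
  also have "\<dots> = (\<Sum>k\<le>d. \<Sum>j<n. coeff p k * real (j choose k))"
    by (simp add: hs[symmetric] sum_distrib_left)
  also have "\<dots> = (\<Sum>j<n. binomial_functional p j)" unfolding binomial_functional_def d_def by (rule sum.swap)
  finally show ?thesis .
qed

definition level_types :: "('v \<Rightarrow> nat \<Rightarrow> 't set) \<Rightarrow> 'v set \<Rightarrow> nat \<Rightarrow> ('v \<Rightarrow> nat \<times> 't) set" where
  "level_types T V n = {\<phi>. \<phi> \<in> extensional V \<and> (\<forall>v\<in>V. snd (\<phi> v) \<in> T v (fst (\<phi> v))) \<and> (\<Sum>v\<in>V. fst (\<phi> v)) \<le> n}"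

text \<open>At a new place, level 0 keeps the budget \<open>n\<close> and the positive levels leave
  the budgets from 0 to n - 1, one each. This is the recursion of
  \<open>binomial_functional_step\<close> for one more linear factor.\<close>

lemma card_level_types:
  fixes T :: "'v \<Rightarrow> nat \<Rightarrow> 't set" and c0 c1 :: "'v \<Rightarrow> real"
  assumes V: "finite V" and T: "\<And>v g. v \<in> V \<Longrightarrow> finite (T v g)"
    and c0: "\<And>v. v \<in> V \<Longrightarrow> real (card (T v 0)) \<le> c0 v"
    and c1: "\<And>v g. v \<in> V \<Longrightarrow> g > 0 \<Longrightarrow> real (card (T v g)) \<le> c1 v"
  shows "finite (level_types T V n) \<and> real (card (level_types T V n)) \<le> binomial_functional (\<Prod>v\<in>V. [:c0 v, c1 v:]) n"
  using assms
proof (induction V arbitrary: n rule: finite_induct)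
  case empty
  have "level_types T {} n = {\<lambda>_. undefined}" by (auto simp: level_types_def)
  then show ?case by (simp add: binomial_functional_def)
next
  case (insert v V)
  have IH: "finite (level_types T V n) \<and> real (card (level_types T V n)) \<le> binomial_functional (\<Prod>v\<in>V. [:c0 v, c1 v:]) n" for n
    using insert by auto
  let ?p = "\<Prod>v\<in>V. [:c0 v, c1 v:]"
  have c0: "real (card (T v 0)) \<le> c0 v" and c1: "\<And>g. g > 0 \<Longrightarrow> real (card (T v g)) \<le> c1 v"
    and fT: "\<And>g. finite (T v g)" using insert.prems by auto
  have c1nn: "0 \<le> c1 v" using c1[of 1] by (auto intro: order.trans[rotated])
  have bnn: "0 \<le> binomial_functional ?p j" for j using IH[of j] by (auto intro: order.trans[rotated])
  define ext where "ext j = (\<lambda>(t, \<phi>). \<phi>(v := (j, t))) ` (T v j \<times> level_types T V (n - j))" for j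
  have sub: "level_types T (insert v V) n \<subseteq> (\<Union>j\<le>n. ext j)"
  proof
    fix \<phi> assume \<phi>: "\<phi> \<in> level_types T (insert v V) n"
    define j t where "j = fst (\<phi> v)" and "t = snd (\<phi> v)"
    have sum: "j + (\<Sum>v\<in>V. fst (\<phi> v)) \<le> n" using \<phi> insert.hyps by (simp add: level_types_def j_def)
    have "(\<Sum>w\<in>V. fst ((\<phi>(v := undefined)) w)) = (\<Sum>w\<in>V. fst (\<phi> w))"
      using insert.hyps by (intro sum.cong) auto
    then have "\<phi>(v := undefined) \<in> level_types T V (n - j)"
      using \<phi> sum insert.hyps by (auto simp: level_types_def extensional_def)
    moreover have "t \<in> T v j" using \<phi> by (auto simp: level_types_def j_def t_def)
    moreover have "\<phi> = (\<phi>(v := undefined))(v := (j, t))" by (auto simp: j_def t_def)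
    ultimately have "\<phi> \<in> ext j" unfolding ext_def by (intro image_eqI[of _ _ "(t, \<phi>(v := undefined))"]) auto
    then show "\<phi> \<in> (\<Union>j\<le>n. ext j)" using sum by auto
  qed
  have fext: "finite (ext j)" for j using fT IH by (auto simp: ext_def)
  have cext: "real (card (ext j)) \<le> real (card (T v j)) * binomial_functional ?p (n - j)" for j
  proof -
    have "card (ext j) \<le> card (T v j \<times> level_types T V (n - j))"
      unfolding ext_def using fT IH by (intro card_image_le) auto
    then have "real (card (ext j)) \<le> real (card (T v j)) * real (card (level_types T V (n - j)))"
      by (simp add: card_cartesian_product flip: of_nat_mult)
    also have "\<dots> \<le> real (card (T v j)) * binomial_functional ?p (n - j)" using IH by (intro mult_left_mono) auto
    finally show ?thesis .
  qed
  have fin: "finite (level_types T (insert v V) n)" using sub fext by (auto intro: finite_subset)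
  have "card (level_types T (insert v V) n) \<le> card (\<Union>j\<le>n. ext j)" using sub fext by (intro card_mono) auto
  also have "\<dots> \<le> (\<Sum>j\<le>n. card (ext j))" by (rule card_UN_le) simp
  finally have "real (card (level_types T (insert v V) n)) \<le> (\<Sum>j\<le>n. real (card (ext j)))"
    by (simp flip: of_nat_sum)
  also have "\<dots> \<le> (\<Sum>j\<le>n. (if j = 0 then c0 v else c1 v) * binomial_functional ?p (n - j))"
  proof (rule sum_mono)
    fix j
    have "real (card (T v j)) \<le> (if j = 0 then c0 v else c1 v)" using c0 c1[of j] by auto
    then show "real (card (ext j)) \<le> (if j = 0 then c0 v else c1 v) * binomial_functional ?p (n - j)"
      using mult_right_mono[OF _ bnn[of "n - j"]] cext[of j] by (meson order.trans)
  qed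
  also have "\<dots> = c0 v * binomial_functional ?p n + c1 v * (\<Sum>j<n. binomial_functional ?p j)"
  proof -
    have "{..n} = insert 0 {1..n}" by auto
    then have "(\<Sum>j\<le>n. (if j = 0 then c0 v else c1 v) * binomial_functional ?p (n - j))
       = c0 v * binomial_functional ?p n + (\<Sum>j\<in>{1..n}. c1 v * binomial_functional ?p (n - j))" by simp
    also have "(\<Sum>j\<in>{1..n}. c1 v * binomial_functional ?p (n - j)) = (\<Sum>j<n. c1 v * binomial_functional ?p j)"
      by (rule sum.reindex_bij_witness[of _ "\<lambda>j. n - j" "\<lambda>j. n - j"]) auto
    finally show ?thesis by (simp add: sum_distrib_left)
  qed
  also have "\<dots> = binomial_functional (\<Prod>v\<in>insert v V. [:c0 v, c1 v:]) n"
    using insert.hyps by (simp add: binomial_functional_step del: mult_pCons_left)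
  finally show ?case using fin by blast
qed

lemma coeff_prod_nonneg:
  assumes "\<And>v. v \<in> V \<Longrightarrow> 0 \<le> c0 v \<and> 0 \<le> (c1 v :: real)"
  shows "0 \<le> coeff (\<Prod>v\<in>V. [:c0 v, c1 v:]) k"
  using assms
proof (induction V arbitrary: k rule: infinite_finite_induct)
  case (insert v V)
  have "0 \<le> c0 v" "0 \<le> c1 v" "\<And>k. 0 \<le> coeff (\<Prod>v\<in>V. [:c0 v, c1 v:]) k" using insert by auto
  then show ?case using insert.hyps by (cases k) auto
qed (auto simp: coeff_eq_0 split: nat.splits)

text \<open>Bounding \<open>n choose k\<close> by a multiple of \<open>5 ^ k\<close> turns the
  functional into evaluation at 5. Two places guarantee at least 12 levels, and 593/2000 * 113/100
  \<le> 42/125.\<close>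

lemma card_level_types_bound:
  fixes T :: "'v \<Rightarrow> nat \<Rightarrow> 't set" and c0 c1 :: "'v \<Rightarrow> real"
  assumes V: "finite V" "card V \<ge> 2" and T: "\<And>v g. v \<in> V \<Longrightarrow> finite (T v g)"
    and c0: "\<And>v. v \<in> V \<Longrightarrow> real (card (T v 0)) \<le> c0 v"
    and c1: "\<And>v g. v \<in> V \<Longrightarrow> g > 0 \<Longrightarrow> real (card (T v g)) \<le> c1 v"
  shows "finite (level_types T V (total_level (card V)))"
    "real (card (level_types T V (total_level (card V)))) \<le> (42/125) * (\<Prod>v\<in>V. 45/16 * (c0 v + 5 * c1 v))"
proof -
  let ?n = "total_level (card V)" and ?p = "\<Prod>v\<in>V. [:c0 v, c1 v:]"
  have "finite (level_types T V ?n) \<and> real (card (level_types T V ?n)) \<le> binomial_functional ?p ?n"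
    by (rule card_level_types) (use assms in auto)
  then have fin: "finite (level_types T V ?n)" and le: "real (card (level_types T V ?n)) \<le> binomial_functional ?p ?n" by auto
  show "finite (level_types T V ?n)" by (rule fin)
  have nn: "0 \<le> c0 v \<and> 0 \<le> c1 v" if "v \<in> V" for v
    using c0[OF that] c1[OF that, of 1] by (auto intro: order.trans[rotated])
  have n12: "?n \<ge> 12" using V(2) by (simp add: total_level_def)
  have P: "0 \<le> poly ?p 5" unfolding poly_prod using nn by (intro prod_nonneg) auto
  note le
  also have "binomial_functional ?p ?n \<le> (\<Sum>k\<le>degree ?p. coeff ?p k * ((593/2000) * 5 ^ k * (6/5) ^ ?n))"
    unfolding binomial_functional_def using coeff_prod_nonneg[of V c0 c1] nn
    by (intro sum_mono mult_left_mono binomial_mode_bound n12) auto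
  also have "\<dots> = (593/2000) * (6/5) ^ ?n * poly ?p 5"
    by (simp add: poly_altdef sum_distrib_left mult_ac)
  also have "\<dots> \<le> (593/2000) * ((113/100) * (45/16) ^ card V) * poly ?p 5"
    using total_level_growth[OF V(2)] P by (intro mult_right_mono mult_left_mono) auto
  also have "\<dots> \<le> (42/125) * ((45/16) ^ card V * poly ?p 5)" using P by simp
  also have "(45/16) ^ card V * poly ?p 5 = (\<Prod>v\<in>V. 45/16 * (c0 v + 5 * c1 v))"
  proof -
    have "poly ?p 5 = (\<Prod>v\<in>V. c0 v + 5 * c1 v)" by (simp add: poly_prod)
    then show ?thesis by (simp only: prod.distrib prod_constant)
  qed
  finally show "real (card (level_types T V ?n)) \<le> (42/125) * (\<Prod>v\<in>V. 45/16 * (c0 v + 5 * c1 v))" .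
qed

section \<open>The weighted unit equation\<close>

lemma min_abs_comp: "min_abs (\<lambda>z. cmod (e z)) x = min_abs cmod (\<lambda>i. e (x i))"
  "argmin_abs (\<lambda>z. cmod (e z)) x = argmin_abs cmod (\<lambda>i. e (x i))"
  "ln_min (\<lambda>z. cmod (e z)) x = ln_min cmod (\<lambda>i. e (x i))"
  "ln_mean (\<lambda>z. cmod (e z)) x = ln_mean cmod (\<lambda>i. e (x i))"
  by (simp_all add: min_abs_def argmin_abs_def ln_min_def ln_mean_def)

text \<open>The rounded proportions may add up to more than \<open>n\<close>. Lowering them by
  single units stops exactly at \<open>n\<close>, so nothing of the required share is lost.\<close>

lemma exists_sum_truncation:
  fixes g :: "'v \<Rightarrow> nat"
  assumes "finite V"
  shows "\<exists>g'. (\<forall>v\<in>V. g' v \<le> g v) \<and> sum g' V \<le> n \<and> (sum g' V = n \<or> g' = g)"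
  using assms
proof (induction "sum g V" arbitrary: g rule: less_induct)
  case less
  show ?case
  proof (cases "sum g V \<le> n")
    case True then show ?thesis by (intro exI[of _ g]) auto
  next
    case False
    then have "sum g V \<noteq> 0" by simp
    then obtain v where v: "v \<in> V" "g v > 0" using sum_eq_0_iff[OF less.prems, of g] by auto
    define k where "k = g(v := g v - 1)"
    have s: "sum g V = Suc (sum k V)"
    proof -
      have "sum g V = g v + sum g (V - {v})" using v less.prems by (simp add: sum.remove)
      moreover have "sum k V = k v + sum k (V - {v})" using v less.prems by (simp add: sum.remove)
      moreover have "sum k (V - {v}) = sum g (V - {v})" by (rule sum.cong) (auto simp: k_def)
      ultimately show ?thesis using v(2) by (simp add: k_def)
    qed
    then have "sum k V < sum g V" by simp
    from less.hyps[OF this less.prems] obtain g' where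
      g': "\<forall>v\<in>V. g' v \<le> k v" "sum g' V \<le> n" "sum g' V = n \<or> g' = k" by blast
    have 1: "\<forall>u\<in>V. g' u \<le> g u"
    proof
      fix u assume "u \<in> V"
      then have "g' u \<le> k u" using g'(1) by blast
      also have "k u \<le> g u" by (simp add: k_def)
      finally show "g' u \<le> g u" .
    qed
    have 2: "sum g' V = n"
    proof (cases "sum g' V = n")
      case False
      then have "sum k V \<le> n" using g'(2,3) by blast
      then show ?thesis using s \<open>\<not> sum g V \<le> n\<close> g'(3) False by (metis le_SucE le_antisym not_less_eq_eq)
    qed
    show ?thesis by (intro exI[of _ g'] conjI disjI1 1 2) (simp add: 2)
  qed
qed

text \<open>Here \<open>V\<close> and \<open>A\<close> index the places in \<open>S\<close> and the archimedean ones, \<open>f\<close> their absolute values,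
  \<open>w\<close> the weights, and \<open>Out\<close> the absolute values at the remaining places, where all solution triples
  \<open>X\<close> look alike and contribute the constants \<open>c0\<close> and \<open>c1\<close> to the sums of \<open>ln_min\<close> and \<open>ln_mean\<close>.\<close>

locale unit_equation =
  fixes V A :: "'v set" and f :: "'v \<Rightarrow> 'k::field_char_0 \<Rightarrow> real" and emb :: "'v \<Rightarrow> 'k \<Rightarrow> complex"
    and real_place :: "'v \<Rightarrow> bool" and w :: "'v \<Rightarrow> real" and X :: "(nat \<Rightarrow> 'k) set"
    and c0 c1 :: real and Out :: "('k \<Rightarrow> real) set"
  assumes finV: "finite V" and cardV: "card V \<ge> 2" and AV: "A \<subseteq> V"
    and w_pos: "v \<in> V \<Longrightarrow> w v > 0" and w_sum: "sum w A = 1"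
    and arch: "v \<in> A \<Longrightarrow> f v = (\<lambda>z. cmod (emb v z))"
    and emb_add: "v \<in> A \<Longrightarrow> emb v (z + z') = emb v z + emb v z'"
    and emb_mult: "v \<in> A \<Longrightarrow> emb v (z * z') = emb v z * emb v z'"
    and emb_zero: "v \<in> A \<Longrightarrow> emb v z = 0 \<longleftrightarrow> z = 0"
    and emb_real: "v \<in> A \<Longrightarrow> real_place v \<Longrightarrow> Im (emb v z) = 0"
    and nonarch: "v \<in> V - A \<Longrightarrow> ultra (f v)"
    and out_ultra: "g \<in> Out \<Longrightarrow> ultra g"
    and out_const: "g \<in> Out \<Longrightarrow> x \<in> X \<Longrightarrow> y \<in> X \<Longrightarrow> i < 3 \<Longrightarrow> g (x i) = g (y i)"
    and zero_sum_triple: "x \<in> X \<Longrightarrow> zero_sum_triple x"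
    and cross_nz: "x \<in> X \<Longrightarrow> y \<in> X \<Longrightarrow> x \<noteq> y \<Longrightarrow> cross x y \<noteq> 0"
    and c01: "c0 \<le> c1"
    and height: "x \<in> X \<Longrightarrow> (\<Sum>v\<in>V. w v * ln_min (f v) x) + c0 = -2 * ((\<Sum>v\<in>V. w v * ln_mean (f v) x) + c1)"
    and product: "D \<noteq> 0 \<Longrightarrow> (\<And>g x. g \<in> Out \<Longrightarrow> x \<in> X \<Longrightarrow> ln (g D) \<le> real r * ln_mean g x + ln_min g x) \<Longrightarrow>
       0 \<le> (\<Sum>v\<in>V. w v * ln (f v D)) + real r * c1 + c0"
begin

definition h :: "(nat \<Rightarrow> 'k) \<Rightarrow> real" where "h x = (\<Sum>v\<in>V. w v * ln_mean (f v) x) + c1"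

definition a :: "'v \<Rightarrow> (nat \<Rightarrow> 'k) \<Rightarrow> real" where "a v x = w v * (ln_mean (f v) x - ln_min (f v) x)"

lemma emb_diff: "v \<in> A \<Longrightarrow> emb v (x - y) = emb v x - emb v y"
  using emb_add[of v "x - y" y] by simp

lemma zero_sum_triple_emb:
  assumes "v \<in> A" "x \<in> X"
  shows "zero_sum_triple (\<lambda>i. emb v (x i))"
proof -
  have "emb v (x 0) + emb v (x 1) + emb v (x 2) = emb v (x 0 + x 1 + x 2)" by (simp only: emb_add[OF assms(1)])
  then show ?thesis using zero_sum_triple[OF assms(2)] emb_zero[OF assms(1)] by (simp add: zero_sum_triple_def)
qed

lemma cross_emb: "v \<in> A \<Longrightarrow> emb v (cross x y) = cross (\<lambda>i. emb v (x i)) (\<lambda>i. emb v (y i))"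
  by (simp only: cross_def emb_diff emb_mult)

lemma fabs: "v \<in> V \<Longrightarrow> absolute_value (f v)"
proof (cases "v \<in> A")
  case True
  then show ?thesis using norm_triangle_ineq
    by (auto simp: absolute_value_def arch emb_add emb_mult emb_zero norm_mult)
next
  case False
  then show "v \<in> V \<Longrightarrow> absolute_value (f v)" using nonarch ultraD(1) by blast
qed

lemma a_nonneg: "v \<in> V \<Longrightarrow> x \<in> X \<Longrightarrow> a v x \<ge> 0"
  using ln_min_le_ln_mean[OF fabs zero_sum_triple] w_pos by (simp add: a_def less_imp_le)

lemma sum_a: "x \<in> X \<Longrightarrow> (\<Sum>v\<in>V. a v x) + (c1 - c0) = 3 * h x"
  using height[of x] by (simp add: a_def h_def right_diff_distrib sum_subtractf)

lemma out_same:
  assumes "g \<in> Out" "x \<in> X" "y \<in> X"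
  shows "ln_mean g x = ln_mean g y" "ln_min g x = ln_min g y" "argmin_abs g x = argmin_abs g y"
  using out_const[OF assms, of 0] out_const[OF assms, of 1] out_const[OF assms, of 2]
  by (simp_all add: ln_mean_def ln_min_def min_abs_def argmin_abs_def)

section \<open>Levels, types and classes of solutions\<close>

definition n :: nat where "n = total_level (card V)"
definition T :: real where "T = real n + real (card V)"

lemma T_pos: "T > 0" using cardV by (simp add: T_def)

lemma n_T: "51/20 * T \<le> 3 * real n"
proof -
  have "3 * n \<ge> 17 * card V" by (simp add: n_def total_level_def)
  then have "3 * real n \<ge> 17 * real (card V)" by linarith
  then show ?thesis by (simp add: T_def)
qed

definition raw_level :: "(nat \<Rightarrow> 'k) \<Rightarrow> 'v \<Rightarrow> nat" where "raw_level x v = nat \<lfloor>T * a v x / (3 * h x)\<rfloor>"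

definition level :: "(nat \<Rightarrow> 'k) \<Rightarrow> 'v \<Rightarrow> nat" where
  "level x = (SOME g'. (\<forall>v\<in>V. g' v \<le> raw_level x v) \<and> sum g' V \<le> n \<and> (sum g' V = n \<or> g' = raw_level x))"

lemma level: "\<forall>v\<in>V. level x v \<le> raw_level x v" "sum (level x) V \<le> n" "sum (level x) V = n \<or> level x = raw_level x"
  using someI_ex[OF exists_sum_truncation[OF finV, of "raw_level x" n]] unfolding level_def by blast+

text \<open>At a nonarchimedean place of level 0 no saving is claimed, so the position is not
  recorded; the place then has one type instead of three.\<close>

definition place_type :: "(nat \<Rightarrow> 'k) \<Rightarrow> 'v \<Rightarrow> nat \<times> nat" where
  "place_type x v = (if v \<in> A then (argmin_abs (f v) x, sector (ratio (\<lambda>i. emb v (x i))))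
     else if level x v = 0 then (0, 0) else (argmin_abs (f v) x, 0))"

definition solution_class :: "(nat \<Rightarrow> 'k) \<Rightarrow> 'v \<Rightarrow> nat \<times> nat \<times> nat" where
  "solution_class x = restrict (\<lambda>v. (level x v, place_type x v)) V"

definition type_set :: "'v \<Rightarrow> nat \<Rightarrow> (nat \<times> nat) set" where
  "type_set v g = (if v \<in> A then {0..<3} \<times> {0..<(if real_place v then 2 else 6)}
     else if g = 0 then {(0, 0)} else {0..<3} \<times> {0})"

lemma ratio_real:
  assumes "v \<in> A" "real_place v"
  shows "Im (ratio (\<lambda>i. emb v (x i))) = 0"
proof -
  have "Im (z / z') = 0" if "Im z = 0" "Im z' = 0" for z z' using that by (simp add: Im_divide)
  then show ?thesis using emb_real[OF assms] by (simp add: ratio_def Let_def)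
qed

lemma solution_class_mem: "solution_class x \<in> level_types type_set V n"
proof -
  have "(\<Sum>v\<in>V. fst (solution_class x v)) = sum (level x) V" by (rule sum.cong) (auto simp: solution_class_def)
  moreover have "place_type x v \<in> type_set v (level x v)" for v
    using sector_less ratio_real argmin_abs_less by (auto simp: place_type_def type_set_def)
  ultimately show ?thesis using level(2) by (auto simp: level_types_def solution_class_def)
qed

lemma solution_class_eqD:
  assumes "solution_class x = solution_class y" "v \<in> V"
  shows "level x v = level y v" "place_type x v = place_type y v"
  using fun_cong[OF assms(1), of v] assms(2) by (auto simp: solution_class_def)

lemma a_ge:
  assumes "x \<in> X" "v \<in> V" "h x > 0"
  shows "a v x \<ge> 3 * h x * (real (level x v) / T)"
proof -
  have nn: "0 \<le> T * a v x / (3 * h x)" using a_nonneg[OF assms(2,1)] T_pos assms(3) by simp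
  have "real (level x v) \<le> real (raw_level x v)" using level(1) assms(2) by simp
  also have "\<dots> \<le> T * a v x / (3 * h x)" using nn by (simp add: raw_level_def)
  finally show ?thesis using T_pos assms(3) by (simp add: field_simps)
qed

text \<open>If truncation took place, the levels add up to \<open>n\<close>. If not, they fall short
  of \<open>n\<close> only as far as part of the total \<open>3 * h y\<close> lies outside
  \<open>V\<close>, and that part is \<open>c1 - c0\<close>. By \<open>n_T\<close>, \<open>n\<close>
  levels are worth 2.55 M.\<close>

lemma class_sum:
  assumes y: "y \<in> X" "h y > 0" and M: "0 \<le> M" "M \<le> h y"
  shows "51/20 * M \<le> (\<Sum>v\<in>V. 3 * M * (real (level y v) / T)) + (c1 - c0)"
proof -
  define G where "G = real (sum (level y) V)"
  have s: "(\<Sum>v\<in>V. 3 * M * (real (level y v) / T)) = 3 * M * (G / T)"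
    by (simp add: G_def sum_distrib_left[symmetric] sum_divide_distrib[symmetric])
  have "3 * M * ((real n - G) / T) \<le> c1 - c0"
  proof (cases "level y = raw_level y")
    case True
    have "a v y \<le> 3 * h y * ((real (level y v) + 1) / T)" if "v \<in> V" for v
    proof -
      have "T * a v y / (3 * h y) \<le> real (level y v) + 1" unfolding True raw_level_def by linarith
      then show ?thesis using T_pos y(2) by (simp add: field_simps)
    qed
    then have "(\<Sum>v\<in>V. a v y) \<le> (\<Sum>v\<in>V. 3 * h y * ((real (level y v) + 1) / T))" by (rule sum_mono)
    also have "\<dots> = 3 * h y * ((G + real (card V)) / T)"
      by (simp add: G_def sum_distrib_left[symmetric] sum_divide_distrib[symmetric] sum.distrib)
    finally have *: "3 * h y - (c1 - c0) \<le> 3 * h y * ((G + real (card V)) / T)" using sum_a[OF y(1)] by linarith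
    define q where "q = (real n - G) / T"
    have "(G + real (card V)) / T = 1 - q" using T_pos by (simp add: T_def q_def field_simps)
    from *[unfolded this] have "h y * (3 * q) \<le> c1 - c0" by (simp add: algebra_simps)
    moreover have "M * (3 * q) \<le> h y * (3 * q)"
      using M level(2)[of y] T_pos by (intro mult_right_mono) (auto simp: G_def q_def simp flip: of_nat_sum)
    ultimately show ?thesis by (simp add: q_def[symmetric] mult_ac)
  next
    case False
    then have "real n - G = 0" using level(3)[of y] by (simp add: G_def)
    then show ?thesis using c01 by simp
  qed
  moreover have "51/20 * M \<le> 3 * M * (real n / T)"
  proof -
    have "51/20 \<le> 3 * (real n / T)" using n_T T_pos by (simp add: field_simps)
    then have "51/20 * M \<le> 3 * (real n / T) * M" using M by (intro mult_right_mono) auto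
    then show ?thesis by (simp add: mult_ac)
  qed
  moreover have "3 * M * (real n / T) = 3 * M * (G / T) + 3 * M * ((real n - G) / T)"
    by (simp add: diff_divide_distrib right_diff_distrib)
  ultimately show ?thesis unfolding s by linarith
qed

text \<open>Common core of \<open>gap\<close> and \<open>pade_gap\<close>: \<open>D\<close> is a
  determinant of degree \<open>r\<close> in \<open>x\<close> and 1 in \<open>y\<close>,
  \<open>\<alpha>\<close> the power of the smallest coordinate of \<open>x\<close> in it, and
  \<open>\<kappa>\<close> the archimedean loss, counted once since the weights on \<open>A\<close>
  sum to 1. The local savings, bounded below by the common levels, are added up by
  \<open>class_sum\<close>.\<close>

lemma class_inequality:
  assumes x: "x \<in> X" "h x > 0" and y: "y \<in> X" "h y > 0" and solution_class: "solution_class x = solution_class y" and D: "D \<noteq> 0"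
    and \<alpha>: "\<alpha> \<ge> 0" and \<kappa>: "\<kappa> \<ge> 0"
    and A1: "\<And>v. v \<in> A \<Longrightarrow> argmin_abs (f v) x = argmin_abs (f v) y \<Longrightarrow> sector (ratio (\<lambda>i. emb v (x i))) = sector (ratio (\<lambda>i. emb v (y i))) \<Longrightarrow>
       ln (f v D) \<le> \<kappa> + real r * ln_mean (f v) x + ln_mean (f v) y - min (\<alpha> * (ln_mean (f v) x - ln_min (f v) x)) (ln_mean (f v) y - ln_min (f v) y)"
    and N1: "\<And>g. ultra g \<Longrightarrow> ln (g D) \<le> real r * ln_mean g x + ln_mean g y"
    and N2: "\<And>g. ultra g \<Longrightarrow> argmin_abs g x = argmin_abs g y \<Longrightarrow>
       ln (g D) \<le> real r * ln_mean g x + ln_mean g y - min (\<alpha> * (ln_mean g x - ln_min g x)) (ln_mean g y - ln_min g y)"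
    and \<alpha>1: "\<alpha> \<ge> 1"
  shows "51/20 * min (\<alpha> * h x) (h y) \<le> \<kappa> + real r * h x + h y"
proof -
  define M where "M = min (\<alpha> * h x) (h y)"
  have M: "0 \<le> M" "M \<le> h y" "M \<le> \<alpha> * h x" using x y \<alpha> by (auto simp: M_def)
  have loc: "w v * ln (f v D) \<le> (if v \<in> A then w v * \<kappa> else 0) + real r * (w v * ln_mean (f v) x) + w v * ln_mean (f v) y - 3 * M * (real (level y v) / T)"
    if v: "v \<in> V" for v
  proof -
    have wv: "w v > 0" using w_pos v by auto
    have gT: "real (level y v) / T \<ge> 0" using T_pos by simp
    have "3 * M * (real (level y v) / T) \<le> 3 * (\<alpha> * h x) * (real (level y v) / T)"
      using M gT by (intro mult_right_mono) auto
    also have "\<dots> \<le> \<alpha> * a v x"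
      using mult_left_mono[OF a_ge[OF x(1) v x(2)] \<alpha>] solution_class_eqD(1)[OF solution_class v] by (simp add: mult_ac)
    finally have mx: "3 * M * (real (level y v) / T) \<le> w v * (\<alpha> * (ln_mean (f v) x - ln_min (f v) x))" by (simp add: a_def mult_ac)
    have "3 * M * (real (level y v) / T) \<le> 3 * h y * (real (level y v) / T)"
      using M gT by (intro mult_right_mono) auto
    also have "\<dots> \<le> w v * (ln_mean (f v) y - ln_min (f v) y)" using a_ge[OF y(1) v y(2)] by (simp add: a_def)
    finally have my: "3 * M * (real (level y v) / T) \<le> w v * (ln_mean (f v) y - ln_min (f v) y)" .
    have mm: "3 * M * (real (level y v) / T) \<le> w v * min (\<alpha> * (ln_mean (f v) x - ln_min (f v) x)) (ln_mean (f v) y - ln_min (f v) y)"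
      using mx my by (auto simp: min_def)
    note t = solution_class_eqD(2)[OF solution_class v]
    consider (a) "v \<in> A" | (b) "v \<notin> A" "level y v = 0" | (c) "v \<notin> A" "level y v \<noteq> 0" by blast
    then show ?thesis
    proof cases
      case a
      then have "ln (f v D) \<le> \<kappa> + real r * ln_mean (f v) x + ln_mean (f v) y - min (\<alpha> * (ln_mean (f v) x - ln_min (f v) x)) (ln_mean (f v) y - ln_min (f v) y)"
        using t by (intro A1) (auto simp: place_type_def)
      from mult_left_mono[OF this, of "w v"] show ?thesis using mm wv a by (simp add: algebra_simps)
    next
      case b
      from mult_left_mono[OF N1[of "f v"], of "w v"] show ?thesis using nonarch v b wv by (simp add: algebra_simps)
    next
      case c
      then have "argmin_abs (f v) x = argmin_abs (f v) y" using t solution_class_eqD(1)[OF solution_class v] by (auto simp: place_type_def)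
      then have "ln (f v D) \<le> real r * ln_mean (f v) x + ln_mean (f v) y - min (\<alpha> * (ln_mean (f v) x - ln_min (f v) x)) (ln_mean (f v) y - ln_min (f v) y)"
        using nonarch v c by (intro N2) auto
      from mult_left_mono[OF this, of "w v"] show ?thesis using mm wv c by (simp add: algebra_simps)
    qed
  qed
  have "0 \<le> (\<Sum>v\<in>V. w v * ln (f v D)) + real r * c1 + c0"
  proof (rule product[OF D])
    \<comment> \<open>Outside \<open>V\<close> the triples have equal absolute values, so the
      positions agree, and \<open>\<alpha> \<ge> 1\<close> guarantees that the whole difference of
      mean and minimum is saved.\<close>
    fix g z assume g: "g \<in> Out" "z \<in> X"
    note S = out_same[OF g(1) x(1) y(1)] out_same[OF g(1) x(1) g(2)]
    have "ln_mean g x - ln_min g x \<ge> 0" using ln_min_le_ln_mean[OF ultraD(1)[OF out_ultra[OF g(1)]] zero_sum_triple[OF x(1)]] by simp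
    then have "\<alpha> * (ln_mean g x - ln_min g x) \<ge> ln_mean g x - ln_min g x" using mult_right_mono[OF \<alpha>1] by fastforce
    then show "ln (g D) \<le> real r * ln_mean g z + ln_min g z"
      using N2[OF out_ultra[OF g(1)] S(3)] S by (auto simp: min_def split: if_splits)
  qed
  also have "(\<Sum>v\<in>V. w v * ln (f v D)) \<le> (\<Sum>v\<in>V. (if v \<in> A then w v * \<kappa> else 0) + real r * (w v * ln_mean (f v) x) + w v * ln_mean (f v) y - 3 * M * (real (level y v) / T))"
    by (rule sum_mono) (rule loc)
  also have "\<dots> = (\<Sum>v\<in>V. if v \<in> A then w v * \<kappa> else 0) + real r * (h x - c1) + (h y - c1) - (\<Sum>v\<in>V. 3 * M * (real (level y v) / T))"
    by (simp add: sum.distrib sum_subtractf h_def sum_distrib_left)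
  also have "(\<Sum>v\<in>V. if v \<in> A then w v * \<kappa> else 0) = sum w A * \<kappa>"
    using AV finV by (simp add: sum.inter_restrict[symmetric] Int_absorb1 sum_distrib_right)
  finally have "0 \<le> \<kappa> + real r * h x + h y - ((\<Sum>v\<in>V. 3 * M * (real (level y v) / T)) + (c1 - c0))"
    unfolding w_sum by (simp add: algebra_simps)
  then show ?thesis using class_sum[OF y M(1,2)] unfolding M_def[symmetric] by linarith
qed

lemma gap:
  assumes x: "x \<in> X" "h x > 0" and y: "y \<in> X" "h y > 0" and solution_class: "solution_class x = solution_class y" and ne: "x \<noteq> y"
  shows "51/20 * min (h x) (h y) \<le> 1/8 + h x + h y"
proof -
  note D = cross_nz[OF x(1) y(1) ne] and tx = zero_sum_triple[OF x(1)] and ty = zero_sum_triple[OF y(1)]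
  have "51/20 * min (1 * h x) (h y) \<le> 1/8 + real 1 * h x + h y"
  proof (rule class_inequality[OF x y solution_class D])
    fix v assume v: "v \<in> A" and i: "argmin_abs (f v) x = argmin_abs (f v) y"
      and s: "sector (ratio (\<lambda>i. emb v (x i))) = sector (ratio (\<lambda>i. emb v (y i)))"
    have "cross (\<lambda>i. emb v (x i)) (\<lambda>i. emb v (y i)) \<noteq> 0" unfolding cross_emb[OF v, symmetric] emb_zero[OF v] by (rule D)
    from complex_cross_sector[OF zero_sum_triple_emb[OF v x(1)] zero_sum_triple_emb[OF v y(1)] i[unfolded arch[OF v] min_abs_comp[of "emb v"]] s this]
    show "ln (f v (cross x y)) \<le> 1/8 + real 1 * ln_mean (f v) x + ln_mean (f v) y - min (1 * (ln_mean (f v) x - ln_min (f v) x)) (ln_mean (f v) y - ln_min (f v) y)"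
      unfolding arch[OF v] min_abs_comp[of "emb v"] cross_emb[OF v] of_nat_1 mult_1_left .
  next
    fix g :: "'k \<Rightarrow> real" assume g: "ultra g"
    show "ln (g (cross x y)) \<le> real 1 * ln_mean g x + ln_mean g y" using ultra_cross(1)[OF g tx ty D] unfolding of_nat_1 mult_1_left .
    show "ln (g (cross x y)) \<le> real 1 * ln_mean g x + ln_mean g y - min (1 * (ln_mean g x - ln_min g x)) (ln_mean g y - ln_min g y)" if "argmin_abs g x = argmin_abs g y"
      using ultra_cross(2)[OF g tx ty D that] unfolding of_nat_1 mult_1_left .
  qed auto
  then show ?thesis by simp
qed

lemma pade_gap:
  assumes x: "x \<in> X" "h x > 0" and y: "y \<in> X" "h y > 0" and solution_class: "solution_class x = solution_class y" and N: "N \<ge> 2"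
  shows "51/20 * min (2 * real N * h x) (h y) \<le> real N * ln 10 + 3 * real N * h x + h y"
proof -
  note tx = zero_sum_triple[OF x(1)] and ty = zero_sum_triple[OF y(1)]
  interpret triple x using tx by unfold_locales (auto simp: zero_sum_triple_def dest: less3)
  have "y 0 + y 1 + y 2 = 0" "y 0 \<noteq> 0" using ty by (auto simp: zero_sum_triple_def)
  from pade_nonvanishing[OF _ this, of N] N
  obtain e where e: "e = (\<lambda>i. if i = 2 then N - 1 else N) \<or> e = (\<lambda>i. if i = 0 then N - 1 else N)"
    and D: "cross (pade e x) y \<noteq> 0" by (auto simp: cross_def)
  have pe: "pade_exponents N e" using e N by (auto simp: pade_exponents_def)
  have "51/20 * min (real (2 * N) * h x) (h y) \<le> real N * ln 10 + real (3 * N) * h x + h y"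
  proof (rule class_inequality[OF x y solution_class D])
    fix v assume v: "v \<in> A" and i: "argmin_abs (f v) x = argmin_abs (f v) y"
    show "ln (f v (cross (pade e x) y)) \<le> real N * ln 10 + real (3 * N) * ln_mean (f v) x + ln_mean (f v) y
        - min (real (2 * N) * (ln_mean (f v) x - ln_min (f v) x)) (ln_mean (f v) y - ln_min (f v) y)"
      using abs_pade[OF fabs tx ty pe D N i] v AV by blast
  next
    fix g :: "'k \<Rightarrow> real" assume g: "ultra g"
    show "ln (g (cross (pade e x) y)) \<le> real (3 * N) * ln_mean g x + ln_mean g y" by (rule ultra_pade(1)[OF g tx ty pe D])
    show "ln (g (cross (pade e x) y)) \<le> real (3 * N) * ln_mean g x + ln_mean g y - min (real (2 * N) * (ln_mean g x - ln_min g x)) (ln_mean g y - ln_min g y)"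
      if "argmin_abs g x = argmin_abs g y" by (rule ultra_pade(2)[OF g tx ty pe D that])
  qed (use N in auto)
  then show ?thesis by simp
qed

text \<open>Equal heights of distinct members of a class would give 0.55 h \<le> 1/8 in
  \<open>gap\<close>. So \<open>h\<close> is injective on a class and \<open>chain_bound\<close>
  applies to its values.\<close>

lemma card_large:
  "finite {x\<in>X. h x \<ge> 3/5}" "card {x\<in>X. h x \<ge> 3/5} \<le> 21 * card (level_types type_set V n)"
proof -
  let ?L = "{x\<in>X. h x \<ge> 3/5}"
  have fib: "finite {x\<in>?L. solution_class x = \<phi>} \<and> card {x\<in>?L. solution_class x = \<phi>} \<le> 21" for \<phi>
  proof -
    let ?F = "{x\<in>?L. solution_class x = \<phi>}"
    have inj: "inj_on h ?F"
    proof (rule inj_onI, rule ccontr)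
      fix x y assume xy: "x \<in> ?F" "y \<in> ?F" "h x = h y" "x \<noteq> y"
      from xy have "x \<in> X" "h x \<ge> 3/5" "y \<in> X" "h y \<ge> 3/5" "solution_class x = solution_class y" by auto
      then show False using gap[of x y] xy(3,4) by simp
    qed
    have "finite (h ` ?F) \<and> card (h ` ?F) \<le> 21"
    proof (rule chain_bound)
      fix p q assume "p \<in> h ` ?F" "q \<in> h ` ?F" "p < q"
      then obtain x y where xy: "x \<in> ?F" "y \<in> ?F" "p = h x" "q = h y" by auto
      then have "x \<noteq> y" using \<open>p < q\<close> by auto
      then show "(31/20) * p - 1/8 \<le> q" using gap[of x y] xy \<open>p < q\<close> by auto
      fix N :: nat assume "N \<ge> 2"
      then show "(51/20) * min (2 * real N * p) q \<le> real N * ln 10 + 3 * real N * p + q"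
        using pade_gap[of x y N] xy by auto
    qed auto
    then show ?thesis using finite_image_iff[OF inj] card_image[OF inj] by simp
  qed
  have fc: "finite (level_types type_set V n)"
    unfolding n_def by (rule card_level_types_bound(1)[OF finV cardV, of _ "\<lambda>_. 18" "\<lambda>_. 18"]) (auto simp: type_set_def)
  have eq: "?L = (\<Union>\<phi>\<in>level_types type_set V n. {x\<in>?L. solution_class x = \<phi>})" using solution_class_mem by auto
  show "finite ?L" by (subst eq) (use fib fc in blast)
  have "card ?L \<le> (\<Sum>\<phi>\<in>level_types type_set V n. card {x\<in>?L. solution_class x = \<phi>})"
    by (subst eq) (rule card_UN_le[OF fc])
  also have "\<dots> \<le> (\<Sum>\<phi>\<in>level_types type_set V n. 21)" using fib by (intro sum_mono) auto
  finally show "card ?L \<le> 21 * card (level_types type_set V n)" by simp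
qed

section \<open>Solutions of small height\<close>

definition cells :: "'v \<Rightarrow> (nat \<times> int \<times> int) set" where
  "cells v = {0..<3} \<times> ({-4..4} \<times> (if real_place v then {0} else {-7..6}))"

text \<open>Two distinct solutions in the same cell at every archimedean place save 6/5 altogether,
  while their heights add up to less than 6/5; this contradicts the product formula. So the cells
  determine the solution.\<close>

lemma card_small:
  "finite {x\<in>X. h x < 3/5}" "card {x\<in>X. h x < 3/5} \<le> (\<Prod>v\<in>A. if real_place v then 27 else 378)"
proof -
  let ?S = "{x\<in>X. h x < 3/5}"
  have finA: "finite A" using AV finV finite_subset by auto
  define c where "c = (\<lambda>x. restrict (\<lambda>v. (argmin_abs (f v) x, cell (ratio (\<lambda>i. emb v (x i))))) A)"
  have sub: "c ` ?S \<subseteq> PiE A cells"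
  proof (rule image_subsetI)
    fix x assume "x \<in> ?S"
    then have x: "x \<in> X" by simp
    have "(argmin_abs (f v) x, cell (ratio (\<lambda>i. emb v (x i)))) \<in> cells v" if v: "v \<in> A" for v
      using cell_range[OF ratio_facts(4)[OF zero_sum_triple_emb[OF v x] refl refl]] ratio_real[OF v, of x] argmin_abs_less
      by (auto simp: cells_def)
    then show "c x \<in> PiE A cells" by (auto simp: c_def)
  qed
  have inj: "inj_on c ?S"
  proof (rule inj_onI, rule ccontr)
    fix x y assume xy: "x \<in> ?S" "y \<in> ?S" and eq: "c x = c y" and ne: "x \<noteq> y"
    then have x: "x \<in> X" "h x < 3/5" and y: "y \<in> X" "h y < 3/5" by auto
    note D = cross_nz[OF x(1) y(1) ne] and tx = zero_sum_triple[OF x(1)] and ty = zero_sum_triple[OF y(1)]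
    have loc: "w v * ln (f v (cross x y)) \<le> w v * ln_mean (f v) x + w v * ln_mean (f v) y - (if v \<in> A then w v * (6/5) else 0)"
      if v: "v \<in> V" for v
    proof (cases "v \<in> A")
      case True
      have e: "argmin_abs (f v) x = argmin_abs (f v) y" "cell (ratio (\<lambda>i. emb v (x i))) = cell (ratio (\<lambda>i. emb v (y i)))"
        using fun_cong[OF eq, of v] True by (auto simp: c_def)
      have "cross (\<lambda>i. emb v (x i)) (\<lambda>i. emb v (y i)) \<noteq> 0" unfolding cross_emb[OF True, symmetric] emb_zero[OF True] by (rule D)
      from complex_cross_cell[OF zero_sum_triple_emb[OF True x(1)] zero_sum_triple_emb[OF True y(1)] e(1)[unfolded arch[OF True] min_abs_comp[of "emb v"]] e(2) this]
      have "ln (f v (cross x y)) \<le> ln_mean (f v) x + ln_mean (f v) y - 6/5"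
        unfolding arch[OF True] min_abs_comp[of "emb v"] cross_emb[OF True] .
      from mult_left_mono[OF this, of "w v"] show ?thesis using w_pos[OF v] True by (simp add: algebra_simps)
    next
      case False
      then have "ln (f v (cross x y)) \<le> ln_mean (f v) x + ln_mean (f v) y"
        using ultra_cross(1)[OF nonarch tx ty D] v by blast
      from mult_left_mono[OF this, of "w v"] show ?thesis using w_pos[OF v] False by (simp add: algebra_simps)
    qed
    have "0 \<le> (\<Sum>v\<in>V. w v * ln (f v (cross x y))) + real 1 * c1 + c0"
    proof (rule product[OF D])
      fix g z assume g: "g \<in> Out" "z \<in> X"
      note S = out_same[OF g(1) x(1) y(1)] out_same[OF g(1) x(1) g(2)]
      show "ln (g (cross x y)) \<le> real 1 * ln_mean g z + ln_min g z"
        using ultra_cross(2)[OF out_ultra[OF g(1)] tx ty D S(3)] S by (auto simp: min_def split: if_splits)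
    qed
    also have "(\<Sum>v\<in>V. w v * ln (f v (cross x y))) \<le> (\<Sum>v\<in>V. w v * ln_mean (f v) x + w v * ln_mean (f v) y - (if v \<in> A then w v * (6/5) else 0))"
      by (rule sum_mono) (rule loc)
    also have "\<dots> = (h x - c1) + (h y - c1) - (\<Sum>v\<in>V. if v \<in> A then w v * (6/5) else 0)"
      by (simp add: sum.distrib sum_subtractf h_def)
    also have "(\<Sum>v\<in>V. if v \<in> A then w v * (6/5) else 0) = sum w A * (6/5)"
      using AV finV by (simp only: sum.inter_restrict[symmetric] Int_absorb1 sum_distrib_right)
    finally show False using x(2) y(2) c01 unfolding w_sum by simp
  qed
  have fp: "finite (PiE A cells)" by (rule finite_PiE[OF finA]) (auto simp: cells_def)
  show "finite ?S" using inj_on_finite[OF inj sub fp] .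
  have "card ?S \<le> card (PiE A cells)" by (rule card_inj_on_le[OF inj sub fp])
  also have "\<dots> = (\<Prod>v\<in>A. card (cells v))" by (rule card_PiE[OF finA])
  also have "\<dots> = (\<Prod>v\<in>A. if real_place v then 27 else 378)"
    by (rule prod.cong) (auto simp: cells_def card_cartesian_product)
  finally show "card ?S \<le> (\<Prod>v\<in>A. if real_place v then 27 else 378)" .
qed

theorem card_solutions:
  "finite X" "real (card X) \<le> 21 * (42/125) * (\<Prod>v\<in>V. if v \<in> A then (if real_place v then 405/4 else 1215/4) else 45)
      + (\<Prod>v\<in>A. if real_place v then 27 else 378)"
proof -
  let ?L = "{x\<in>X. h x \<ge> 3/5}" and ?S = "{x\<in>X. h x < 3/5}"
  have X: "X = ?L \<union> ?S" by auto
  show "finite X" by (subst X) (use card_large(1) card_small(1) in blast)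
  \<comment> \<open>Three positions times two or six sectors at archimedean places; otherwise one
    type at level 0 and three above. The factors are 45/16 * (6 + 30), 45/16 * (18 + 90) and 45/16 *
    (1 + 15).\<close>
  let ?c0 = "\<lambda>v. if v \<in> A then (if real_place v then 6 else 18) else (1::real)"
  let ?c1 = "\<lambda>v. if v \<in> A then (if real_place v then 6 else 18) else (3::real)"
  have "real (card (level_types type_set V n)) \<le> 42/125 * (\<Prod>v\<in>V. 45/16 * (?c0 v + 5 * ?c1 v))"
    unfolding n_def by (rule card_level_types_bound(2)[OF finV cardV]) (auto simp: type_set_def)
  also have "(\<Prod>v\<in>V. 45/16 * (?c0 v + 5 * ?c1 v)) = (\<Prod>v\<in>V. if v \<in> A then (if real_place v then 405/4 else 1215/4) else 45)"
    by (rule prod.cong) auto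
  finally have 1: "real (card (level_types type_set V n)) \<le> 42/125 * (\<Prod>v\<in>V. if v \<in> A then (if real_place v then 405/4 else 1215/4) else 45)" .
  have "real (card X) \<le> real (card ?L) + real (card ?S)"
    by (subst X) (simp add: card_Un_le flip: of_nat_add)
  also have "real (card ?L) \<le> 21 * real (card (level_types type_set V n))"
    using card_large(2) by (simp flip: of_nat_mult add: of_nat_le_iff)
  also have "\<dots> \<le> 21 * (42/125 * (\<Prod>v\<in>V. if v \<in> A then (if real_place v then 405/4 else 1215/4) else 45))"
    using 1 by (intro mult_left_mono) auto
  also have "real (card ?S) \<le> real (\<Prod>v\<in>A. if real_place v then 27 else 378)"
    using card_small(2) by (simp only: of_nat_le_iff)
  also have "real (\<Prod>v\<in>A. if real_place v then 27 else 378) = (\<Prod>v\<in>A. if real_place v then 27 else 378)"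
    by (simp add: if_distrib cong: if_cong)
  finally show "real (card X) \<le> 21 * (42/125) * (\<Prod>v\<in>V. if v \<in> A then (if real_place v then 405/4 else 1215/4) else 45)
      + (\<Prod>v\<in>A. if real_place v then 27 else 378)" by simp
qed

end

section \<open>Places of a number field\<close>

locale s_unit_equation = padic_embeddings m \<sigma> w
  for m :: nat and \<sigma> :: "nat \<Rightarrow> 'k::field_char_0 \<Rightarrow> complex" and w :: "nat \<Rightarrow> complex \<Rightarrow> real" +
  fixes S :: "('k \<Rightarrow> real) set set" and lam mu :: 'k
  assumes S: "finite S" "\<And>v. v \<in> places \<Longrightarrow> archimedean v \<Longrightarrow> v \<in> S"
    and lam_mu: "lam \<noteq> 0" "mu \<noteq> 0"
begin

text \<open>Each pair \<open>(i, p)\<close> of an embedding and a prime or \<open>0\<close> gives an absolute value \<open>G (i, p)\<close>; different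
  pairs may give the same place, which then receives the sum of their weights.\<close>

definition Idx :: "(nat \<times> nat) set" where "Idx = {(i, p). i < m \<and> (p = 0 \<or> prime p)}"

definition G :: "nat \<times> nat \<Rightarrow> 'k \<Rightarrow> real" where "G \<iota> = F (fst \<iota>) (snd \<iota>)"

definition place_of :: "nat \<times> nat \<Rightarrow> ('k \<Rightarrow> real) set" where "place_of \<iota> = absolute_value_equiv `` {G \<iota>}"

lemma IdxD: "\<iota> \<in> Idx \<Longrightarrow> fst \<iota> < m" "\<iota> \<in> Idx \<Longrightarrow> snd \<iota> = 0 \<or> prime (snd \<iota>)"
  by (auto simp: Idx_def)

lemma G_abs: "\<iota> \<in> Idx \<Longrightarrow> absolute_value (G \<iota>)"
  using F_abs IdxD by (simp add: G_def)

lemma G_two: "\<iota> \<in> Idx \<Longrightarrow> snd \<iota> = 0 \<Longrightarrow> G \<iota> (of_nat n) = real n"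
  using IdxD by (simp add: G_def F_def \<sigma>_of_nat)

lemma G_nontrivial: "\<iota> \<in> Idx \<Longrightarrow> G \<iota> \<in> nontrivial_absolute_values"
proof -
  assume \<iota>: "\<iota> \<in> Idx"
  have "\<exists>n>0. G \<iota> (of_nat n) \<noteq> 1"
  proof (cases "snd \<iota> = 0")
    case True
    then show ?thesis using G_two[OF \<iota> True, of 2] by (intro exI[of _ 2]) simp
  next
    case False
    then have "prime (snd \<iota>)" using IdxD[OF \<iota>] by auto
    then show ?thesis using F_p[OF IdxD(1)[OF \<iota>], of "snd \<iota>"] prime_gt_1_nat[of "snd \<iota>"]
      by (intro exI[of _ "snd \<iota>"]) (auto simp: G_def)
  qed
  then obtain n where "n > 0" "G \<iota> (of_nat n) \<noteq> 1" by blast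
  then show ?thesis using G_abs[OF \<iota>] unfolding nontrivial_absolute_values_def
    by (intro CollectI conjI exI[of _ "of_nat n"]) auto
qed

lemma place_of_places: "\<iota> \<in> Idx \<Longrightarrow> place_of \<iota> \<in> places"
  unfolding place_of_def places_def by (rule quotientI[OF G_nontrivial])

lemma G_in_place_of: "\<iota> \<in> Idx \<Longrightarrow> G \<iota> \<in> place_of \<iota>"
  unfolding place_of_def by (rule equiv_class_self[OF equiv_absolute_value_equiv G_nontrivial])

lemma place_of_eqD:
  assumes "\<iota> \<in> Idx" "\<kappa> \<in> Idx" "place_of \<iota> = place_of \<kappa>"
  shows "\<exists>c>0. \<forall>x. G \<iota> x = G \<kappa> x powr c"
proof -
  have "(G \<kappa>, G \<iota>) \<in> absolute_value_equiv"
    using eq_equiv_class[OF assms(3)[symmetric, unfolded place_of_def] equiv_absolute_value_equiv] G_nontrivial[OF assms(1)] by blast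
  then show ?thesis by (auto simp: absolute_value_equiv_def)
qed

lemma arch_in_S: "\<iota> \<in> Idx \<Longrightarrow> snd \<iota> = 0 \<Longrightarrow> place_of \<iota> \<in> S"
proof -
  assume \<iota>: "\<iota> \<in> Idx" "snd \<iota> = 0"
  have "G \<iota> (1 + 1) > max (G \<iota> 1) (G \<iota> 1)" using G_two[OF \<iota>, of 2] G_two[OF \<iota>, of 1] by simp
  then have "archimedean (place_of \<iota>)" using place_archimedean_iff[OF place_of_places G_in_place_of] \<iota> by blast
  then show ?thesis using S(2) place_of_places \<iota> by blast
qed

text \<open>Equivalent absolute values are below 1 at the same elements, and a prime p is below 1
  only at indices whose second component is p.\<close>

lemma place_of_prime:
  assumes "\<iota> \<in> Idx" "\<kappa> \<in> Idx" "place_of \<iota> = place_of \<kappa>"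
  shows "snd \<iota> = snd \<kappa>"
proof -
  have *: "snd \<iota> = snd \<kappa>" if I: "\<iota> \<in> Idx" "\<kappa> \<in> Idx" and e: "place_of \<iota> = place_of \<kappa>" and p: "prime (snd \<iota>)" for \<iota> \<kappa>
  proof (rule ccontr)
    assume ne: "snd \<iota> \<noteq> snd \<kappa>"
    let ?p = "snd \<iota>"
    obtain c where c: "c > 0" "\<And>x. G \<iota> x = G \<kappa> x powr c" using place_of_eqD[OF I e] by blast
    have "G \<kappa> (of_nat ?p) \<ge> 1"
    proof (cases "snd \<kappa> = 0")
      case True
      then show ?thesis using G_two[OF I(2) True, of ?p] prime_gt_1_nat[OF p] by simp
    next
      case False
      then have "G \<kappa> (of_nat ?p) = 1" using F_prime[of "fst \<kappa>" "snd \<kappa>" ?p] IdxD[OF I(2)] p ne by (auto simp: G_def)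
      then show ?thesis by simp
    qed
    then have "G \<iota> (of_nat ?p) \<ge> 1" using c ge_one_powr_ge_zero[of "G \<kappa> (of_nat ?p)" c] by simp
    moreover have "G \<iota> (of_nat ?p) < 1" using F_p[OF IdxD(1)[OF I(1)] p] prime_gt_1_nat[OF p] by (simp add: G_def)
    ultimately show False by simp
  qed
  show ?thesis using *[OF assms] *[OF assms(2,1) assms(3)[symmetric]] IdxD(2) assms(1,2) by metis
qed

definition V :: "('k \<Rightarrow> real) set set" where "V = place_of ` Idx \<inter> S"
definition A :: "('k \<Rightarrow> real) set set" where "A = place_of ` ({..<m} \<times> {0})"
definition J :: "('k \<Rightarrow> real) set \<Rightarrow> (nat \<times> nat) set" where "J v = {\<iota>\<in>Idx. place_of \<iota> = v}"
definition rep :: "('k \<Rightarrow> real) set \<Rightarrow> nat \<times> nat" where "rep v = (SOME \<iota>. \<iota> \<in> J v)"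
definition f :: "('k \<Rightarrow> real) set \<Rightarrow> 'k \<Rightarrow> real" where "f v = G (rep v)"
definition expo :: "nat \<times> nat \<Rightarrow> real" where "expo \<iota> = (SOME c. c > 0 \<and> (\<forall>x. G \<iota> x = f (place_of \<iota>) x powr c))"
text \<open>Collects the exponents of all indices over \<open>v\<close>, so that sums of logarithms
  over indices become weighted sums over places. Division by \<open>m\<close> makes the archimedean
  weights add up to 1.\<close>

definition weight :: "('k \<Rightarrow> real) set \<Rightarrow> real" where "weight v = (\<Sum>\<iota>\<in>J v. expo \<iota>) / real m"
definition emb :: "('k \<Rightarrow> real) set \<Rightarrow> 'k \<Rightarrow> complex" where "emb v = \<sigma> (fst (rep v))"
definition real_place :: "('k \<Rightarrow> real) set \<Rightarrow> bool" where "real_place v \<longleftrightarrow> (\<forall>z. Im (emb v z) = 0)"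

lemma arch_Idx: "{..<m} \<times> {0} \<subseteq> Idx" by (auto simp: Idx_def)

lemma A_V: "A \<subseteq> V" using arch_in_S arch_Idx by (auto simp: A_def V_def)

lemma finite_V: "finite V" using S by (simp add: V_def)

lemma rep: "\<iota> \<in> Idx \<Longrightarrow> rep (place_of \<iota>) \<in> Idx \<and> place_of (rep (place_of \<iota>)) = place_of \<iota>"
  using someI[of "\<lambda>\<kappa>. \<kappa> \<in> J (place_of \<iota>)" \<iota>] by (simp add: rep_def J_def)

lemma rep_V: "v \<in> V \<Longrightarrow> rep v \<in> Idx" "v \<in> V \<Longrightarrow> place_of (rep v) = v"
  using rep by (auto simp: V_def)

lemma rep_A: "v \<in> A \<Longrightarrow> snd (rep v) = 0"
proof -
  assume "v \<in> A"
  then obtain i where i: "i < m" "v = place_of (i, 0)" by (auto simp: A_def)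
  then have "(i, 0) \<in> Idx" by (auto simp: Idx_def)
  then show ?thesis using rep[of "(i, 0)"] place_of_prime[of "rep v" "(i, 0)"] i by simp
qed

lemma J_sub: "v \<in> V \<Longrightarrow> J v \<subseteq> {..<m} \<times> {snd (rep v)}"
  using place_of_prime[OF _ rep_V(1)] rep_V(2) IdxD(1) by (fastforce simp: J_def)

lemma finite_J: "v \<in> V \<Longrightarrow> finite (J v)" using finite_subset[OF J_sub] by simp

lemma expo: "\<iota> \<in> Idx \<Longrightarrow> expo \<iota> > 0" "\<iota> \<in> Idx \<Longrightarrow> G \<iota> x = f (place_of \<iota>) x powr expo \<iota>"
proof -
  assume \<iota>: "\<iota> \<in> Idx"
  have "\<exists>c>0. \<forall>x. G \<iota> x = f (place_of \<iota>) x powr c" using place_of_eqD[of \<iota> "rep (place_of \<iota>)"] rep[OF \<iota>] \<iota> by (simp add: f_def)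
  from someI_ex[OF this, folded expo_def] show "expo \<iota> > 0" "G \<iota> x = f (place_of \<iota>) x powr expo \<iota>" by blast+
qed

lemma weight_pos: "v \<in> V \<Longrightarrow> weight v > 0"
proof -
  assume v: "v \<in> V"
  have "rep v \<in> J v" using rep_V[OF v] by (simp add: J_def)
  then have "J v \<noteq> {}" by blast
  then have "(\<Sum>\<iota>\<in>J v. expo \<iota>) > 0" using expo(1) finite_J[OF v] by (intro sum_pos) (auto simp: J_def)
  then show ?thesis using m_pos by (simp add: weight_def)
qed

lemma f_abs: "v \<in> V \<Longrightarrow> absolute_value (f v)"
  using G_abs rep_V by (simp add: f_def)

lemma ln_G: "\<iota> \<in> Idx \<Longrightarrow> x \<noteq> 0 \<Longrightarrow> ln (G \<iota> x) = expo \<iota> * ln (f (place_of \<iota>) x)"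
  by (cases "f (place_of \<iota>) x = 0") (simp_all add: expo(2) ln_powr)

lemma min_abs_G: "\<iota> \<in> Idx \<Longrightarrow> min_abs (G \<iota>) x = min_abs (f (place_of \<iota>)) x powr expo \<iota>"
proof -
  assume \<iota>: "\<iota> \<in> Idx"
  have "f (place_of \<iota>) z \<ge> 0" for z using abs_val_simps(1)[OF G_abs] rep[OF \<iota>] by (simp add: f_def)
  moreover have "min (a powr c) (b powr c) = min a b powr c" if "a \<ge> 0" "b \<ge> 0" "c > 0" for a b c :: real
    using that powr_mono2[of c a b] powr_mono2[of c b a] by (auto simp: min_def)
  ultimately show ?thesis using expo(1)[OF \<iota>] by (simp add: min_abs_def expo(2)[OF \<iota>, of "_ _"])
qed

lemma ln_min_G: "\<iota> \<in> Idx \<Longrightarrow> ln_min (G \<iota>) x = expo \<iota> * ln_min (f (place_of \<iota>)) x"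
  by (cases "min_abs (f (place_of \<iota>)) x = 0") (simp_all add: ln_min_def min_abs_G ln_powr)

lemma ln_mean_G: "\<iota> \<in> Idx \<Longrightarrow> zero_sum_triple x \<Longrightarrow> ln_mean (G \<iota>) x = expo \<iota> * ln_mean (f (place_of \<iota>)) x"
  by (simp add: ln_mean_def ln_min_G ln_G zero_sum_triple_def algebra_simps)

lemma sum_places:
  assumes Q: "finite Q" "\<And>p. p \<in> Q \<Longrightarrow> prime p" "(snd \<circ> rep) ` V - {0} \<subseteq> Q"
    and h: "\<And>\<iota>. \<iota> \<in> Idx \<Longrightarrow> place_of \<iota> \<in> S \<Longrightarrow> h (G \<iota>) = expo \<iota> * h (f (place_of \<iota>))"
  shows "(\<Sum>\<iota>\<in>{..<m} \<times> insert 0 Q. h (G \<iota>)) =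
    real m * (\<Sum>v\<in>V. weight v * h (f v)) + (\<Sum>\<iota>\<in>{\<iota>\<in>{..<m} \<times> insert 0 Q. place_of \<iota> \<notin> S}. h (G \<iota>))"
proof -
  let ?I = "{..<m} \<times> insert 0 Q"
  have fin: "finite ?I" using Q by simp
  have sub: "?I \<subseteq> Idx" using Q by (auto simp: Idx_def)
  let ?B = "{\<iota>\<in>?I. place_of \<iota> \<in> S}"
  have B: "?B = (\<Union>v\<in>V. J v)"
  proof (intro equalityI subsetI)
    fix \<iota> assume "\<iota> \<in> ?B"
    then show "\<iota> \<in> (\<Union>v\<in>V. J v)" using sub by (auto simp: J_def V_def)
  next
    fix \<iota> assume "\<iota> \<in> (\<Union>v\<in>V. J v)"
    then obtain v where v: "v \<in> V" "\<iota> \<in> J v" by blast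
    then have "fst \<iota> < m" "snd \<iota> = snd (rep v)" using J_sub[OF v(1)] by auto
    moreover have "snd (rep v) \<in> insert 0 Q" using Q(3) v(1) by auto
    moreover have "place_of \<iota> \<in> S" using v by (auto simp: J_def V_def)
    ultimately show "\<iota> \<in> ?B" by (cases \<iota>) auto
  qed
  have "(\<Sum>\<iota>\<in>?B. h (G \<iota>)) = (\<Sum>v\<in>V. \<Sum>\<iota>\<in>J v. h (G \<iota>))"
    unfolding B by (rule sum.UNION_disjoint) (use finite_V finite_J in \<open>auto simp: J_def\<close>)
  also have "\<dots> = (\<Sum>v\<in>V. \<Sum>\<iota>\<in>J v. expo \<iota> * h (f v))"
    by (intro sum.cong refl) (use h in \<open>auto simp: J_def V_def\<close>)
  also have "\<dots> = real m * (\<Sum>v\<in>V. weight v * h (f v))"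
    using m_pos by (simp add: weight_def sum_distrib_left sum_distrib_right sum_divide_distrib)
  finally have 1: "(\<Sum>\<iota>\<in>?B. h (G \<iota>)) = real m * (\<Sum>v\<in>V. weight v * h (f v))" .
  have "(\<Sum>\<iota>\<in>?I. h (G \<iota>)) = (\<Sum>\<iota>\<in>?B. h (G \<iota>)) + (\<Sum>\<iota>\<in>{\<iota>\<in>?I. place_of \<iota> \<notin> S}. h (G \<iota>))"
    using sum.union_disjoint[of ?B "{\<iota>\<in>?I. place_of \<iota> \<notin> S}" "\<lambda>\<iota>. h (G \<iota>)"] fin
    by (simp add: Un_def conj_disj_distribL[symmetric] disjoint_iff cong: conj_cong)
  then show ?thesis using 1 by simp
qed

definition bad_primes :: "'k \<Rightarrow> nat set" where "bad_primes x = {p. prime p \<and> (\<exists>i<m. F i p x \<noteq> 1)}"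

text \<open>Besides the primes belonging to \<open>V\<close>, those at which \<open>lam\<close> or
  \<open>mu\<close> is not of absolute value 1. At an index with a prime outside \<open>Q0\<close>
  all coordinates of \<open>tri (1, 1)\<close> have absolute value 1.\<close>

definition Q0 :: "nat set" where "Q0 = bad_primes lam \<union> bad_primes mu \<union> ((snd \<circ> rep) ` V - {0})"

lemma Q0: "finite Q0" "p \<in> Q0 \<Longrightarrow> prime p"
proof -
  show "finite Q0" using F_finite lam_mu finite_V by (simp add: Q0_def bad_primes_def)
  have "prime (snd (rep v))" if "v \<in> V" "snd (rep v) \<noteq> 0" for v using IdxD(2)[OF rep_V(1)[OF that(1)]] that(2) by simp
  then show "p \<in> Q0 \<Longrightarrow> prime p" by (auto simp: Q0_def bad_primes_def)
qed

lemma bad_primes: "x \<noteq> 0 \<Longrightarrow> finite (bad_primes x)" "p \<in> bad_primes x \<Longrightarrow> prime p"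
  using F_finite by (auto simp: bad_primes_def)

lemma Q0_rep: "(snd \<circ> rep) ` V - {0} \<subseteq> Q0" by (simp add: Q0_def)

lemma sum_ln_G:
  assumes "x \<noteq> 0" "finite Q" "\<And>p. p \<in> Q \<Longrightarrow> prime p" "bad_primes x \<subseteq> Q"
  shows "(\<Sum>\<iota>\<in>{..<m} \<times> insert 0 Q. ln (G \<iota> x)) = 0"
proof -
  have "(\<Sum>\<iota>\<in>{..<m} \<times> insert 0 Q. ln (G \<iota> x)) = (\<Sum>p\<in>insert 0 Q. \<Sum>i<m. ln (F i p x))"
    by (subst sum.swap) (simp add: sum.cartesian_product G_def split_beta)
  also have "\<dots> = 0" by (rule product_formula) (use assms in \<open>auto simp: bad_primes_def\<close>)
  finally show ?thesis .
qed

section \<open>Solutions as triples with sum zero\<close>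

definition sols :: "('k \<times> 'k) set" where
  "sols = {(x, y). x \<in> S_units S \<and> y \<in> S_units S \<and> lam * x + mu * y = 1}"

definition tri :: "'k \<times> 'k \<Rightarrow> nat \<Rightarrow> 'k" where
  "tri z = (\<lambda>i. if i = 0 then lam * fst z else if i = 1 then mu * snd z else -1)"

lemma S_unit_G: "a \<in> S_units S \<Longrightarrow> \<iota> \<in> Idx \<Longrightarrow> place_of \<iota> \<notin> S \<Longrightarrow> G \<iota> a = 1"
  using place_of_places[of \<iota>] G_in_place_of[of \<iota>] by (simp add: S_units_def)

lemma tri_zero_sum_triple: "z \<in> sols \<Longrightarrow> zero_sum_triple (tri z)"
  using lam_mu by (auto simp: sols_def tri_def zero_sum_triple_def S_units_def)

lemma tri_out:
  assumes "z \<in> sols" "\<iota> \<in> Idx" "place_of \<iota> \<notin> S"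
  shows "G \<iota> (tri z i) = G \<iota> (tri (1, 1) i)"
proof -
  have "G \<iota> (fst z) = 1" "G \<iota> (snd z) = 1" using S_unit_G[OF _ assms(2,3)] assms(1) by (auto simp: sols_def)
  then show ?thesis using abs_val_simps(3,5)[OF G_abs[OF assms(2)]] by (simp add: tri_def)
qed

lemma tri_out_ln_min:
  assumes "z \<in> sols" "\<iota> \<in> Idx" "place_of \<iota> \<notin> S"
  shows "ln_min (G \<iota>) (tri z) = ln_min (G \<iota>) (tri (1, 1))" "ln_mean (G \<iota>) (tri z) = ln_mean (G \<iota>) (tri (1, 1))"
  using tri_out[OF assms] by (simp_all add: ln_min_def ln_mean_def min_abs_def)

text \<open>The part of a height sum outside \<open>S\<close>. S-units have absolute value 1 there,
  so the triple of (1, 1), though in general not a solution, has the right absolute values for all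
  of them.\<close>

definition C :: "(('k \<Rightarrow> real) \<Rightarrow> (nat \<Rightarrow> 'k) \<Rightarrow> real) \<Rightarrow> real" where
  "C l = (\<Sum>\<iota>\<in>{\<iota>\<in>{..<m} \<times> insert 0 Q0. place_of \<iota> \<notin> S}. l (G \<iota>) (tri (1, 1))) / real m"

lemma sum_out:
  assumes z: "z \<in> sols" and Q: "finite Q" "\<And>p. p \<in> Q \<Longrightarrow> prime p" "Q0 \<subseteq> Q" and l: "l = ln_min \<or> l = ln_mean"
  shows "(\<Sum>\<iota>\<in>{\<iota>\<in>{..<m} \<times> insert 0 Q. place_of \<iota> \<notin> S}. l (G \<iota>) (tri z)) = real m * C l"
proof -
  have sub: "{..<m} \<times> insert 0 Q \<subseteq> Idx" using Q by (auto simp: Idx_def)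
  have "(\<Sum>\<iota>\<in>{\<iota>\<in>{..<m} \<times> insert 0 Q. place_of \<iota> \<notin> S}. l (G \<iota>) (tri z))
    = (\<Sum>\<iota>\<in>{\<iota>\<in>{..<m} \<times> insert 0 Q. place_of \<iota> \<notin> S}. l (G \<iota>) (tri (1, 1)))"
    using l tri_out_ln_min[OF z] sub by (intro sum.cong) auto
  also have "\<dots> = (\<Sum>\<iota>\<in>{\<iota>\<in>{..<m} \<times> insert 0 Q0. place_of \<iota> \<notin> S}. l (G \<iota>) (tri (1, 1)))"
  proof (rule sum.mono_neutral_right)
    show "\<forall>\<iota>\<in>{\<iota>\<in>{..<m} \<times> insert 0 Q. place_of \<iota> \<notin> S} - {\<iota>\<in>{..<m} \<times> insert 0 Q0. place_of \<iota> \<notin> S}. l (G \<iota>) (tri (1, 1)) = 0"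
    proof
      fix \<iota> assume a: "\<iota> \<in> {\<iota>\<in>{..<m} \<times> insert 0 Q. place_of \<iota> \<notin> S} - {\<iota>\<in>{..<m} \<times> insert 0 Q0. place_of \<iota> \<notin> S}"
      then have \<iota>: "\<iota> \<in> Idx" using sub by auto
      from a have b: "fst \<iota> < m" "snd \<iota> \<in> Q" "snd \<iota> \<notin> Q0" by auto
      then have "G \<iota> lam = 1" "G \<iota> mu = 1" using Q(2)[of "snd \<iota>"] by (auto simp: Q0_def bad_primes_def G_def)
      then have "\<And>i. G \<iota> (tri (1, 1) i) = 1" using abs_val_simps(5,6)[OF G_abs[OF \<iota>]] by (simp add: tri_def)
      then show "l (G \<iota>) (tri (1, 1)) = 0" using l by (auto simp: ln_min_def ln_mean_def min_abs_def)
    qed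
  qed (use Q in auto)
  finally show ?thesis using m_pos by (simp add: C_def)
qed

text \<open>Only one term of the product formula survives, and its weight is positive.\<close>

lemma S_unit_one_place:
  assumes "V = {v}" "a \<in> S_units S"
  shows "f v a = 1"
proof -
  have a: "a \<noteq> 0" using assms by (simp add: S_units_def)
  define Q where "Q = Q0 \<union> bad_primes a"
  have Q: "finite Q" "\<And>p. p \<in> Q \<Longrightarrow> prime p" "Q0 \<subseteq> Q" "bad_primes a \<subseteq> Q"
    using Q0 F_finite[OF a] by (auto simp: Q_def bad_primes_def)
  have "0 = (\<Sum>\<iota>\<in>{..<m} \<times> insert 0 Q. ln (G \<iota> a))" using sum_ln_G[OF a Q(1,2,4)] by simp
  also have "\<dots> = real m * (\<Sum>v\<in>V. weight v * ln (f v a)) + (\<Sum>\<iota>\<in>{\<iota>\<in>{..<m} \<times> insert 0 Q. place_of \<iota> \<notin> S}. ln (G \<iota> a))"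
    by (rule sum_places[where h = "\<lambda>g. ln (g a)", OF Q(1,2)]) (use Q(3) a ln_G in \<open>auto simp: Q0_def\<close>)
  also have "(\<Sum>\<iota>\<in>{\<iota>\<in>{..<m} \<times> insert 0 Q. place_of \<iota> \<notin> S}. ln (G \<iota> a)) = 0"
    using S_unit_G[OF assms(2)] Q(2) by (intro sum.neutral) (auto simp: Idx_def)
  finally have "weight v * ln (f v a) = 0" using m_pos by (simp add: assms(1))
  moreover have "weight v > 0" using weight_pos assms by simp
  moreover have "f v a > 0" using abs_val_simps(7)[OF f_abs a] assms by simp
  ultimately show ?thesis by simp
qed

text \<open>Both absolute values take the value 2 at the number 2.\<close>

lemma expo_arch: "\<iota> \<in> Idx \<Longrightarrow> snd \<iota> = 0 \<Longrightarrow> expo \<iota> = 1"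
proof -
  assume \<iota>: "\<iota> \<in> Idx" "snd \<iota> = 0"
  have r: "rep (place_of \<iota>) \<in> Idx" "snd (rep (place_of \<iota>)) = 0" using rep[OF \<iota>(1)] place_of_prime[of "rep (place_of \<iota>)" \<iota>] \<iota> by auto
  have "ln (G \<iota> (of_nat 2)) = expo \<iota> * ln (f (place_of \<iota>) (of_nat 2))" using \<iota> by (intro ln_G) auto
  then show ?thesis unfolding f_def G_two[OF \<iota>] G_two[OF r] by simp
qed

lemma J_arch: "v \<in> A \<Longrightarrow> J v = {\<iota>\<in>{..<m} \<times> {0}. place_of \<iota> = v}"
  using J_sub[of v] A_V rep_A arch_Idx by (auto simp: J_def)

lemma weight_arch: "v \<in> A \<Longrightarrow> weight v = real (card (J v)) / real m"
proof -
  assume v: "v \<in> A"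
  have "(\<Sum>\<iota>\<in>J v. expo \<iota>) = (\<Sum>\<iota>\<in>J v. 1)"
    by (intro sum.cong refl expo_arch) (use arch_Idx in \<open>auto simp: J_arch[OF v]\<close>)
  then show ?thesis by (simp add: weight_def)
qed

lemma sum_card_J: "(\<Sum>v\<in>A. card (J v)) = m"
proof -
  have "(\<Sum>v\<in>A. card (J v)) = (\<Sum>v\<in>place_of ` ({..<m} \<times> {0}). card {\<iota>\<in>{..<m} \<times> {0::nat}. place_of \<iota> = v})"
    unfolding A_def[symmetric] by (rule sum.cong) (simp_all add: J_arch)
  also have "\<dots> = card ({..<m} \<times> {0::nat})"
    using sum.image_gen[of "{..<m} \<times> {0::nat}" "\<lambda>_. 1::nat" place_of] by simp
  finally show ?thesis by simp
qed

text \<open>An embedding and its complex conjugate induce the same absolute value, and at a place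
  that is not real they are different indices.\<close>

lemma card_J: "v \<in> A \<Longrightarrow> card (J v) \<ge> (if real_place v then 1 else 2)"
proof -
  assume v: "v \<in> A"
  have vV: "v \<in> V" using v A_V by blast
  note r = rep_V[OF vV] rep_A[OF v]
  let ?i = "fst (rep v)"
  have i: "?i < m" using IdxD r by blast
  obtain j where j: "j < m" "\<And>x. \<sigma> j x = cnj (\<sigma> ?i x)" using \<sigma>_cnj[OF i] by blast
  have "G (j, 0) = G (rep v)" using r(3) j(2) by (auto simp: G_def F_def)
  then have "place_of (j, 0) = v" using r by (simp add: place_of_def)
  then have sub: "{rep v, (j, 0)} \<subseteq> J v" using r j by (auto simp: J_def Idx_def)
  then have "card {rep v, (j, 0)} \<le> card (J v)" by (rule card_mono[OF finite_J[OF vV]])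
  moreover have "rep v \<noteq> (j, 0)" if "\<not> real_place v"
  proof
    assume "rep v = (j, 0)"
    then have "\<sigma> j x = cnj (\<sigma> j x)" for x using j(2)[of x] by simp
    then have "Im (\<sigma> j x) = 0" for x by (metis Reals_cnj_iff complex_is_Real_iff)
    then show False using that \<open>rep v = (j, 0)\<close> by (simp add: real_place_def emb_def)
  qed
  ultimately show ?thesis by (cases "rep v = (j, 0)") auto
qed

lemma emb_simps:
  assumes "v \<in> A"
  shows "emb v (x + y) = emb v x + emb v y" "emb v (x * y) = emb v x * emb v y" "emb v x = 0 \<longleftrightarrow> x = 0"
    "f v = (\<lambda>x. cmod (emb v x))"
proof -
  have i: "fst (rep v) < m" "snd (rep v) = 0" using assms A_V rep_V IdxD rep_A by blast+
  then show "emb v (x + y) = emb v x + emb v y" "emb v (x * y) = emb v x * emb v y" "emb v x = 0 \<longleftrightarrow> x = 0"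
    "f v = (\<lambda>x. cmod (emb v x))"
    using \<sigma>_add \<sigma>_mult \<sigma>_eq_0_iff by (auto simp: emb_def f_def G_def F_def)
qed

lemma tri_inj: "inj_on tri sols"
proof (rule inj_onI)
  fix z z' assume "tri z = tri z'"
  then have "tri z 0 = tri z' 0" "tri z 1 = tri z' 1" by auto
  then show "z = z'" using lam_mu by (simp add: tri_def prod_eq_iff)
qed

lemma cross_tri:
  assumes z: "z \<in> sols" "z' \<in> sols" and ne: "tri z \<noteq> tri z'"
  shows "cross (tri z) (tri z') \<noteq> 0"
proof
  assume "cross (tri z) (tri z') = 0"
  have s: "tri z 0 + tri z 1 + tri z 2 = 0" "tri z' 0 + tri z' 1 + tri z' 2 = 0"
    using tri_zero_sum_triple z by (auto simp: zero_sum_triple_def)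
  have t: "tri z 2 = -1" "tri z' 2 = -1" by (simp_all add: tri_def)
  have "tri z 0 = tri z' 0" using \<open>cross _ _ = 0\<close> cross_rot(1)[OF s, of 2] t by simp
  moreover have "tri z 1 = tri z' 1" using s t calculation by (simp add: add_eq_0_iff2 eq_diff_eq[symmetric])
  ultimately have "tri z = tri z'" by (auto simp: tri_def fun_eq_iff)
  then show False using ne by blast
qed

lemma sols_unit_equation:
  assumes "card V \<ge> 2" "sols \<noteq> {}"
  shows "unit_equation V A f emb real_place weight (tri ` sols) (C ln_min) (C ln_mean) (G ` {\<iota>\<in>Idx. place_of \<iota> \<notin> S})"
proof
  show "finite V" "card V \<ge> 2" "A \<subseteq> V" using finite_V assms A_V by auto
  fix v
  show "weight v > 0" if "v \<in> V" using weight_pos[OF that] .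
  have "(\<Sum>v\<in>A. weight v) = real (\<Sum>v\<in>A. card (J v)) / real m" by (simp add: weight_arch sum_divide_distrib)
  then show "sum weight A = 1" using sum_card_J m_pos by simp
  show "f v = (\<lambda>z. cmod (emb v z))" "emb v (z + z') = emb v z + emb v z'" "emb v (z * z') = emb v z * emb v z'"
    "emb v z = 0 \<longleftrightarrow> z = 0" if "v \<in> A" for z z' using emb_simps[OF that] by auto
  show "Im (emb v z) = 0" if "real_place v" for z using that by (simp add: real_place_def)
  have ultra_G: "ultra (G \<iota>)" if "\<iota> \<in> Idx" "snd \<iota> \<noteq> 0" for \<iota>
    using that G_abs[OF that(1)] F_ultra[of "fst \<iota>" "snd \<iota>"] IdxD[OF that(1)] by (auto simp: ultra_def G_def)
  show "ultra (f v)" if v: "v \<in> V - A"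
  proof -
    have "snd (rep v) \<noteq> 0"
    proof
      assume "snd (rep v) = 0"
      then have "rep v \<in> {..<m} \<times> {0}" using IdxD(1) rep_V(1) v by (cases "rep v") fastforce
      then show False using v rep_V(2) by (metis A_def DiffD1 DiffD2 imageI)
    qed
    then show ?thesis using ultra_G rep_V v by (simp add: f_def)
  qed
  show "ultra g" if "g \<in> G ` {\<iota>\<in>Idx. place_of \<iota> \<notin> S}" for g using that ultra_G arch_in_S by auto
  show "g (x i) = g (y i)" if "g \<in> G ` {\<iota>\<in>Idx. place_of \<iota> \<notin> S}" "x \<in> tri ` sols" "y \<in> tri ` sols" for g x y i
    using that tri_out by fastforce
  show "zero_sum_triple x" if "x \<in> tri ` sols" for x using that tri_zero_sum_triple by auto
  show "cross x y \<noteq> 0" if "x \<in> tri ` sols" "y \<in> tri ` sols" "x \<noteq> y" for x y using that cross_tri by auto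
  obtain z0 where z0: "z0 \<in> sols" using assms by blast
  show "C ln_min \<le> C ln_mean" unfolding C_def
  proof (intro divide_right_mono sum_mono)
    fix \<iota> assume "\<iota> \<in> {\<iota>\<in>{..<m} \<times> insert 0 Q0. place_of \<iota> \<notin> S}"
    then have \<iota>: "\<iota> \<in> Idx" "place_of \<iota> \<notin> S" using Q0 by (auto simp: Idx_def)
    show "ln_min (G \<iota>) (tri (1, 1)) \<le> ln_mean (G \<iota>) (tri (1, 1))"
      using ln_min_le_ln_mean[OF G_abs[OF \<iota>(1)] tri_zero_sum_triple[OF z0]] tri_out_ln_min[OF z0 \<iota>] by simp
  qed simp
  show "(\<Sum>v\<in>V. weight v * ln_min (f v) x) + C ln_min = -2 * ((\<Sum>v\<in>V. weight v * ln_mean (f v) x) + C ln_mean)" if x: "x \<in> tri ` sols" for x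
  proof -
    obtain z where z: "z \<in> sols" "x = tri z" using x by blast
    have nz: "x 0 \<noteq> 0" "x 1 \<noteq> 0" "x 2 \<noteq> 0" using tri_zero_sum_triple z by (auto simp: zero_sum_triple_def)
    define Q where "Q = Q0 \<union> bad_primes (x 0) \<union> bad_primes (x 1) \<union> bad_primes (x 2)"
    have Q: "finite Q" "\<And>p. p \<in> Q \<Longrightarrow> prime p" "Q0 \<subseteq> Q"
      using Q0 bad_primes nz unfolding Q_def by blast+
    have Q4: "(snd \<circ> rep) ` V - {0} \<subseteq> Q" using Q0_rep Q(3) by (rule order.trans)
    have s: "(\<Sum>\<iota>\<in>{..<m} \<times> insert 0 Q. ln (G \<iota> (x i))) = 0" if "i = 0 \<or> i = 1 \<or> i = 2" for i
      using that nz Q(1,2) by (intro sum_ln_G) (auto simp: Q_def)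
    \<comment> \<open>The minimum plus twice the mean is the sum of the logarithms of all three
      coordinates, and the product formula applies to each coordinate.\<close>
    have "(\<Sum>\<iota>\<in>{..<m} \<times> insert 0 Q. ln_min (G \<iota>) x) + 2 * (\<Sum>\<iota>\<in>{..<m} \<times> insert 0 Q. ln_mean (G \<iota>) x)
      = (\<Sum>\<iota>\<in>{..<m} \<times> insert 0 Q. ln (G \<iota> (x 0)) + ln (G \<iota> (x 1)) + ln (G \<iota> (x 2)))"
      unfolding sum_distrib_left sum.distrib[symmetric] by (rule sum.cong) (simp_all add: ln_mean_def field_simps)
    also have "\<dots> = 0" using s[of 0] s[of 1] s[of 2] by (simp only: sum.distrib) simp
    finally have 0: "(\<Sum>\<iota>\<in>{..<m} \<times> insert 0 Q. ln_min (G \<iota>) x) + 2 * (\<Sum>\<iota>\<in>{..<m} \<times> insert 0 Q. ln_mean (G \<iota>) x) = 0" .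
    have 1: "(\<Sum>\<iota>\<in>{..<m} \<times> insert 0 Q. ln_min (G \<iota>) x) = real m * (\<Sum>v\<in>V. weight v * ln_min (f v) x) + real m * C ln_min"
      unfolding sum_out[OF z(1) Q(1,2,3), of ln_min, simplified, folded z(2), symmetric]
      by (rule sum_places[OF Q(1,2) Q4]) (use ln_min_G in auto)
    have 2: "(\<Sum>\<iota>\<in>{..<m} \<times> insert 0 Q. ln_mean (G \<iota>) x) = real m * (\<Sum>v\<in>V. weight v * ln_mean (f v) x) + real m * C ln_mean"
      unfolding sum_out[OF z(1) Q(1,2,3), of ln_mean, simplified, folded z(2), symmetric]
      by (rule sum_places[OF Q(1,2) Q4]) (use ln_mean_G[OF _ tri_zero_sum_triple[OF z(1), folded z(2)]] in auto)
    have "real m * ((\<Sum>v\<in>V. weight v * ln_min (f v) x) + C ln_min + 2 * ((\<Sum>v\<in>V. weight v * ln_mean (f v) x) + C ln_mean)) = 0"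
      using 0 unfolding 1 2 by (simp only: distrib_left mult.left_commute[of _ 2])
    then show ?thesis using m_pos by simp
  qed
  show "0 \<le> (\<Sum>v\<in>V. weight v * ln (f v D)) + real r * C ln_mean + C ln_min"
    if D: "D \<noteq> 0" and le: "\<And>g x. g \<in> G ` {\<iota>\<in>Idx. place_of \<iota> \<notin> S} \<Longrightarrow> x \<in> tri ` sols \<Longrightarrow> ln (g D) \<le> real r * ln_mean g x + ln_min g x" for D r
  proof -
    define Q where "Q = Q0 \<union> bad_primes D"
    have Q: "finite Q" "\<And>p. p \<in> Q \<Longrightarrow> prime p" "Q0 \<subseteq> Q"
      using Q0 bad_primes D unfolding Q_def by blast+
    have Q4: "(snd \<circ> rep) ` V - {0} \<subseteq> Q" using Q0_rep Q(3) by (rule order.trans)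
    let ?O = "{\<iota>\<in>{..<m} \<times> insert 0 Q. place_of \<iota> \<notin> S}"
    have O: "?O \<subseteq> {\<iota>\<in>Idx. place_of \<iota> \<notin> S}" using Q(2) by (auto simp: Idx_def)
    have "0 = (\<Sum>\<iota>\<in>{..<m} \<times> insert 0 Q. ln (G \<iota> D))" using sum_ln_G[OF D Q(1,2)] by (simp add: Q_def)
    also have "\<dots> = real m * (\<Sum>v\<in>V. weight v * ln (f v D)) + (\<Sum>\<iota>\<in>?O. ln (G \<iota> D))"
      by (rule sum_places[where h = "\<lambda>g. ln (g D)", OF Q(1,2) Q4]) (use D ln_G in auto)
    also have "(\<Sum>\<iota>\<in>?O. ln (G \<iota> D)) \<le> (\<Sum>\<iota>\<in>?O. real r * ln_mean (G \<iota>) (tri z0) + ln_min (G \<iota>) (tri z0))"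
      by (intro sum_mono le) (use O z0 in auto)
    also have "\<dots> = real r * (real m * C ln_mean) + real m * C ln_min"
      using sum_out[OF z0 Q(1,2,3), of ln_mean] sum_out[OF z0 Q(1,2,3), of ln_min] by (simp add: sum.distrib sum_distrib_left[symmetric])
    finally have "0 \<le> real m * ((\<Sum>v\<in>V. weight v * ln (f v D)) + real r * C ln_mean + C ln_min)" by (simp add: algebra_simps)
    then show ?thesis using m_pos by (simp add: zero_le_mult_iff)
  qed
qed

end

section \<open>Numerical comparison and the case of a single place\<close>

lemma prod_weights_bound:
  fixes d :: "'v \<Rightarrow> nat"
  assumes V: "finite V" "A \<subseteq> V" "A \<noteq> {}" and d: "\<And>v. v \<in> A \<Longrightarrow> d v \<ge> (if real_place v then 1 else 2)"
  shows "21 * (42/125) * (\<Prod>v\<in>V. if v \<in> A then (if real_place v then 405/4 else 1215/4) else 45) + (\<Prod>v\<in>A. if real_place v then 27 else 378)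
    \<le> (5 * 3.4 ^ sum d A * 45 ^ card V :: real)"
proof -
  define \<alpha> \<beta> \<gamma> :: "'v \<Rightarrow> real" where "\<alpha> = (\<lambda>v. if real_place v then 405/4 else 1215/4)"
    and "\<beta> = (\<lambda>v. if real_place v then 27 else 378)" and "\<gamma> = (\<lambda>v. 3.4 ^ d v * 45)"
  have finA: "finite A" using V finite_subset by blast
  have pw: "(17/5::real) ^ k \<le> (17/5) ^ d v" if "v \<in> A" "k \<le> (if real_place v then 1 else 2)" for k v
    using d[OF that(1)] that(2) by (intro power_increasing) auto
  have \<gamma>: "\<gamma> v \<ge> (if real_place v then 153 else 2601/5)" if "v \<in> A" for v
    using pw[OF that, of 1] pw[OF that, of 2] by (auto simp: \<gamma>_def power2_eq_square)
  have le: "\<alpha> v \<le> \<gamma> v" "\<beta> v \<le> \<gamma> v" if "v \<in> A" for v using \<gamma>[OF that] by (auto simp: \<alpha>_def \<beta>_def split: if_splits)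
  have nn: "\<alpha> v \<ge> 0" "\<beta> v \<ge> 0" "\<gamma> v \<ge> 0" for v by (auto simp: \<alpha>_def \<beta>_def \<gamma>_def)
  \<comment> \<open>At all archimedean places but one, both factors are below 3.4 * 45 = 153 or
    3.4^2 * 45 = 520.2. At \<open>v0\<close> the sum with coefficient 21 * 42/125 = 7.056 is
    compared with five times that: 741.42 \<le> 765 if it is real, 2521.26 \<le> 2601 if
    not.\<close>
  obtain v0 where v0: "v0 \<in> A" using V(3) by blast
  let ?A = "A - {v0}" and ?K = "45 ^ card (V - A) :: real"
  have "(\<Prod>v\<in>V. if v \<in> A then \<alpha> v else 45) = (\<Prod>v\<in>A. if v \<in> A then \<alpha> v else 45) * (\<Prod>v\<in>V - A. if v \<in> A then \<alpha> v else 45)"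
    using prod.subset_diff[OF V(2,1), of "\<lambda>v. if v \<in> A then \<alpha> v else 45"] by (simp only: mult.commute)
  then have P: "(\<Prod>v\<in>V. if v \<in> A then \<alpha> v else 45) = \<alpha> v0 * prod \<alpha> ?A * ?K"
    using prod.remove[OF finA v0, of \<alpha>] by simp
  have "21 * (42/125) * (\<Prod>v\<in>V. if v \<in> A then \<alpha> v else 45) + prod \<beta> A
     \<le> 21 * (42/125) * (\<alpha> v0 * prod \<gamma> ?A * ?K) + \<beta> v0 * prod \<gamma> ?A * ?K"
  proof (rule add_mono)
    have "prod \<alpha> ?A \<le> prod \<gamma> ?A" using le nn by (intro prod_mono) auto
    then show "21 * (42/125) * (\<Prod>v\<in>V. if v \<in> A then \<alpha> v else 45) \<le> 21 * (42/125) * (\<alpha> v0 * prod \<gamma> ?A * ?K)"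
      unfolding P using nn by (intro mult_left_mono mult_right_mono) auto
    have "prod \<beta> A = \<beta> v0 * prod \<beta> ?A * 1" using prod.remove[OF finA v0, of \<beta>] by simp
    also have "\<dots> \<le> \<beta> v0 * prod \<gamma> ?A * ?K"
      using le nn by (intro mult_mono prod_mono order.refl mult_nonneg_nonneg prod_nonneg) auto
    finally show "prod \<beta> A \<le> \<beta> v0 * prod \<gamma> ?A * ?K" .
  qed
  also have "\<dots> = (21 * (42/125) * \<alpha> v0 + \<beta> v0) * (prod \<gamma> ?A * ?K)" by (simp add: algebra_simps)
  also have "\<dots> \<le> (5 * \<gamma> v0) * (prod \<gamma> ?A * ?K)"
  proof (rule mult_right_mono)
    show "21 * (42/125) * \<alpha> v0 + \<beta> v0 \<le> 5 * \<gamma> v0" using \<gamma>[OF v0] by (auto simp: \<alpha>_def \<beta>_def split: if_splits)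
  qed (use nn in \<open>auto intro!: mult_nonneg_nonneg prod_nonneg\<close>)
  also have "\<dots> = 5 * prod \<gamma> A * ?K" using prod.remove[OF finA v0, of \<gamma>] by simp
  also have "prod \<gamma> A = 3.4 ^ sum d A * 45 ^ card A" by (simp add: \<gamma>_def prod.distrib power_sum)
  also have "5 * (3.4 ^ sum d A * 45 ^ card A) * ?K = (5 * 3.4 ^ sum d A * 45 ^ card V :: real)"
    using card_mono[OF V(1,2)] by (simp add: card_Diff_subset[OF finA V(2)] flip: power_add)
  finally show ?thesis unfolding \<alpha>_def \<beta>_def .
qed

lemma two_circles:
  "finite {z. cmod z = r \<and> cmod (1 - z) = t}" "card {z. cmod z = r \<and> cmod (1 - z) = t} \<le> 2"
proof -
  define a where "a = (1 + r\<^sup>2 - t\<^sup>2) / 2"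
  define b where "b = sqrt (r\<^sup>2 - a\<^sup>2)"
  have sub: "{z. cmod z = r \<and> cmod (1 - z) = t} \<subseteq> {Complex a b, Complex a (- b)}"
  proof
    fix z assume "z \<in> {z. cmod z = r \<and> cmod (1 - z) = t}"
    then have "cmod z ^ 2 = r\<^sup>2" "cmod (1 - z) ^ 2 = t\<^sup>2" by auto
    then have e: "(Re z)\<^sup>2 + (Im z)\<^sup>2 = r\<^sup>2" "(1 - Re z)\<^sup>2 + (Im z)\<^sup>2 = t\<^sup>2" by (simp_all add: cmod_power2)
    have re: "Re z = a" using e unfolding a_def by (simp add: power2_eq_square algebra_simps)
    have "(Im z)\<^sup>2 = r\<^sup>2 - a\<^sup>2" using e(1) re by simp
    then have "b = \<bar>Im z\<bar>" by (simp add: b_def flip: real_sqrt_abs)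
    then show "z \<in> {Complex a b, Complex a (- b)}" using re by (auto simp: complex_eq_iff abs_if split: if_splits)
  qed
  then show "finite {z. cmod z = r \<and> cmod (1 - z) = t}" by (rule finite_subset) simp
  have "card {z. cmod z = r \<and> cmod (1 - z) = t} \<le> card {Complex a b, Complex a (- b)}" using sub by (intro card_mono) auto
  also have "\<dots> \<le> 2" by (simp add: card_insert_if)
  finally show "card {z. cmod z = r \<and> cmod (1 - z) = t} \<le> 2" .
qed

context s_unit_equation
begin

lemma A_nonempty: "A \<noteq> {}" using m_pos by (auto simp: A_def)

text \<open>By \<open>S_unit_one_place\<close> the image of \<open>lam * x\<close> lies on the
  circle of radius |lam| around 0 and on that of radius |mu| around 1, which meet in at most two
  points.\<close>

lemma sols_one_place:
  assumes "V = {v}"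
  shows "finite sols \<and> card sols \<le> 2"
proof -
  have v: "v \<in> A" using A_V A_nonempty assms by auto
  note e = emb_simps[OF v]
  define Z where "Z = {z. cmod z = cmod (emb v lam) \<and> cmod (1 - z) = cmod (emb v mu)}"
  have one: "emb v 1 = 1" using e(2)[of 1 1] e(3)[of 1] by auto
  have inj: "inj_on (\<lambda>z. emb v (lam * fst z)) sols"
  proof (rule inj_onI)
    fix z z' assume z: "z \<in> sols" "z' \<in> sols" "emb v (lam * fst z) = emb v (lam * fst z')"
    have "emb v (lam * fst z) = emb v (lam * fst z - lam * fst z') + emb v (lam * fst z')" unfolding e(1)[symmetric] by simp
    then have "lam * fst z - lam * fst z' = 0" using z(3) e(3) by simp
    then have "fst z = fst z'" using lam_mu by simp
    moreover have "lam * fst z + mu * snd z = 1" "lam * fst z' + mu * snd z' = 1" using z by (auto simp: sols_def)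
    ultimately have "mu * snd z = mu * snd z'" by (metis add_left_imp_eq)
    then show "z = z'" using lam_mu \<open>fst z = fst z'\<close> by (simp add: prod_eq_iff)
  qed
  have sub: "(\<lambda>z. emb v (lam * fst z)) ` sols \<subseteq> Z"
  proof (rule image_subsetI)
    fix z assume "z \<in> sols"
    then have z: "fst z \<in> S_units S" "snd z \<in> S_units S" "lam * fst z + mu * snd z = 1" by (auto simp: sols_def)
    have n: "cmod (emb v (fst z)) = 1" "cmod (emb v (snd z)) = 1"
      using S_unit_one_place[OF assms] z(1,2) e(4) by auto
    have "emb v (lam * fst z) + emb v (mu * snd z) = 1" using e(1)[of "lam * fst z" "mu * snd z"] z(3) one by simp
    then have "1 - emb v (lam * fst z) = emb v (mu * snd z)" by (simp add: algebra_simps)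
    then show "emb v (lam * fst z) \<in> Z" using n by (simp add: Z_def e(2) norm_mult)
  qed
  have "finite Z" "card Z \<le> 2" using two_circles by (auto simp: Z_def)
  then show ?thesis using inj_on_finite[OF inj sub] card_inj_on_le[OF inj sub] by auto
qed

theorem card_sols: "finite sols \<and> real (card sols) \<le> (3.1 + 5 * 3.4 ^ m) * 45 ^ card S"
proof (cases "sols = {}")
  case False
  have cV: "card V \<le> card S" using S by (intro card_mono) (auto simp: V_def)
  have V1: "card V \<ge> 1" using A_V A_nonempty finite_V by (simp add: Suc_le_eq card_gt_0_iff) blast
  show ?thesis
  proof (cases "card V \<ge> 2")
    case True
    interpret U: unit_equation V A f emb real_place weight "tri ` sols" "C ln_min" "C ln_mean" "G ` {\<iota>\<in>Idx. place_of \<iota> \<notin> S}"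
      by (rule sols_unit_equation[OF True False])
    have fin: "finite sols" using U.card_solutions(1) finite_imageD[OF _ tri_inj] by blast
    have "real (card sols) = real (card (tri ` sols))" by (simp add: card_image[OF tri_inj])
    also have "\<dots> \<le> 5 * 3.4 ^ (\<Sum>v\<in>A. card (J v)) * 45 ^ card V"
      by (rule order.trans[OF U.card_solutions(2) prod_weights_bound[OF finite_V A_V A_nonempty]]) (rule card_J)
    also have "\<dots> \<le> (3.1 + 5 * 3.4 ^ m) * 45 ^ card S"
      unfolding sum_card_J using cV by (intro mult_mono power_increasing) auto
    finally show ?thesis using fin by simp
  next
    case False
    then obtain v where v: "V = {v}" using V1 by (metis card_1_singletonE le_antisym not_less_eq_eq numeral_2_eq_2 One_nat_def)
    have "real (card sols) \<le> 2" using sols_one_place[OF v] by simp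
    also have "2 \<le> (3.1 + 5 * 3.4 ^ m) * (45 ^ card S :: real)"
    proof -
      have "2 * 1 \<le> (3.1 + 5 * 3.4 ^ m) * (45 ^ card S :: real)" by (intro mult_mono add_increasing2) auto
      then show ?thesis by simp
    qed
    finally show ?thesis using sols_one_place[OF v] by simp
  qed
qed simp

end

theorem theorem1p1:
  fixes lam mu :: "'k::field_char_0"
    and S :: "('k \<Rightarrow> real) set set"
    and m s :: nat
  assumes "number_field TYPE('k)"
    and "m = field_degree TYPE('k)"
    and "S \<subseteq> places"
    and "finite S"
    and "\<And>v. v \<in> places \<Longrightarrow> archimedean v \<Longrightarrow> v \<in> S"
    and "s = card S"
    and "lam \<noteq> 0"
    and "mu \<noteq> 0"
  shows "finite {(x, y). x \<in> S_units S \<and> y \<in> S_units S \<and> lam * x + mu * y = 1} \<and>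
         real (card {(x, y). x \<in> S_units S \<and> y \<in> S_units S \<and> lam * x + mu * y = 1})
           \<le> (3.1 + 5 * 3.4 ^ m) * 45 ^ s"
proof -
  obtain \<sigma> :: "nat \<Rightarrow> 'k \<Rightarrow> complex" where \<sigma>: "embeddings m \<sigma>"
  proof (rule exists_embeddings[OF assms(1)], goal_cases)
    case (1 \<sigma>)
    show ?case by (rule that, unfold assms(2), rule embeddings.intro) (fact assms(1) 1)+
  qed
  interpret embeddings m \<sigma> by (rule \<sigma>)
  have "\<exists>v. padic_absolute_value p v" if "prime p" for p
  proof (rule exists_padic_absolute_value[OF that, where 'a = complex], goal_cases)
    case (1 v)
    have "padic_absolute_value p v" by (rule padic_absolute_value.intro) (fact 1)+
    then show ?case by blast
  qed
  then obtain w where w: "\<And>p. prime p \<Longrightarrow> padic_absolute_value p (w p)" by metis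
  interpret padic_embeddings m \<sigma> w
    by (intro padic_embeddings.intro \<sigma> padic_embeddings_axioms.intro w)
  interpret s_unit_equation m \<sigma> w S lam mu
    by unfold_locales (fact assms)+
  show ?thesis using card_sols unfolding sols_def assms(6) .
qed

end
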